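(* Let $(A,\tau)$ be a trace-reduced tracial $*$-algebra and suppose that $A$ admits a countably generated dense subalgebra (dense in the topology induced by the $p$-norms). Let $\omega$ be a non-principal ultrafilter on $\mathbb{N}=\{1,2,\dots\}$. Then there exist trace-reduced tracial $*$-algebras $(A_n,\tau_n)$ of type I$_{\leq n}$ ($n\in\mathbb{N}$) and a trace-preserving embedding (an injective $*$-algebra homomorphism preserving the traces) into the metric ultraproduct $$\iota\colon (A,\tau)\hookrightarrow\prod_{n\to\omega}(A_n,\tau_n).$$
   Context: A tracial $*$-algebra $(A,\tau)$ is a unital complex algebra $A$ with involution together with a $\mathbb{C}$-linear functional $\tau\colon A\to\mathbb{C}$ (a "positive trace") with $\tau(1)=1$, $\tau(a^*a)\ge 0$ and $\tau(ab)=\tau(ba)$ for all $a,b\in A$. It is trace-reduced if $\tau(a^*a)=0$ implies $a=0$. It is of type I$_{\leq k}$ if it satisfies the polynomial identity $j_k=\sum_{\sigma\in S_{2k}}\mathrm{sgn}(\sigma)X_{\sigma(1)}\cdots X_{\sigma(2k)}$, i.e. $j_k(a_1,\dots,a_{2k})=0$ for all $a_1,\dots,a_{2k}\in A$. For even $p\ge 2$ put $\|a\|_p=\tau((a^*a)^{p/2})^{1/p}$. The topology induced by the $p$-norms on a trace-reduced tracial $*$-algebra is the (metrizable) vector space topology for which the sets $\{a:\|a\|_p<1/n\}$, $n\ge1$, $p\geq 2$ even, form a subbasis of neighborhoods of $0$. Metric ultraproduct: given tracial $*$-algebras $(A_i,\tau_i)$, $i\in I$, and an ultrafilter $\omega$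 on $I$, let $\widetilde{\prod}_{i}(A_i,\tau_i)$ be the $*$-algebra of all $(a_i)_i\in\prod_i A_i$ such that $(\|a_i\|_p)_{i\in I}$ is bounded for every even $p$. On it, $\tau_\omega((a_i)_i)=\lim_{i\to\omega}\tau_i(a_i)$ is a positive trace, $Z_{\tau_\omega}=\{x : \tau_\omega(x^*x)=0\}$ is a two-sided $*$-ideal on which $\tau_\omega$ vanishes, and the metric ultraproduct is $\prod_{i\to\omega}(A_i,\tau_i):=\widetilde{\prod}_i(A_i,\tau_i)/Z_{\tau_\omega}$ with the trace induced by $\tau_\omega$. *)

theory Defs
  imports
    Complex_Main
    "HOL-Library.Countable_Set"
    "HOL-Library.FuncSet"
    "HOL-Library.Nonpos_Ints"
    "HOL-Combinatorics.Permutations"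
    "HOL-Analysis.Abstract_Topology"
    "HOL-Algebra.Module"
    "HOL-Algebra.QuotRing"
    "HOL-Algebra.Subrings"
begin

section \<open>Tracial star-algebras\<close>

definition complex_ring :: "complex ring"
  where "complex_ring = \<lparr>carrier = UNIV, mult = (*), one = 1, zero = 0, add = (+)\<rparr>"

record 'b tracial_algebra = "(complex, 'b) module" +
  invol :: "'b \<Rightarrow> 'b"
  tau :: "'b \<Rightarrow> complex"

text \<open>The locale algebra of HOL-Algebra requires the algebra to be commutative, so the
  noncommutative notion is assembled here from the locales module and ring. Positivity of the
  trace is membership in the set of nonnegative reals, viewed inside the complex numbers.\<close>

locale tracial_star_algebra = Module.module complex_ring A + ring A
  for A :: "('b, 'm) tracial_algebra_scheme" (structure) +
  assumes smult_mult_left: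
      "x \<in> carrier A \<Longrightarrow> y \<in> carrier A \<Longrightarrow> (c \<odot> x) \<otimes> y = c \<odot> (x \<otimes> y)"
    and smult_mult_right:
      "x \<in> carrier A \<Longrightarrow> y \<in> carrier A \<Longrightarrow> x \<otimes> (c \<odot> y) = c \<odot> (x \<otimes> y)"
    and invol_closed: "x \<in> carrier A \<Longrightarrow> invol A x \<in> carrier A"
    and invol_invol: "x \<in> carrier A \<Longrightarrow> invol A (invol A x) = x"
    and invol_add:
      "x \<in> carrier A \<Longrightarrow> y \<in> carrier A \<Longrightarrow> invol A (x \<oplus> y) = invol A x \<oplus> invol A y"
    and invol_smult: "x \<in> carrier A \<Longrightarrow> invol A (c \<odot> x) = cnj c \<odot> invol A x"
    and invol_mult:
      "x \<in> carrier A \<Longrightarrow> y \<in> carrier A \<Longrightarrow> invol A (x \<otimes> y) = invol A y \<otimes> invol A x"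
    and tau_add: "x \<in> carrier A \<Longrightarrow> y \<in> carrier A \<Longrightarrow> tau A (x \<oplus> y) = tau A x + tau A y"
    and tau_smult: "x \<in> carrier A \<Longrightarrow> tau A (c \<odot> x) = c * tau A x"
    and tau_one: "tau A \<one> = 1"
    and tau_positive: "x \<in> carrier A \<Longrightarrow> tau A (invol A x \<otimes> x) \<in> \<real>\<^sub>\<ge>\<^sub>0"
    and tau_commute: "x \<in> carrier A \<Longrightarrow> y \<in> carrier A \<Longrightarrow> tau A (x \<otimes> y) = tau A (y \<otimes> x)"

locale trace_reduced_algebra = tracial_star_algebra A for A (structure) +
  assumes trace_reduced: "x \<in> carrier A \<Longrightarrow> tau A (invol A x \<otimes> x) = 0 \<Longrightarrow> x = \<zero>"

definition standard_identity :: "('b, 'm) tracial_algebra_scheme \<Rightarrow> nat \<Rightarrow> (nat \<Rightarrow> 'b) \<Rightarrow> 'b"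
  where "standard_identity A k a =
    (\<Oplus>\<^bsub>A\<^esub>\<sigma>\<in>{\<sigma>. \<sigma> permutes {1..2 * k}}.
      of_int (sign \<sigma>) \<odot>\<^bsub>A\<^esub> foldr (mult A) (map (\<lambda>i. a (\<sigma> i)) [1..<Suc (2 * k)]) \<one>\<^bsub>A\<^esub>)"

definition type_I_le :: "nat \<Rightarrow> ('b, 'm) tracial_algebra_scheme \<Rightarrow> bool"
  where "type_I_le k A \<longleftrightarrow>
    (\<forall>a \<in> {1..2 * k} \<rightarrow> carrier A. standard_identity A k a = \<zero>\<^bsub>A\<^esub>)"

section \<open>The p-norms and their topology\<close>

text \<open>Only used for even \<open>p \<ge> 2\<close>, in which case the trace below is a nonnegative real.\<close>

definition pnorm :: "('b, 'm) tracial_algebra_scheme \<Rightarrow> nat \<Rightarrow> 'b \<Rightarrow> real"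
  where "pnorm A p a = root p (Re (tau A ((invol A a \<otimes>\<^bsub>A\<^esub> a) [^]\<^bsub>A\<^esub> (p div 2))))"

definition pnorm_nbhd :: "('b, 'm) tracial_algebra_scheme \<Rightarrow> (nat \<times> nat) set \<Rightarrow> 'b set"
  where "pnorm_nbhd A F = {a \<in> carrier A. \<forall>(n, p)\<in>F. pnorm A p a < 1 / real n}"

definition pnorm_open :: "('b, 'm) tracial_algebra_scheme \<Rightarrow> 'b set \<Rightarrow> bool"
  where "pnorm_open A U \<longleftrightarrow> U \<subseteq> carrier A \<and>
    (\<forall>a\<in>U. \<exists>F \<subseteq> {(n, p). 1 \<le> n \<and> 2 \<le> p \<and> even p}. finite F \<and>
      (\<forall>x \<in> pnorm_nbhd A F. a \<oplus>\<^bsub>A\<^esub> x \<in> U))"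

definition pnorm_topology :: "('b, 'm) tracial_algebra_scheme \<Rightarrow> 'b topology"
  where "pnorm_topology A = topology (pnorm_open A)"

lemma istopology_pnorm_open: "istopology (pnorm_open A)"
  unfolding istopology_def
proof (intro conjI allI impI)
  let ?E = "{(n, p). 1 \<le> n \<and> 2 \<le> p \<and> even p} :: (nat \<times> nat) set"
  fix S T assume S: "pnorm_open A S" and T: "pnorm_open A T"
  have "\<exists>H\<subseteq>?E. finite H \<and> (\<forall>x \<in> pnorm_nbhd A H. a \<oplus>\<^bsub>A\<^esub> x \<in> S \<inter> T)" if a: "a \<in> S \<inter> T" for a
  proof -
    obtain F where F: "F \<subseteq> ?E" "finite F" "\<forall>x \<in> pnorm_nbhd A F. a \<oplus>\<^bsub>A\<^esub> x \<in> S"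
      using S a unfolding pnorm_open_def by (meson IntD1)
    obtain G where G: "G \<subseteq> ?E" "finite G" "\<forall>x \<in> pnorm_nbhd A G. a \<oplus>\<^bsub>A\<^esub> x \<in> T"
      using T a unfolding pnorm_open_def by (meson IntD2)
    have "pnorm_nbhd A (F \<union> G) \<subseteq> pnorm_nbhd A F" "pnorm_nbhd A (F \<union> G) \<subseteq> pnorm_nbhd A G"
      by (auto simp: pnorm_nbhd_def)
    with F(3) G(3) have "\<forall>x \<in> pnorm_nbhd A (F \<union> G). a \<oplus>\<^bsub>A\<^esub> x \<in> S \<inter> T"
      by blast
    moreover have "F \<union> G \<subseteq> ?E" "finite (F \<union> G)"
      using F(1,2) G(1,2) by (simp_all only: Un_least finite_Un)
    ultimately show ?thesis by blast
  qed
  moreover have "S \<inter> T \<subseteq> carrier A"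
    using S unfolding pnorm_open_def by blast
  ultimately show "pnorm_open A (S \<inter> T)"
    unfolding pnorm_open_def by simp
next
  let ?E = "{(n, p). 1 \<le> n \<and> 2 \<le> p \<and> even p} :: (nat \<times> nat) set"
  fix K assume K: "\<forall>S\<in>K. pnorm_open A S"
  have "\<exists>H\<subseteq>?E. finite H \<and> (\<forall>x \<in> pnorm_nbhd A H. a \<oplus>\<^bsub>A\<^esub> x \<in> \<Union>K)" if a: "a \<in> \<Union>K" for a
  proof -
    obtain S where S: "S \<in> K" "a \<in> S" using a by (rule UnionE)
    have "pnorm_open A S" using K S(1) by (rule bspec)
    then obtain F where F: "F \<subseteq> ?E" "finite F" "\<forall>x \<in> pnorm_nbhd A F. a \<oplus>\<^bsub>A\<^esub> x \<in> S"
      using S(2) unfolding pnorm_open_def by meson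
    have "\<forall>x \<in> pnorm_nbhd A F. a \<oplus>\<^bsub>A\<^esub> x \<in> \<Union>K" using F(3) S(1) by blast
    with F(1,2) show ?thesis by blast
  qed
  moreover have "\<Union>K \<subseteq> carrier A"
    using K unfolding pnorm_open_def by (simp add: Sup_le_iff)
  ultimately show "pnorm_open A (\<Union>K)"
    unfolding pnorm_open_def by simp
qed

lemma openin_pnorm_topology: "openin (pnorm_topology A) U \<longleftrightarrow> pnorm_open A U"
  by (simp add: pnorm_topology_def topology_inverse'[OF istopology_pnorm_open])

lemma topspace_pnorm_topology:
  assumes "tracial_star_algebra A"
  shows "topspace (pnorm_topology A) = carrier A"
proof (rule subset_antisym)
  interpret tracial_star_algebra A by fact
  have "\<forall>x \<in> pnorm_nbhd A {}. a \<oplus>\<^bsub>A\<^esub> x \<in> carrier A" if "a \<in> carrier A" for a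
    using that by (simp add: pnorm_nbhd_def)
  then have "pnorm_open A (carrier A)"
    unfolding pnorm_open_def by (meson empty_subsetI finite.emptyI subset_refl)
  then show "carrier A \<subseteq> topspace (pnorm_topology A)"
    by (intro openin_subset) (simp add: openin_pnorm_topology)
  have "pnorm_open A (topspace (pnorm_topology A))"
    using openin_topspace[of "pnorm_topology A"] by (simp only: openin_pnorm_topology)
  then show "topspace (pnorm_topology A) \<subseteq> carrier A"
    unfolding pnorm_open_def by (rule conjunct1)
qed

text \<open>Subalgebras are unital; they need not be closed under the involution.\<close>

definition complex_subalgebra :: "'b set \<Rightarrow> ('b, 'm) tracial_algebra_scheme \<Rightarrow> bool"
  where "complex_subalgebra B A \<longleftrightarrow>
    subring B A \<and> (\<forall>c. \<forall>x\<in>B. c \<odot>\<^bsub>A\<^esub> x \<in> B)"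

definition countably_generated :: "'b set \<Rightarrow> ('b, 'm) tracial_algebra_scheme \<Rightarrow> bool"
  where "countably_generated B A \<longleftrightarrow>
    (\<exists>S \<subseteq> carrier A. countable S \<and> B = (\<lambda>C. complex_subalgebra C A) hull S)"

section \<open>Metric ultraproducts\<close>

definition ultrafilter_on :: "'i set \<Rightarrow> 'i filter \<Rightarrow> bool"
  where "ultrafilter_on I \<omega> \<longleftrightarrow>
    \<omega> \<noteq> bot \<and> eventually (\<lambda>i. i \<in> I) \<omega> \<and>
    (\<forall>P. eventually P \<omega> \<or> eventually (\<lambda>i. \<not> P i) \<omega>)"

definition nonprincipal :: "'i filter \<Rightarrow> bool"
  where "nonprincipal \<omega> \<longleftrightarrow> (\<forall>i. \<omega> \<noteq> principal {i})"

definition bounded_product ::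
    "'i set \<Rightarrow> ('i \<Rightarrow> ('b, 'm) tracial_algebra_scheme) \<Rightarrow> 'i filter \<Rightarrow> ('i \<Rightarrow> 'b) tracial_algebra"
  where "bounded_product I A \<omega> =
    \<lparr>carrier = {a \<in> (\<Pi>\<^sub>E i\<in>I. carrier (A i)).
       \<forall>p. even p \<and> 2 \<le> p \<longrightarrow> (\<exists>C. \<forall>i\<in>I. pnorm (A i) p (a i) \<le> C)},
     mult = (\<lambda>a b. \<lambda>i\<in>I. a i \<otimes>\<^bsub>A i\<^esub> b i),
     one = (\<lambda>i\<in>I. \<one>\<^bsub>A i\<^esub>),
     zero = (\<lambda>i\<in>I. \<zero>\<^bsub>A i\<^esub>),
     add = (\<lambda>a b. \<lambda>i\<in>I. a i \<oplus>\<^bsub>A i\<^esub> b i),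
     smult = (\<lambda>c a. \<lambda>i\<in>I. c \<odot>\<^bsub>A i\<^esub> a i),
     invol = (\<lambda>a. \<lambda>i\<in>I. invol (A i) (a i)),
     tau = (\<lambda>a. Lim \<omega> (\<lambda>i. tau (A i) (a i)))\<rparr>"

definition null_ideal :: "('b, 'm) tracial_algebra_scheme \<Rightarrow> 'b set"
  where "null_ideal A = {x \<in> carrier A. tau A (invol A x \<otimes>\<^bsub>A\<^esub> x) = 0}"

text \<open>The operations on cosets are given in the style of \<open>rcoset_mult\<close>: when J is a
  star-ideal on which the trace vanishes, the unions range over equal cosets and the trace takes
  a single value on each coset.\<close>

definition quotient_algebra :: "('b, 'm) tracial_algebra_scheme \<Rightarrow> 'b set \<Rightarrow> 'b set tracial_algebra"
  where "quotient_algebra A J =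
    \<lparr>carrier = carrier (A Quot J),
     mult = mult (A Quot J),
     one = one (A Quot J),
     zero = zero (A Quot J),
     add = add (A Quot J),
     smult = (\<lambda>c X. \<Union>x\<in>X. J +>\<^bsub>A\<^esub> (c \<odot>\<^bsub>A\<^esub> x)),
     invol = (\<lambda>X. \<Union>x\<in>X. J +>\<^bsub>A\<^esub> invol A x),
     tau = (\<lambda>X. the_elem (tau A ` X))\<rparr>"

definition metric_ultraproduct ::
    "'i set \<Rightarrow> ('i \<Rightarrow> ('b, 'm) tracial_algebra_scheme) \<Rightarrow> 'i filter \<Rightarrow> ('i \<Rightarrow> 'b) set tracial_algebra"
  where "metric_ultraproduct I A \<omega> =
    quotient_algebra (bounded_product I A \<omega>) (null_ideal (bounded_product I A \<omega>))"

definition trace_preserving_embedding ::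
    "('b, 'm) tracial_algebra_scheme \<Rightarrow> ('c, 'n) tracial_algebra_scheme \<Rightarrow> ('b \<Rightarrow> 'c) \<Rightarrow> bool"
  where "trace_preserving_embedding A B \<iota> \<longleftrightarrow>
    \<iota> \<in> ring_hom A B \<and> inj_on \<iota> (carrier A) \<and>
    (\<forall>c. \<forall>x\<in>carrier A. \<iota> (c \<odot>\<^bsub>A\<^esub> x) = c \<odot>\<^bsub>B\<^esub> \<iota> x) \<and>
    (\<forall>x\<in>carrier A. \<iota> (invol A x) = invol B (\<iota> x)) \<and>
    (\<forall>x\<in>carrier A. tau B (\<iota> x) = tau A x)"

end

(* It suffices to approximate the moments of countably many selfadjoint generators s_0, s_1, ... of A
   by moments in algebras of type I: a diagonal argument then extends the assignment of approximating
   generators continuously, in all p-norms, to an embedding into the ultraproduct.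

   For fixed d let X_0, ..., X_(d-1) be the field operators (creation plus annihilation) on the full
   Fock space truncated to words of length at most 2d, and let t be an indeterminate.  The matrices
   t X_i over C[t] generate a *-algebra of type I with no linear relations among the words of length at
   most 2d, because the coefficient of a word w can be read off from the coefficient of t^|w| in the
   entry of the vacuum column at w.  Hence (word of length at most 2d) |-> (its moment in A), extended
   by 0 to longer words, is a well defined tracial functional T; it is positive on the span of words
   of length at most d.  Let l be the functional on C[t] with moments c_k = alpha 16^(k^2) L^max(k-2d,0).
   The Hankel matrix (c_(i+j)) is strictly diagonally dominant after normalisation, so F |-> l(tr F) is
   strictly positive; for L large it also absorbs the mixed terms of T between short and long words.
   Thus T + l(tr) is, up to a scalar, a faithful positive trace, and for alpha small it has almost the
   same moments as A. *)

theory Submission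
  imports Defs "HOL-Computational_Algebra.Polynomial" "HOL-Analysis.Topology_Euclidean_Space"
begin

section \<open>Norms on a tracial star-algebra\<close>

text \<open>Elements of \<open>A\<close> need not be bounded, so only the p-norms are available. For
  an exponent 2^k the norm of a polynomial in the generators is a root of one finite linear
  combination of word moments, so convergence of word moments carries over to norms. Hoelder and
  Minkowski have to be derived from positivity and traciality alone.

  Truncation destroys positivity: a word longer than \<open>d\<close> has a square longer than 2d,
  so T gives it square norm 0, while its products with short words may have nonzero trace. The added
  term must therefore be negligible on words of length at most 2d and large on squares of words
  longer than \<open>d\<close>. This is the purpose of L^max(k-2d,0): it is 1 up to degree 2d, so
  \<open>L\<close> can be chosen after \<alpha> without disturbing the approximated moments.

  Matrices of finite size over a commutative ring satisfy standard identities of large degree. A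
  crude bound on that degree is enough, because the truncation parameter may grow with n as slowly
  as one likes.\<close>

lemma complex_ring_simps [simp]:
  "carrier complex_ring = UNIV" "mult complex_ring = (*)" "one complex_ring = 1"
  "zero complex_ring = 0" "add complex_ring = (+)"
  by (simp_all add: complex_ring_def)

context tracial_star_algebra
begin

lemma scale_closed [simp, intro]: "x \<in> carrier A \<Longrightarrow> c \<odot> x \<in> carrier A"
  using smult_closed[of c x] by simp

lemma scale_add_left: "x \<in> carrier A \<Longrightarrow> (a + b) \<odot> x = a \<odot> x \<oplus> b \<odot> x"
  using smult_l_distr[of a b x] by simp

lemma scale_add_right: "x \<in> carrier A \<Longrightarrow> y \<in> carrier A \<Longrightarrow> a \<odot> (x \<oplus> y) = a \<odot> x \<oplus> a \<odot> y"
  using smult_r_distr[of a x y] by simp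

lemma scale_scale: "x \<in> carrier A \<Longrightarrow> a \<odot> (b \<odot> x) = (a * b) \<odot> x"
  using smult_assoc1[of a b x] by simp

lemma scale_one [simp]: "x \<in> carrier A \<Longrightarrow> 1 \<odot> x = x"
  using smult_one[of x] by simp

lemma scale_zero_left [simp]: "x \<in> carrier A \<Longrightarrow> 0 \<odot> x = \<zero>"
  using smult_l_null[of x] by simp

lemma scale_zero_right [simp]: "c \<odot> \<zero> = \<zero>"
  using smult_r_null[of c] by simp

lemma uminus_eq_scale: "x \<in> carrier A \<Longrightarrow> \<ominus> x = (-1) \<odot> x"
proof -
  assume x: "x \<in> carrier A"
  have "(-1) \<odot> x \<oplus> x = (-1 + 1) \<odot> x"
    using x by (simp only: scale_add_left scale_one)
  then have "(-1) \<odot> x \<oplus> x = \<zero>" using x by simp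
  then show ?thesis using x by (metis minus_equality scale_closed)
qed

lemma minus_eq_scale: "x \<in> carrier A \<Longrightarrow> y \<in> carrier A \<Longrightarrow> x \<ominus> y = x \<oplus> (-1) \<odot> y"
  by (simp add: a_minus_def uminus_eq_scale)

declare invol_closed [simp, intro]

lemma tau_zero [simp]: "tau A \<zero> = 0"
  using tau_smult[of "\<zero>" 0] by simp

lemma tau_minus: "x \<in> carrier A \<Longrightarrow> y \<in> carrier A \<Longrightarrow> tau A (x \<ominus> y) = tau A x - tau A y"
  by (simp add: minus_eq_scale tau_add tau_smult)

lemma invol_zero [simp]: "invol A \<zero> = \<zero>"
  using invol_smult[of "\<zero>" 0] by simp

lemma invol_one [simp]: "invol A \<one> = \<one>"
  by (metis invol_closed invol_invol invol_mult one_closed r_one l_one)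

lemma invol_minus: "x \<in> carrier A \<Longrightarrow> y \<in> carrier A \<Longrightarrow> invol A (x \<ominus> y) = invol A x \<ominus> invol A y"
  by (simp add: minus_eq_scale invol_add invol_smult)

section \<open>Positivity and the Cauchy-Schwarz inequality\<close>

lemma tau_square:
  assumes "x \<in> carrier A"
  shows "Im (tau A (invol A x \<otimes> x)) = 0" "Re (tau A (invol A x \<otimes> x)) \<ge> 0"
  using tau_positive[OF assms] by (auto simp: complex_nonneg_Reals_iff)

lemma tau_square_expand:
  assumes x: "x \<in> carrier A" and y: "y \<in> carrier A"
  shows "tau A (invol A (x \<oplus> c \<odot> y) \<otimes> (x \<oplus> c \<odot> y)) =
    tau A (invol A x \<otimes> x) + c * tau A (invol A x \<otimes> y) + cnj c * tau A (invol A y \<otimes> x)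
      + cnj c * c * tau A (invol A y \<otimes> y)"
  using x y
  by (simp add: invol_add invol_smult l_distr r_distr smult_mult_left smult_mult_right
      tau_add tau_smult algebra_simps)

text \<open>Not an axiom: \<open>tau\<close> is only assumed real and nonnegative on squares.
  Polarisation with the coefficients 1 and i gives the imaginary and the real part of the
  claim.\<close>

lemma tau_invol_mult:
  assumes x: "x \<in> carrier A" and y: "y \<in> carrier A"
  shows "tau A (invol A y \<otimes> x) = cnj (tau A (invol A x \<otimes> y))"
proof -
  have 1: "Im (tau A (invol A x \<otimes> y) + tau A (invol A y \<otimes> x)) = 0"
    using tau_square(1)[of "x \<oplus> 1 \<odot> y"] tau_square_expand[OF x y, of 1]
      tau_square(1)[OF x] tau_square(1)[OF y] x y by simp
  have 2: "Re (tau A (invol A x \<otimes> y) - tau A (invol A y \<otimes> x)) = 0"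
    using tau_square(1)[of "x \<oplus> \<i> \<odot> y"] tau_square_expand[OF x y, of \<i>]
      tau_square(1)[OF x] tau_square(1)[OF y] x y by simp
  show ?thesis using 1 2 by (simp add: complex_eq_iff)
qed

lemma tau_invol: "x \<in> carrier A \<Longrightarrow> tau A (invol A x) = cnj (tau A x)"
  using tau_invol_mult[of \<one> x] by simp

lemma tau_Cauchy_Schwarz_invol:
  assumes x: "x \<in> carrier A" and y: "y \<in> carrier A"
  shows "(cmod (tau A (invol A x \<otimes> y)))\<^sup>2 \<le> Re (tau A (invol A x \<otimes> x)) * Re (tau A (invol A y \<otimes> y))"
proof -
  define z p q where "z = tau A (invol A x \<otimes> y)" and "p = Re (tau A (invol A x \<otimes> x))"
    and "q = Re (tau A (invol A y \<otimes> y))"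
  have q0: "q \<ge> 0" using tau_square(2)[OF y] by (simp add: q_def)
  have *: "0 \<le> p - 2 * t * (cmod z)\<^sup>2 + t\<^sup>2 * (cmod z)\<^sup>2 * q" for t :: real
  proof -
    \<comment> \<open>The phase of \<open>cnj z\<close> makes both cross terms real and leaves a
      real quadratic in \<open>t\<close>.\<close>
    define c where "c = - of_real t * cnj z"
    have yx: "tau A (invol A y \<otimes> x) = cnj z" unfolding z_def by (rule tau_invol_mult[OF x y])
    have qq: "tau A (invol A y \<otimes> y) = of_real q"
      using tau_square(1)[OF y] by (simp add: q_def complex_eq_iff)
    have "0 \<le> Re (tau A (invol A (x \<oplus> c \<odot> y) \<otimes> (x \<oplus> c \<odot> y)))"
      using tau_square(2)[of "x \<oplus> c \<odot> y"] x y by simp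
    also have "\<dots> = p + Re (c * z + cnj c * cnj z + cnj c * c * of_real q)"
      unfolding tau_square_expand[OF x y] yx qq z_def p_def by simp
    also have "\<dots> = p - 2 * t * (cmod z)\<^sup>2 + t\<^sup>2 * (cmod z)\<^sup>2 * q"
      unfolding c_def by (simp add: cmod_power2) (simp add: power2_eq_square algebra_simps)
    finally show ?thesis .
  qed
  have "(cmod z)\<^sup>2 \<le> p * q"
  proof (cases "q = 0")
    case True
    have "z = 0"
    proof (rule ccontr)
      assume "z \<noteq> 0"
      then have pos: "(cmod z)\<^sup>2 > 0" by simp
      \<comment> \<open>The quadratic has degenerated to a line of negative slope; this value of
        \<open>t\<close> takes it to -1.\<close>
      have "0 \<le> p - 2 * ((p + 1) / (2 * (cmod z)\<^sup>2)) * (cmod z)\<^sup>2"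
        using *[of "(p + 1) / (2 * (cmod z)\<^sup>2)"] True by simp
      also have "\<dots> = -1" using pos by (simp add: field_simps)
      finally show False by simp
    qed
    then show ?thesis using True by simp
  next
    case False
    then have qp: "q > 0" using q0 by simp
    have "0 \<le> p - 2 * (1 / q) * (cmod z)\<^sup>2 + (1 / q)\<^sup>2 * (cmod z)\<^sup>2 * q" by (rule *)
    also have "\<dots> = p - (cmod z)\<^sup>2 / q" using qp by (simp add: field_simps power2_eq_square)
    finally show ?thesis using qp by (simp add: field_simps)
  qed
  then show ?thesis by (simp add: z_def p_def q_def)
qed

text \<open>Powers of two only, because Hoelder's inequality is proved by repeated halving. Level 0
  is degenerate: \<open>1 div 2 = 0\<close> makes \<open>N 0 x\<close> equal to 1, so the norm
  inequalities are stated for \<open>Suc k\<close>, that is for the exponent 2^(k+1).\<close>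

definition N :: "nat \<Rightarrow> 'b \<Rightarrow> real" where "N k x = pnorm A (2 ^ k) x"

section \<open>Powers of x* x and their moments\<close>

lemma pow_in [simp, intro]: "x \<in> carrier A \<Longrightarrow> x [^] (n::nat) \<in> carrier A"
  by (rule nat_pow_closed)

lemma invol_pow:
  assumes h: "h \<in> carrier A" "invol A h = h"
  shows "invol A (h [^] (m::nat)) = h [^] m"
proof (induction m)
  case (Suc m)
  have "invol A (h [^] Suc m) = h \<otimes> h [^] m" using h Suc by (simp add: invol_mult)
  also have "\<dots> = h [^] Suc m" using h nat_pow_Suc2[of h m] by simp
  finally show ?case .
qed simp

text \<open>Every power of h = x* x is again of the form y* y: take y = h^m for the exponent 2m and
  y = x h^m for the exponent 2m + 1.\<close>

lemma tau_pow_nonneg: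
  assumes x: "x \<in> carrier A"
  shows "Re (tau A ((invol A x \<otimes> x) [^] (n::nat))) \<ge> 0" "Im (tau A ((invol A x \<otimes> x) [^] n)) = 0"
proof -
  define h where "h = invol A x \<otimes> x"
  have h: "h \<in> carrier A" "invol A h = h" using x by (auto simp: h_def invol_mult invol_invol)
  have hp: "invol A (h [^] m) = h [^] m" for m :: nat using h by (rule invol_pow)
  have "\<exists>y\<in>carrier A. h [^] n = invol A y \<otimes> y"
  proof (cases "even n")
    case True
    then obtain m where n: "n = m + m" by (metis evenE mult_2)
    have "h [^] n = invol A (h [^] m) \<otimes> h [^] m" using h by (simp add: hp n nat_pow_mult)
    then show ?thesis using h by blast
  next
    case False
    then obtain m where n: "n = m + 1 + m" by (metis oddE mult_2 add.commute add.left_commute)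
    have "h [^] n = h [^] Suc m \<otimes> h [^] m" using h unfolding n by (subst nat_pow_mult) simp_all
    also have "\<dots> = h [^] m \<otimes> h \<otimes> h [^] m" by simp
    also have "\<dots> = invol A (x \<otimes> h [^] m) \<otimes> (x \<otimes> h [^] m)"
    proof -
      have p: "h [^] m \<in> carrier A" using h by simp
      have "invol A (x \<otimes> h [^] m) = h [^] m \<otimes> invol A x" using p x by (simp add: invol_mult hp)
      then show ?thesis using p x by (simp add: m_assoc) (simp add: h_def m_assoc)
    qed
    finally show ?thesis using h x by blast
  qed
  then obtain y where "y \<in> carrier A" "h [^] n = invol A y \<otimes> y" by blast
  then show "Re (tau A ((invol A x \<otimes> x) [^] n)) \<ge> 0" "Im (tau A ((invol A x \<otimes> x) [^] n)) = 0"
    using tau_square[of y] by (auto simp: h_def)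
qed

lemma pnorm_nonneg: "x \<in> carrier A \<Longrightarrow> pnorm A p x \<ge> 0"
  unfolding pnorm_def by (simp add: real_root_ge_zero tau_pow_nonneg)

lemma pnorm_power:
  "x \<in> carrier A \<Longrightarrow> p > 0 \<Longrightarrow> pnorm A p x ^ p = Re (tau A ((invol A x \<otimes> x) [^] (p div 2)))"
  unfolding pnorm_def by (simp add: tau_pow_nonneg)

lemma N_nonneg: "x \<in> carrier A \<Longrightarrow> N k x \<ge> 0"
  by (simp add: N_def pnorm_nonneg)

lemma N_power:
  "x \<in> carrier A \<Longrightarrow> N (Suc k) x ^ (2 ^ Suc k) = Re (tau A ((invol A x \<otimes> x) [^] (2 ^ k :: nat)))"
  unfolding N_def by (subst pnorm_power) auto

lemma of_real_N_power:
  "x \<in> carrier A \<Longrightarrow> tau A ((invol A x \<otimes> x) [^] (2 ^ k :: nat)) = of_real (N (Suc k) x ^ (2 ^ Suc k))"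
  unfolding N_power by (simp add: complex_eq_iff tau_pow_nonneg)

text \<open>Positivity of the trace on the square of u - v, where u and v play the role of h^(m/2)
  and h^(m/2+1) for h = x* x. For odd m the missing half power is supplied by x itself, as x
  h^i.\<close>

lemma pnorm_convexity:
  assumes x: "x \<in> carrier A"
  defines "\<mu> \<equiv> \<lambda>m. Re (tau A ((invol A x \<otimes> x) [^] (m::nat)))"
  shows "2 * \<mu> (Suc m) \<le> \<mu> m + \<mu> (Suc (Suc m))"
proof -
  define h where "h = invol A x \<otimes> x"
  have h: "h \<in> carrier A" "invol A h = h" using x by (auto simp: h_def invol_mult invol_invol)
  have hp: "invol A (h [^] m) = h [^] m" for m :: nat using h by (rule invol_pow)
  have mu: "\<mu> k = Re (tau A (h [^] k))" for k by (simp add: \<mu>_def h_def)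
  have p1: "h [^] i \<otimes> h [^] j = h [^] (i + j)" for i j :: nat using h by (simp add: nat_pow_mult)
  show ?thesis
  proof (cases "even m")
    case True
    then obtain i where m: "m = i + i" by (metis evenE mult_2)
    define u v where "u = h [^] i" and "v = h [^] Suc i"
    have uv: "u \<in> carrier A" "v \<in> carrier A" using h by (auto simp: u_def v_def)
    have e: "tau A (invol A u \<otimes> u) = tau A (h [^] m)" "tau A (invol A u \<otimes> v) = tau A (h [^] Suc m)"
      "tau A (invol A v \<otimes> u) = tau A (h [^] Suc m)" "tau A (invol A v \<otimes> v) = tau A (h [^] Suc (Suc m))"
      unfolding u_def v_def hp p1 m by (simp_all only: add_Suc add_Suc_right)
    have "0 \<le> Re (tau A (invol A (u \<oplus> (-1) \<odot> v) \<otimes> (u \<oplus> (-1) \<odot> v)))"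
      using uv by (intro tau_square) simp_all
    also have "\<dots> = \<mu> m - 2 * \<mu> (Suc m) + \<mu> (Suc (Suc m))"
      unfolding tau_square_expand[OF uv] e mu by simp
    finally show ?thesis by simp
  next
    case False
    then obtain i where m: "m = i + Suc i" by (metis oddE mult_2 add_Suc_right Suc_eq_plus1)
    have q: "invol A (x \<otimes> h [^] i) \<otimes> (x \<otimes> h [^] j) = h [^] (i + Suc j)" for i j :: nat
    proof -
      have p: "h [^] i \<in> carrier A" "h [^] j \<in> carrier A" using h by simp_all
      have "invol A (x \<otimes> h [^] i) = h [^] i \<otimes> invol A x" using p x by (simp add: invol_mult hp)
      then have "invol A (x \<otimes> h [^] i) \<otimes> (x \<otimes> h [^] j) = h [^] i \<otimes> ((invol A x \<otimes> x) \<otimes> h [^] j)"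
        using p x by (simp add: m_assoc)
      also have "invol A x \<otimes> x = h" by (simp only: h_def)
      also have "h \<otimes> h [^] j = h [^] Suc j" using h nat_pow_Suc2[of h j] by simp
      finally show ?thesis using p1[of i "Suc j"] by simp
    qed
    define u v where "u = x \<otimes> h [^] i" and "v = x \<otimes> h [^] Suc i"
    have uv: "u \<in> carrier A" "v \<in> carrier A" using h x by (auto simp: u_def v_def)
    have e: "tau A (invol A u \<otimes> u) = tau A (h [^] m)" "tau A (invol A u \<otimes> v) = tau A (h [^] Suc m)"
      "tau A (invol A v \<otimes> u) = tau A (h [^] Suc m)" "tau A (invol A v \<otimes> v) = tau A (h [^] Suc (Suc m))"
      unfolding u_def v_def q m by (simp_all only: add_Suc add_Suc_right)
    have "0 \<le> Re (tau A (invol A (u \<oplus> (-1) \<odot> v) \<otimes> (u \<oplus> (-1) \<odot> v)))"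
      using uv by (intro tau_square) simp_all
    also have "\<dots> = \<mu> m - 2 * \<mu> (Suc m) + \<mu> (Suc (Suc m))"
      unfolding tau_square_expand[OF uv] e mu by simp
    finally show ?thesis by simp
  qed
qed

text \<open>Reduces an arbitrary even exponent to a dyadic one. By convexity and
  \<open>\<mu> 0 = 1\<close> the moments either never rise before \<open>m\<close>, hence stay at
  most 1, or never fall after their first rise, so that \<open>\<mu> m\<close> is at most
  \<open>\<mu> n\<close>. A crude bound is enough, since it only serves to transfer
  boundedness.\<close>

lemma pnorm_bound_N:
  assumes x: "x \<in> carrier A" and p: "even p" "2 \<le> p" "p \<le> 2 ^ Suc k"
  shows "pnorm A p x \<le> max 1 (N (Suc k) x) ^ (2 ^ Suc k)"
proof -
  define \<mu> where "\<mu> \<equiv> \<lambda>m. Re (tau A ((invol A x \<otimes> x) [^] (m::nat)))"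
  have conv: "\<mu> (Suc m) - \<mu> m \<le> \<mu> (Suc (Suc m)) - \<mu> (Suc m)" for m
    using pnorm_convexity[OF x, of m] unfolding \<mu>_def by linarith
  have mu0: "\<mu> 0 = 1" by (simp add: \<mu>_def tau_one)
  have incr: "\<mu> (Suc m) - \<mu> m \<le> \<mu> (Suc n) - \<mu> n" if "m \<le> n" for m n
    by (rule lift_Suc_mono_le[of "\<lambda>m. \<mu> (Suc m) - \<mu> m"]) (use conv that in auto)
  have bound: "\<mu> m \<le> max 1 (\<mu> n)" if "m \<le> n" for m n
  proof (cases "\<forall>j<m. \<mu> (Suc j) - \<mu> j \<le> 0")
    case True
    then have "\<mu> m \<le> \<mu> 0"
    proof (induction m)
      case (Suc m)
      then show ?case by (metis add.commute diff_le_eq le_add_diff_inverse less_Suc_eq lift_Suc_antimono_le nle_le order.trans add.right_neutral)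
    qed simp
    then show ?thesis using mu0 by simp
  next
    case False
    then obtain j where j: "j < m" "\<mu> (Suc j) - \<mu> j > 0" by force
    have "\<mu> i \<le> \<mu> (Suc i)" if "i \<ge> j" for i using incr[OF that] j by linarith
    then have "\<mu> m \<le> \<mu> (m + t)" for t
      by (induction t) (use j in \<open>auto intro: order_trans\<close>)
    from this[of "n - m"] show ?thesis using that by simp
  qed
  define C where "C = max 1 (N (Suc k) x) ^ (2 ^ Suc k)"
  have C1: "C \<ge> 1" unfolding C_def by (rule one_le_power) simp
  have "pnorm A p x ^ p = \<mu> (p div 2)" using p x by (simp add: pnorm_power \<mu>_def)
  also have "\<dots> \<le> max 1 (\<mu> (2 ^ k))" by (rule bound) (use p in auto)
  also have "\<mu> (2 ^ k) = N (Suc k) x ^ (2 ^ Suc k)" using N_power[OF x, of k] by (simp add: \<mu>_def)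
  also have "max 1 \<dots> \<le> C" unfolding C_def
    using C1 C_def N_nonneg[OF x] by (auto intro!: power_mono)
  also have "C \<le> C ^ p" using C1 p by (intro self_le_power) auto
  finally have "pnorm A p x ^ p \<le> C ^ p" .
  then show ?thesis unfolding C_def[symmetric]
    using C1 p by (metis power_le_imp_le_base Suc_pred' less_le_trans zero_less_numeral order.trans zero_le_one)
qed

section \<open>Hoelder's inequality for dyadic exponents\<close>

abbreviation lprod :: "'b list \<Rightarrow> 'b" where "lprod xs \<equiv> foldr (\<otimes>) xs \<one>"

lemma lprod_closed [simp]: "set xs \<subseteq> carrier A \<Longrightarrow> lprod xs \<in> carrier A"
  by (induction xs) auto

lemma lprod_append:
  "set xs \<subseteq> carrier A \<Longrightarrow> set ys \<subseteq> carrier A \<Longrightarrow> lprod (xs @ ys) = lprod xs \<otimes> lprod ys"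
  by (induction xs) (auto simp: m_assoc)

lemma N_one_eq: "x \<in> carrier A \<Longrightarrow> (N (Suc 0) x)\<^sup>2 = Re (tau A (invol A x \<otimes> x))"
  using N_power[of x 0] by simp

lemma N_one_invol: "x \<in> carrier A \<Longrightarrow> N (Suc 0) (invol A x) = N (Suc 0) x"
proof -
  assume x: "x \<in> carrier A"
  have "(N (Suc 0) (invol A x))\<^sup>2 = (N (Suc 0) x)\<^sup>2"
    using x by (simp add: N_one_eq invol_invol tau_commute[of x "invol A x"])
  then show ?thesis using x by (simp add: N_nonneg power2_eq_iff_nonneg)
qed

lemma tau_Cauchy_Schwarz:
  assumes x: "x \<in> carrier A" and y: "y \<in> carrier A"
  shows "cmod (tau A (x \<otimes> y)) \<le> N (Suc 0) x * N (Suc 0) y"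
proof -
  have "(cmod (tau A (x \<otimes> y)))\<^sup>2 \<le> (N (Suc 0) x * N (Suc 0) y)\<^sup>2"
    using tau_Cauchy_Schwarz_invol[of "invol A x" y] x y N_one_eq[of "invol A x"]
    by (simp add: invol_invol power_mult_distrib N_one_eq N_one_invol)
  then show ?thesis
    using x y by (meson N_nonneg mult_nonneg_nonneg power2_le_imp_le)
qed

text \<open>One halving of the word length in the proof of Hoelder's inequality. An unpaired last
  letter would be dropped, so it is applied to words of even length.\<close>

fun pair_up :: "'b list \<Rightarrow> 'b list" where
  "pair_up (x # y # xs) = (x \<otimes> y) # pair_up xs"
| "pair_up xs = []"

lemma pair_up:
  assumes "length xs = 2 * m" "set xs \<subseteq> carrier A"
  shows "length (pair_up xs) = m \<and> set (pair_up xs) \<subseteq> carrier A \<and> lprod (pair_up xs) = lprod xs"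
  using assms
proof (induction xs arbitrary: m rule: pair_up.induct)
  case (1 x y xs)
  then obtain j where "m = Suc j" by (cases m) auto
  then show ?case using 1(1)[of j] 1(2,3) by (auto simp: m_assoc)
qed auto

text \<open>Cyclicity of the trace: since (a b)^(j+1) = a (b a)^j b, the powers of y y* and of y* y
  have equal traces.\<close>

lemma N_invol:
  assumes y: "y \<in> carrier A"
  shows "N (Suc k) (invol A y) = N (Suc k) y"
proof -
  have cyc: "tau A ((a \<otimes> b) [^] n) = tau A ((b \<otimes> a) [^] n)" if a: "a \<in> carrier A" and b: "b \<in> carrier A" for a b and n :: nat
  proof (cases n)
    case (Suc j)
    have e: "(a \<otimes> b) [^] Suc j = a \<otimes> ((b \<otimes> a) [^] j \<otimes> b)" for j
      by (induction j) (use a b in \<open>simp_all add: m_assoc\<close>)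
    have "tau A (a \<otimes> ((b \<otimes> a) [^] j \<otimes> b)) = tau A (((b \<otimes> a) [^] j \<otimes> b) \<otimes> a)"
      using a b by (intro tau_commute) auto
    then show ?thesis using a b e[of j] by (simp add: Suc m_assoc)
  qed simp
  have "N (Suc k) (invol A y) ^ (2 ^ Suc k) = N (Suc k) y ^ (2 ^ Suc k)"
    using y by (simp only: N_power invol_closed invol_invol cyc[of y "invol A y"])
  then show ?thesis using y
    by (metis N_nonneg invol_closed power_eq_iff_eq_base zero_less_numeral zero_less_power)
qed


text \<open>With h = x* x selfadjoint, h* h is h^2, so both sides are roots of the same moment of h.
  This is where a norm is traded for one with twice the exponent.\<close>

lemma N_square:
  assumes x: "x \<in> carrier A"
  shows "N (Suc k) (invol A x \<otimes> x) = (N (Suc (Suc k)) x)\<^sup>2"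
proof -
  define m :: nat where "m = 2 ^ k"
  have len: "2 * m = 2 ^ Suc k" by (simp add: m_def)
  define h where "h = invol A x \<otimes> x"
  have h: "h \<in> carrier A" "invol A h = h" using x by (auto simp: h_def invol_mult invol_invol)
  have "N (Suc k) h ^ (2 * m) = Re (tau A ((h \<otimes> h) [^] m))"
    using N_power[OF h(1), of k] h by (simp add: len m_def)
  also have "(h \<otimes> h) [^] m = h [^] (2 * m)"
    using h by (metis nat_pow_pow numeral_2_eq_2 nat_pow_Suc nat_pow_0 l_one)
  also have "Re (tau A (h [^] (2 * m))) = N (Suc (Suc k)) x ^ (2 ^ Suc (Suc k))"
    using N_power[OF x, of "Suc k"] by (simp add: h_def len)
  also have "\<dots> = ((N (Suc (Suc k)) x)\<^sup>2) ^ (2 * m)"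
    by (simp add: m_def power_mult[symmetric])
  finally show ?thesis
    unfolding h_def using x h
    by (metis N_nonneg h_def len power_eq_iff_eq_base zero_le_power2 zero_less_numeral zero_less_power)
qed


lemma lprod_alternating:
  "a \<in> carrier A \<Longrightarrow> b \<in> carrier A \<Longrightarrow> lprod (concat (replicate n [a, b])) = (a \<otimes> b) [^] n"
proof (induction n)
  case (Suc n)
  then have "lprod (concat (replicate (Suc n) [a, b])) = (a \<otimes> b) \<otimes> (a \<otimes> b) [^] n"
    by (simp add: m_assoc)
  then show ?case using Suc.prems nat_pow_Suc2[of "a \<otimes> b" n] by simp
qed simp

text \<open>The premise is Hoelder's inequality at level \<open>k\<close>, kept as a premise so that
  the lemma serves inside the induction that proves it and afterwards yields \<open>N_mult\<close>
  outright.\<close>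

lemma N_mult_step:
  assumes IH: "\<And>xs. length xs = 2 ^ Suc k \<Longrightarrow> set xs \<subseteq> carrier A \<Longrightarrow>
      cmod (tau A (lprod xs)) \<le> prod_list (map (N (Suc k)) xs)"
    and x: "x \<in> carrier A" and y: "y \<in> carrier A"
  shows "N (Suc k) (x \<otimes> y) \<le> N (Suc (Suc k)) x * N (Suc (Suc k)) y"
proof -
  define m :: nat where "m = 2 ^ k"
  have len: "2 * m = 2 ^ Suc k" by (simp add: m_def)
  let ?a = "invol A x \<otimes> x" and ?b = "y \<otimes> invol A y"
  have "N (Suc k) (x \<otimes> y) ^ (2 * m) = Re (tau A ((invol A y \<otimes> (?a \<otimes> y)) [^] m))"
    using N_power[of "x \<otimes> y" k] x y by (simp add: len m_def invol_mult m_assoc)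
  \<comment> \<open>Moving the leading y* to the end by cyclicity turns the power into an
    alternating word in \<open>?a\<close> and \<open>?b\<close> of length 2^(k+1), the length that
    the premise requires.\<close>
  also have "tau A ((invol A y \<otimes> (?a \<otimes> y)) [^] m) = tau A ((?a \<otimes> ?b) [^] m)"
  proof (cases m)
    case (Suc j)
    have e: "(invol A y \<otimes> (?a \<otimes> y)) [^] Suc j = invol A y \<otimes> ((?a \<otimes> ?b) [^] j \<otimes> (?a \<otimes> y))" for j
      by (induction j) (use x y in \<open>simp_all add: m_assoc\<close>)
    have "tau A (invol A y \<otimes> ((?a \<otimes> ?b) [^] j \<otimes> (?a \<otimes> y))) = tau A (((?a \<otimes> ?b) [^] j \<otimes> (?a \<otimes> y)) \<otimes> invol A y)"
      using x y by (intro tau_commute) auto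
    then show ?thesis using x y e[of j] by (simp add: Suc m_assoc)
  qed simp
  also have "Re \<dots> \<le> cmod \<dots>" by (rule complex_Re_le_cmod)
  also have "\<dots> = cmod (tau A (lprod (concat (replicate m [?a, ?b]))))"
    using x y by (simp add: lprod_alternating)
  also have "\<dots> \<le> prod_list (map (N (Suc k)) (concat (replicate m [?a, ?b])))"
    using x y by (intro IH) (auto simp: length_concat sum_list_replicate m_def)
  also have "\<dots> = (N (Suc k) ?a * N (Suc k) ?b) ^ m"
    by (induction m) (simp_all add: mult.assoc)
  also have "\<dots> = ((N (Suc (Suc k)) x * N (Suc (Suc k)) y)\<^sup>2) ^ m"
    using N_square[OF x] N_square[of "invol A y"] y N_invol[OF y] by (simp add: invol_invol power_mult_distrib)
  also have "\<dots> = (N (Suc (Suc k)) x * N (Suc (Suc k)) y) ^ (2 * m)" by (simp only: power_mult)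
  finally have *: "N (Suc k) (x \<otimes> y) ^ (2 * m) \<le> (N (Suc (Suc k)) x * N (Suc (Suc k)) y) ^ (2 * m)" .
  show ?thesis
    by (rule power_mono_iff[THEN iffD1, OF _ _ _ *]) (simp_all add: x y N_nonneg m_def)
qed

text \<open>Induction on \<open>k\<close>: pairing neighbours halves the length, and Hoelder's inequality for one pair
  is the induction hypothesis for the alternating word in \<open>x\<^sup>* x\<close> and \<open>y y\<^sup>*\<close>.\<close>

lemma tau_lprod_le:
  assumes "length xs = 2 ^ Suc k" "set xs \<subseteq> carrier A"
  shows "cmod (tau A (lprod xs)) \<le> prod_list (map (N (Suc k)) xs)"
  using assms
proof (induction k arbitrary: xs)
  case 0
  then obtain x y where xs: "xs = [x, y]"
    by (cases xs; cases "tl xs") auto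
  show ?case using tau_Cauchy_Schwarz[of x y] 0 by (simp add: xs)
next
  case (Suc k)
  have P: "length (pair_up xs) = 2 ^ Suc k \<and> set (pair_up xs) \<subseteq> carrier A \<and> lprod (pair_up xs) = lprod xs"
    by (rule pair_up) (use Suc.prems in auto)
  have le: "prod_list (map (N (Suc k)) (pair_up xs)) \<le> prod_list (map (N (Suc (Suc k))) xs)"
    if "length xs = 2 * j" "set xs \<subseteq> carrier A" for j
    using that
  proof (induction xs arbitrary: j rule: pair_up.induct)
    case (1 x y xs)
    obtain i where j: "j = Suc i" using 1(2) by (cases j) auto
    have P: "set (pair_up xs) \<subseteq> carrier A" using pair_up[of xs i] 1 j by simp
    have nn: "prod_list (map (N (Suc k)) (pair_up xs)) \<ge> 0"
      using P by (intro prod_list_nonneg) (auto intro!: N_nonneg)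
    have le: "prod_list (map (N (Suc k)) (pair_up xs)) \<le> prod_list (map (N (Suc (Suc k))) xs)"
      using 1(1)[of i] 1(2,3) j by simp
    have "N (Suc k) (x \<otimes> y) * prod_list (map (N (Suc k)) (pair_up xs))
      \<le> (N (Suc (Suc k)) x * N (Suc (Suc k)) y) * prod_list (map (N (Suc (Suc k))) xs)"
      using 1(3) nn le by (intro mult_mono N_mult_step[OF Suc.IH] mult_nonneg_nonneg N_nonneg) simp_all
    then show ?case by (simp add: mult.assoc)
  qed auto
  have "cmod (tau A (lprod xs)) \<le> prod_list (map (N (Suc k)) (pair_up xs))"
    using Suc.IH[of "pair_up xs"] P by simp
  also have "\<dots> \<le> prod_list (map (N (Suc (Suc k))) xs)"
    using le[of "2 ^ Suc k"] Suc.prems by simp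
  finally show ?case .
qed

text \<open>Hoelder for a word of length 2^(k+1) in which every letter but the last is z or z*, and
  these two have the same norm. It is the duality estimate behind the triangle inequality.\<close>

lemma N_mult_aux:
  assumes x: "x \<in> carrier A" and y: "y \<in> carrier A" and z: "z \<in> carrier A"
  shows "cmod (tau A ((invol A z \<otimes> z) [^] (2 ^ k - 1 :: nat) \<otimes> invol A z \<otimes> x)) \<le> N (Suc k) z ^ (2 ^ Suc k - 1) * N (Suc k) x"
proof -
  define m :: nat where "m = 2 ^ k - 1"
  have m: "2 ^ Suc k - 1 = Suc (2 * m)" proof -
    have "(1::nat) \<le> 2 ^ k" by simp
    then show ?thesis unfolding m_def power_Suc by arith
  qed
  let ?xs = "concat (replicate m [invol A z, z]) @ [invol A z, x]"
  have c: "set (concat (replicate m [invol A z, z])) \<subseteq> carrier A" using z by auto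
  have "lprod ?xs = lprod (concat (replicate m [invol A z, z])) \<otimes> lprod [invol A z, x]"
    by (rule lprod_append) (use c z x in simp_all)
  also have "\<dots> = (invol A z \<otimes> z) [^] m \<otimes> invol A z \<otimes> x"
    using z x lprod_alternating[of "invol A z" z m] by (simp add: m_assoc)
  finally have "cmod (tau A ((invol A z \<otimes> z) [^] m \<otimes> invol A z \<otimes> x)) \<le> prod_list (map (N (Suc k)) ?xs)"
    using tau_lprod_le[of ?xs k] c z x m by (simp add: length_concat sum_list_replicate)
  also have "prod_list (map (N (Suc k)) (concat (replicate n [invol A z, z]))) = N (Suc k) z ^ (2 * n)" for n
    by (induction n) (simp_all add: N_invol[OF z] algebra_simps)
  then have "prod_list (map (N (Suc k)) ?xs) = N (Suc k) z ^ Suc (2 * m) * N (Suc k) x"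
    by (simp add: N_invol[OF z])
  finally show ?thesis unfolding m by (simp only: m_def)
qed

text \<open>Minkowski by duality: the top power of the norm of z = x + y is tau(Q z) with Q = (z*
  z)^n z*. Split the second factor linearly, bound both terms by \<open>N_mult_aux\<close>, and
  cancel \<open>N (Suc k) z ^ M\<close>.\<close>

lemma N_triangle:
  assumes x: "x \<in> carrier A" and y: "y \<in> carrier A"
  shows "N (Suc k) (x \<oplus> y) \<le> N (Suc k) x + N (Suc k) y"
proof -
  define z where "z = x \<oplus> y"
  define M :: nat where "M = 2 ^ Suc k - 1"
  have M: "2 ^ Suc k = Suc M" by (simp add: M_def)
  have z: "z \<in> carrier A" using x y by (simp add: z_def)
  define n :: nat where "n = 2 ^ k - 1"
  have n: "2 ^ k = Suc n" by (simp add: n_def)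
  define Q where "Q = (invol A z \<otimes> z) [^] n \<otimes> invol A z"
  have Q: "Q \<in> carrier A" using z by (simp add: Q_def)
  have "(invol A z \<otimes> z) [^] Suc n = Q \<otimes> z" using z by (simp add: Q_def m_assoc)
  also have "\<dots> = Q \<otimes> x \<oplus> Q \<otimes> y" using Q x y by (simp add: z_def r_distr)
  finally have e: "tau A ((invol A z \<otimes> z) [^] (Suc n)) = tau A (Q \<otimes> x) + tau A (Q \<otimes> y)"
    using Q x y by (simp add: tau_add)
  have "N (Suc k) z ^ Suc M = Re (tau A (Q \<otimes> x) + tau A (Q \<otimes> y))"
    using N_power[OF z, of k] unfolding n e M .
  also have "\<dots> \<le> cmod (tau A (Q \<otimes> x)) + cmod (tau A (Q \<otimes> y))"
    by (meson complex_Re_le_cmod norm_triangle_ineq order_trans)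
  also have "\<dots> \<le> N (Suc k) z ^ M * N (Suc k) x + N (Suc k) z ^ M * N (Suc k) y"
    using N_mult_aux[OF x x z, of k] N_mult_aux[OF y y z, of k] by (simp add: Q_def M_def n_def)
  finally have "N (Suc k) z ^ M * N (Suc k) z \<le> N (Suc k) z ^ M * (N (Suc k) x + N (Suc k) y)"
    by (simp add: algebra_simps)
  then show ?thesis
    unfolding z_def[symmetric]
    using N_nonneg[OF z, of "Suc k"] N_nonneg[OF x, of "Suc k"] N_nonneg[OF y, of "Suc k"]
    by (cases "N (Suc k) z = 0") (simp_all add: mult_le_cancel_left_pos)
qed

lemma N_mult:
  assumes x: "x \<in> carrier A" and y: "y \<in> carrier A"
  shows "N (Suc k) (x \<otimes> y) \<le> N (Suc (Suc k)) x * N (Suc (Suc k)) y"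
  by (rule N_mult_step[OF tau_lprod_le x y])

lemma N_scale:
  assumes x: "x \<in> carrier A"
  shows "N (Suc k) (c \<odot> x) = cmod c * N (Suc k) x"
proof -
  let ?h = "invol A x \<otimes> x"
  have "(invol A (c \<odot> x) \<otimes> (c \<odot> x)) = (cnj c * c) \<odot> ?h"
    using x by (simp add: invol_smult smult_mult_left smult_mult_right scale_scale mult.commute)
  moreover have "((b \<odot> h) [^] n) = (b ^ n) \<odot> h [^] n" if "h \<in> carrier A" for b h and n :: nat
    using that by (induction n) (simp_all add: smult_mult_left smult_mult_right scale_scale mult.commute)
  ultimately have "N (Suc k) (c \<odot> x) ^ (2 ^ Suc k) = Re ((cnj c * c) ^ (2 ^ k) * tau A (?h [^] (2 ^ k :: nat)))"
    using x N_power[of "c \<odot> x" k] by (simp add: tau_smult)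
  also have "\<dots> = (cmod c * N (Suc k) x) ^ (2 ^ Suc k)"
  proof -
    have "cnj c * c = of_real ((cmod c)\<^sup>2)" by (metis complex_norm_square mult.commute)
    then have "(cnj c * c) ^ (2 ^ k) = of_real (cmod c ^ (2 ^ Suc k))"
      by (simp add: power_mult[symmetric])
    then show ?thesis unfolding of_real_N_power[OF x]
      by (simp add: power_mult_distrib del: power_Suc)
  qed
  finally show ?thesis
    by (rule power_eq_imp_eq_base) (use x in \<open>simp_all add: N_nonneg\<close>)
qed

lemma N_one: "N (Suc k) \<one> = 1"
proof -
  have "N (Suc k) \<one> ^ (2 ^ Suc k) = 1 ^ (2 ^ Suc k)"
    by (subst N_power) (simp_all add: tau_one)
  then show ?thesis
    by (rule power_eq_imp_eq_base) (simp_all add: N_nonneg)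
qed

lemma N_zero: "N (Suc k) \<zero> = 0"
  using N_scale[of "\<zero>" k 0] by simp

text \<open>Multiplication by the unit, which has norm 1 because its trace is 1.\<close>

lemma N_mono_Suc: "x \<in> carrier A \<Longrightarrow> N (Suc k) x \<le> N (Suc (Suc k)) x"
  using N_mult[of x \<one> k] by (simp add: N_one)

lemma N_mono: "x \<in> carrier A \<Longrightarrow> j \<le> k \<Longrightarrow> N (Suc j) x \<le> N (Suc k) x"
  by (rule lift_Suc_mono_le[of "\<lambda>k. N (Suc k) x"]) (auto intro: N_mono_Suc)

lemma cmod_tau_le: "x \<in> carrier A \<Longrightarrow> cmod (tau A x) \<le> N (Suc k) x"
proof -
  assume x: "x \<in> carrier A"
  then have "cmod (tau A x) \<le> N (Suc 0) x"
    using tau_Cauchy_Schwarz[of \<one> x] by (simp add: N_one)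
  also have "\<dots> \<le> N (Suc k) x" using x by (rule N_mono) simp
  finally show ?thesis .
qed

lemma N_minus_commute: "x \<in> carrier A \<Longrightarrow> y \<in> carrier A \<Longrightarrow> N (Suc k) (x \<ominus> y) = N (Suc k) (y \<ominus> x)"
proof -
  assume xy: "x \<in> carrier A" "y \<in> carrier A"
  then have "x \<ominus> y = (-1) \<odot> (y \<ominus> x)"
    by (simp add: minus_eq_scale scale_add_right scale_scale a_comm)
  then show ?thesis using N_scale[of "y \<ominus> x" k "-1"] xy by simp
qed

lemma N_triangle_minus:
  assumes "x \<in> carrier A" "y \<in> carrier A" "z \<in> carrier A"
  shows "N (Suc k) (x \<ominus> z) \<le> N (Suc k) (x \<ominus> y) + N (Suc k) (y \<ominus> z)"
proof -
  have "x \<ominus> z = (x \<ominus> y) \<oplus> (y \<ominus> z)"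
    using assms by (simp add: minus_eq a_assoc[symmetric]) (simp add: a_assoc l_neg)
  then show ?thesis using N_triangle[of "x \<ominus> y" "y \<ominus> z" k] assms by simp
qed

end

section \<open>The standard identity for matrices over polynomials\<close>

definition mat_mult :: "'w set \<Rightarrow> ('w \<Rightarrow> 'w \<Rightarrow> complex poly) \<Rightarrow> ('w \<Rightarrow> 'w \<Rightarrow> complex poly) \<Rightarrow> 'w \<Rightarrow> 'w \<Rightarrow> complex poly"
  where "mat_mult W F G = (\<lambda>u v. \<Sum>z\<in>W. F u z * G z v)"

definition mat_one :: "'w set \<Rightarrow> 'w \<Rightarrow> 'w \<Rightarrow> complex poly"
  where "mat_one W = (\<lambda>u v. if u = v \<and> u \<in> W then 1 else 0)"

text \<open>Expands an entry over the paths u, z1, z2, ... through \<open>W\<close>. Each summand is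
  then a commutative product over the edges of one path, to which antisymmetry in the factors
  applies.\<close>

lemma foldr_mat_mult_paths:
  assumes W: "finite W" and u: "u \<in> W"
  shows "foldr (mat_mult W) Fs (mat_one W) u v =
    (\<Sum>zs | set zs \<subseteq> W \<and> length zs = length Fs.
      if last (u # zs) = v then (\<Prod>i<length Fs. (Fs ! i) ((u # zs) ! i) (zs ! i)) else 0)"
  using u
proof (induction Fs arbitrary: u)
  case Nil
  have "{zs. set zs \<subseteq> W \<and> length zs = 0} = {[]}" by auto
  then show ?case using Nil by (simp add: mat_one_def)
next
  case (Cons F Fs)
  let ?S = "{zs. set zs \<subseteq> W \<and> length zs = length Fs}"
  have e: "{zs. set zs \<subseteq> W \<and> length zs = length (F # Fs)} = (\<lambda>(z, zs). z # zs) ` (W \<times> ?S)"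
    by (auto simp: length_Suc_conv image_iff)
  have inj: "inj_on (\<lambda>(z, zs). z # zs) (W \<times> ?S)" by (auto simp: inj_on_def)
  have "foldr (mat_mult W) (F # Fs) (mat_one W) u v = (\<Sum>z\<in>W. F u z * foldr (mat_mult W) Fs (mat_one W) z v)"
    by (simp add: mat_mult_def)
  also have "\<dots> = (\<Sum>z\<in>W. \<Sum>zs\<in>?S. if last (z # zs) = v then F u z * (\<Prod>i<length Fs. (Fs ! i) ((z # zs) ! i) (zs ! i)) else 0)"
    by (intro sum.cong refl) (simp add: Cons.IH sum_distrib_left if_distrib cong: if_cong)
  also have "\<dots> = (\<Sum>(z, zs)\<in>W \<times> ?S. if last (z # zs) = v then F u z * (\<Prod>i<length Fs. (Fs ! i) ((z # zs) ! i) (zs ! i)) else 0)"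
    by (simp add: sum.cartesian_product)
  also have "\<dots> = (\<Sum>zs | set zs \<subseteq> W \<and> length zs = length (F # Fs).
      if last (u # zs) = v then (\<Prod>i<length (F # Fs). ((F # Fs) ! i) ((u # zs) ! i) (zs ! i)) else 0)"
    unfolding e
    by (subst sum.reindex[OF inj], intro sum.cong refl) (auto simp del: prod.lessThan_Suc simp add: prod.lessThan_Suc_shift)
  finally show ?case .
qed

text \<open>Transposing two positions with the same matrix unit flips the sign of each summand.\<close>

lemma alternating_sum_zero:
  fixes g :: "nat \<Rightarrow> 'e \<Rightarrow> complex poly"
  assumes ab: "a \<in> {1..m}" "b \<in> {1..m}" "a \<noteq> b" and eq: "e a = e b"
  shows "(\<Sum>\<sigma> | \<sigma> permutes {1..m}. of_int (sign \<sigma>) * (\<Prod>i\<in>{1..m}. g (\<sigma> i) (e i))) = 0"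
proof -
  let ?t = "Transposition.transpose a b"
  let ?f = "\<lambda>\<sigma>. of_int (sign \<sigma>) * (\<Prod>i\<in>{1..m}. g (\<sigma> i) (e i)) :: complex poly"
  let ?P = "{\<sigma>. \<sigma> permutes {1..m}}"
  have t: "?t permutes {1..m}" using ab by (intro permutes_swap_id)
  have "(\<Sum>\<sigma>\<in>?P. ?f \<sigma>) = (\<Sum>\<sigma>\<in>?P. ?f (\<sigma> \<circ> ?t))"
    by (rule sum_permutations_compose_right[OF t])
  also have "\<dots> = (\<Sum>\<sigma>\<in>?P. - ?f \<sigma>)"
  proof (rule sum.cong[OF refl])
    fix \<sigma> assume "\<sigma> \<in> ?P"
    then have s: "\<sigma> permutes {1..m}" by simp
    have "sign (\<sigma> \<circ> ?t) = sign \<sigma> * sign ?t"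
      using s t by (intro sign_compose) (auto simp: permutation_permutes)
    also have "sign ?t = -1" using ab by (simp add: sign_swap_id)
    finally have sg: "sign (\<sigma> \<circ> ?t) = - sign \<sigma>" by (simp only: mult_minus_right mult_1_right)
    have "(\<Prod>i\<in>{1..m}. g (\<sigma> i) (e i)) = (\<Prod>i\<in>{1..m}. g (\<sigma> (?t i)) (e (?t i)))"
      using prod.permute[OF t, of "\<lambda>i. g (\<sigma> i) (e i)"] by (simp add: comp_def)
    also have "\<dots> = (\<Prod>i\<in>{1..m}. g (\<sigma> (?t i)) (e i))"
      using eq by (intro prod.cong refl) (auto simp: Transposition.transpose_def)
    finally have pr: "(\<Prod>i\<in>{1..m}. g ((\<sigma> \<circ> ?t) i) (e i)) = (\<Prod>i\<in>{1..m}. g (\<sigma> i) (e i))" by simp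
    show "?f (\<sigma> \<circ> ?t) = - ?f \<sigma>" by (simp only: sg pr of_int_minus mult_minus_left)
  qed
  also have "\<dots> = - (\<Sum>\<sigma>\<in>?P. ?f \<sigma>)" by (rule sum_negf)
  finally show ?thesis by (simp only: eq_neg_iff_add_eq_0 mult_2[symmetric]) simp
qed

text \<open>The edges of a path are pairs in W x W. A path with more steps than there are pairs
  repeats an edge, and the alternating sum over that path cancels. The bound is weaker than that of
  Amitsur and Levitzki, but \<open>W\<close> can be kept small compared with the degree.\<close>

lemma matrix_standard_identity:
  assumes W: "finite W" and m: "(card W)\<^sup>2 < m" and uv: "u \<in> W"
  shows "(\<Sum>\<sigma> | \<sigma> permutes {1..m}. of_int (sign \<sigma>) *
     foldr (mat_mult W) (map (\<lambda>i. M (\<sigma> i)) [1..<Suc m]) (mat_one W) u v) = 0"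
proof -
  let ?S = "{zs. set zs \<subseteq> W \<and> length zs = m}"
  let ?P = "{\<sigma>. \<sigma> permutes {1..m}}"
  let ?e = "\<lambda>zs i. ((u # zs) ! (i - 1), zs ! (i - 1))"
  have "(\<Sum>\<sigma>\<in>?P. of_int (sign \<sigma>) *
     foldr (mat_mult W) (map (\<lambda>i. M (\<sigma> i)) [1..<Suc m]) (mat_one W) u v)
    = (\<Sum>\<sigma>\<in>?P. \<Sum>zs\<in>?S. if last (u # zs) = v then of_int (sign \<sigma>) *
        (\<Prod>i\<in>{1..m}. case_prod (M (\<sigma> i)) (?e zs i)) else 0)"
  proof (rule sum.cong[OF refl])
    fix \<sigma>
    have "foldr (mat_mult W) (map (\<lambda>i. M (\<sigma> i)) [1..<Suc m]) (mat_one W) u v =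
      (\<Sum>zs\<in>?S. if last (u # zs) = v then (\<Prod>i<m. M (\<sigma> (Suc i)) ((u # zs) ! i) (zs ! i)) else 0)"
      by (subst foldr_mat_mult_paths[OF W uv]) (auto intro!: sum.cong prod.cong simp del: upt_Suc)
    moreover have "(\<Prod>i<m. M (\<sigma> (Suc i)) ((u # zs) ! i) (zs ! i)) = (\<Prod>i\<in>{1..m}. case_prod (M (\<sigma> i)) (?e zs i))" for zs
      by (rule prod.reindex_bij_witness[of _ "\<lambda>i. i - 1" Suc]) auto
    ultimately show "of_int (sign \<sigma>) *
     foldr (mat_mult W) (map (\<lambda>i. M (\<sigma> i)) [1..<Suc m]) (mat_one W) u v = (\<Sum>zs\<in>?S. if last (u # zs) = v then of_int (sign \<sigma>) *
        (\<Prod>i\<in>{1..m}. case_prod (M (\<sigma> i)) (?e zs i)) else 0)"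
      by (simp add: sum_distrib_left if_distrib cong: if_cong)
  qed
  also have "\<dots> = (\<Sum>zs\<in>?S. \<Sum>\<sigma>\<in>?P. if last (u # zs) = v then of_int (sign \<sigma>) *
        (\<Prod>i\<in>{1..m}. case_prod (M (\<sigma> i)) (?e zs i)) else 0)"
    by (rule sum.swap)
  also have "\<dots> = (\<Sum>zs\<in>?S. 0)"
  proof (rule sum.cong[OF refl])
    fix zs assume "zs \<in> ?S"
    then have zs: "set zs \<subseteq> W" "length zs = m" by auto
    have "?e zs ` {1..m} \<subseteq> W \<times> W"
    proof
      fix q assume "q \<in> ?e zs ` {1..m}"
      then obtain i where i: "i \<in> {1..m}" "q = ?e zs i" by auto
      have "zs ! (i - 1) \<in> W" using zs i by (metis atLeastAtMost_iff nth_mem subsetD Suc_pred' less_eq_Suc_le One_nat_def)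
      moreover have "(u # zs) ! (i - 1) \<in> set (u # zs)" using zs i by (intro nth_mem) auto
      ultimately show "q \<in> W \<times> W" using i zs uv by auto
    qed
    then have "card (?e zs ` {1..m}) \<le> card (W \<times> W)" using W by (intro card_mono) auto
    also have "\<dots> < card {1..m}" using m by (simp add: card_cartesian_product power2_eq_square)
    finally have "\<not> inj_on (?e zs) {1..m}" using card_image by fastforce
    then obtain a b where "a \<in> {1..m}" "b \<in> {1..m}" "a \<noteq> b" "?e zs a = ?e zs b"
      by (auto simp: inj_on_def simp del: prod.inject)
    from alternating_sum_zero[OF this, of "\<lambda>j. case_prod (M j)"]
    show "(\<Sum>\<sigma>\<in>?P. if last (u # zs) = v then of_int (sign \<sigma>) *
        (\<Prod>i\<in>{1..m}. case_prod (M (\<sigma> i)) (?e zs i)) else 0) = 0"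
      by (cases "last (u # zs) = v") (simp_all only: if_True if_False sum.neutral_const simp_thms)
  qed
  finally show ?thesis by simp
qed

section \<open>A strictly positive functional on polynomials\<close>

text \<open>Natural subtraction makes the last factor 1 for \<open>k \<le> 2 * d\<close>, so
  \<open>L\<close> does not touch the weights of words of length at most 2d. The square in the
  exponent makes the normalised Hankel matrix decay off the diagonal: (2i)^2 + (2j)^2 exceeds 2
  (i+j)^2 by 2 (i-j)^2.\<close>

definition weight :: "nat \<Rightarrow> real \<Rightarrow> real \<Rightarrow> nat \<Rightarrow> real"
  where "weight d \<alpha> L k = \<alpha> * 16 ^ (k * k) * L ^ (k - 2 * d)"

definition weight_functional :: "nat \<Rightarrow> real \<Rightarrow> real \<Rightarrow> complex poly \<Rightarrow> complex"
  where "weight_functional d \<alpha> L p = (\<Sum>k\<le>degree p. of_real (weight d \<alpha> L k) * coeff p k)"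

lemma weight_functional_eq:
  "degree p \<le> n \<Longrightarrow> weight_functional d \<alpha> L p = (\<Sum>k\<le>n. of_real (weight d \<alpha> L k) * coeff p k)"
  unfolding weight_functional_def by (rule sum.mono_neutral_left) (auto simp: coeff_eq_0)

lemma weight_functional_add:
  "weight_functional d \<alpha> L (p + q) = weight_functional d \<alpha> L p + weight_functional d \<alpha> L q"
proof -
  let ?n = "max (degree p) (degree q)"
  have "degree (p + q) \<le> ?n" by (rule degree_add_le_max)
  then show ?thesis
    by (simp add: weight_functional_eq[of _ ?n] sum.distrib algebra_simps)
qed

lemma weight_functional_0 [simp]: "weight_functional d \<alpha> L 0 = 0"
  by (simp add: weight_functional_def)

lemma weight_functional_sum:
  "weight_functional d \<alpha> L (\<Sum>i\<in>I. f i) = (\<Sum>i\<in>I. weight_functional d \<alpha> L (f i))"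
  by (induction I rule: infinite_finite_induct) (simp_all add: weight_functional_add)

lemma weight_functional_smult:
  "weight_functional d \<alpha> L (smult c p) = c * weight_functional d \<alpha> L p"
  using weight_functional_eq[of "smult c p" "degree p"]
  by (simp add: weight_functional_def degree_smult_le sum_distrib_left algebra_simps)

lemma weight_functional_monom:
  "weight_functional d \<alpha> L (monom c k) = of_real (weight d \<alpha> L k) * c"
  using weight_functional_eq[of "monom c k" k] 
  by (simp add: degree_monom_le if_distrib cong: if_cong)

lemma weight_functional_cnj:
  "weight_functional d \<alpha> L (map_poly cnj p) = cnj (weight_functional d \<alpha> L p)"
proof -
  have "degree (map_poly cnj p) = degree p" by (rule degree_map_poly) simp
  then show ?thesis by (simp add: weight_functional_def coeff_map_poly)
qed

lemma weight_functional_mult: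
  "weight_functional d \<alpha> L (p * q) =
    (\<Sum>i\<le>degree p. \<Sum>j\<le>degree q. of_real (weight d \<alpha> L (i + j)) * coeff p i * coeff q j)"
proof -
  have "p * q = (\<Sum>i\<le>degree p. monom (coeff p i) i) * (\<Sum>j\<le>degree q. monom (coeff q j) j)"
    by (simp add: poly_as_sum_of_monoms)
  also have "\<dots> = (\<Sum>i\<le>degree p. \<Sum>j\<le>degree q. monom (coeff p i * coeff q j) (i + j))"
    by (simp add: sum_product mult_monom)
  finally show ?thesis
    by (simp add: weight_functional_sum weight_functional_monom mult.assoc)
qed

text \<open>The arithmetic-geometric mean inequality; bounding the square of \<open>K\<close> avoids
  the root of \<open>a * b\<close>.\<close>

lemma weighted_amgm:
  fixes a b x y K :: real
  assumes "K\<^sup>2 \<le> a * b" "0 \<le> a" "0 \<le> b" "0 \<le> x" "0 \<le> y" "0 \<le> K"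
  shows "2 * K * x * y \<le> a * x\<^sup>2 + b * y\<^sup>2"
proof -
  have "(2 * K * x * y)\<^sup>2 = 4 * K\<^sup>2 * (x * y)\<^sup>2" by (simp add: power_mult_distrib)
  also have "\<dots> \<le> 4 * (a * b) * (x * y)\<^sup>2" using assms by (intro mult_right_mono) auto
  also have "\<dots> \<le> (a * x\<^sup>2 + b * y\<^sup>2)\<^sup>2"
    using zero_le_power2[of "a * x\<^sup>2 - b * y\<^sup>2"] by (simp add: power2_eq_square algebra_simps)
  finally show ?thesis
    using assms by (meson power2_le_imp_le add_nonneg_nonneg mult_nonneg_nonneg zero_le_power2)
qed

text \<open>The quadratic exponents satisfy the parallelogram identity \<open>sq\<close>, and the
  truncated exponent of \<open>L\<close> is convex. Hence a Hankel entry divided by the geometric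
  mean of its two diagonal entries is at most 16^(-\<delta>), where \<delta> = |i - j| is written as
  a sum of two natural differences.\<close>

lemma weight_log_convex:
  assumes "\<alpha> > 0" "L \<ge> 1"
  shows "(16 ^ ((i - j) + (j - i)) * weight d \<alpha> L (i + j))\<^sup>2 \<le> weight d \<alpha> L (2 * i) * weight d \<alpha> L (2 * j)"
proof -
  define \<delta> where "\<delta> = (i - j) + (j - i)"
  have sq: "2 * i * (2 * i) + 2 * j * (2 * j) = 2 * ((i + j) * (i + j)) + 2 * (\<delta> * \<delta>)"
  proof (cases "i \<le> j")
    case True
    then obtain k where "j = i + k" using le_Suc_ex by blast
    then show ?thesis by (simp add: \<delta>_def algebra_simps)
  next
    case False
    then obtain k where "i = j + k" using le_Suc_ex nat_le_linear by blast
    then show ?thesis by (simp add: \<delta>_def algebra_simps)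
  qed
  have dd: "\<delta> \<le> \<delta> * \<delta>" by (cases \<delta>) auto
  have pw: "(x ^ r * (a * x ^ s * l ^ t))\<^sup>2 = a\<^sup>2 * x ^ (2 * r + 2 * s) * l ^ (2 * t)"
    for x a l :: real and r s t :: nat
    by (simp add: power_mult_distrib power_add power_mult[symmetric] mult.commute mult.left_commute)
  have "(16 ^ \<delta> * weight d \<alpha> L (i + j))\<^sup>2
    = \<alpha>\<^sup>2 * 16 ^ (2 * \<delta> + 2 * ((i + j) * (i + j))) * L ^ (2 * (i + j - 2 * d))"
    unfolding weight_def by (rule pw)
  also have "\<dots> \<le> \<alpha>\<^sup>2 * 16 ^ (2 * i * (2 * i) + 2 * j * (2 * j)) * L ^ ((2 * i - 2 * d) + (2 * j - 2 * d))"
  proof (rule mult_mono[OF mult_left_mono[OF power_increasing] power_increasing])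
    show "2 * \<delta> + 2 * ((i + j) * (i + j)) \<le> 2 * i * (2 * i) + 2 * j * (2 * j)" using dd sq by linarith
    show "2 * (i + j - 2 * d) \<le> 2 * i - 2 * d + (2 * j - 2 * d)" by arith
  qed (use assms in auto)
  also have "\<dots> = weight d \<alpha> L (2 * i) * weight d \<alpha> L (2 * j)"
    unfolding weight_def power_add power2_eq_square by (simp only: mult.assoc mult.commute mult.left_commute)
  finally show ?thesis by (simp only: \<delta>_def)
qed

text \<open>Two geometric series, one on each side of \<open>i\<close>, each at most 1/15.\<close>

lemma sum_inverse_power_16_le: "(\<Sum>j\<in>{..n} - {i}. (1 / 16) ^ ((i - j) + (j - i))) \<le> (1 / 2 :: real)"
proof -
  have g: "(\<Sum>k=1..m. (1 / 16) ^ k) \<le> (1 / 15 :: real)" for m :: nat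
  proof -
    have "(\<Sum>k=1..m. (1 / 16) ^ k) + (1 / 15) * (1 / 16) ^ m = (1 / 15 :: real)"
      by (induction m) (simp_all add: field_simps)
    then show ?thesis by (smt (verit) zero_le_power divide_nonneg_nonneg mult_nonneg_nonneg)
  qed
  have "(\<Sum>j\<in>{..n} - {i}. (1 / 16) ^ ((i - j) + (j - i))) \<le> (\<Sum>j\<in>{..<i} \<union> {i<..i+n}. (1 / 16 :: real) ^ ((i - j) + (j - i)))"
    by (intro sum_mono2) auto
  also have "\<dots> = (\<Sum>j\<in>{..<i}. (1 / 16 :: real) ^ ((i - j) + (j - i))) + (\<Sum>j\<in>{i<..i+n}. (1 / 16) ^ ((i - j) + (j - i)))"
    by (intro sum.union_disjoint) auto
  also have "(\<Sum>j\<in>{..<i}. (1 / 16 :: real) ^ ((i - j) + (j - i))) = (\<Sum>k=1..i. (1 / 16) ^ k)"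
    by (rule sum.reindex_bij_witness[of _ "\<lambda>k. i - k" "\<lambda>j. i - j"]) auto
  also have "(\<Sum>j\<in>{i<..i+n}. (1 / 16 :: real) ^ ((i - j) + (j - i))) = (\<Sum>k=1..n. (1 / 16) ^ k)"
    by (rule sum.reindex_bij_witness[of _ "\<lambda>k. i + k" "\<lambda>j. j - i"]) auto
  finally show ?thesis using g[of i] g[of n] by linarith
qed

lemma weight_pos: "\<alpha> > 0 \<Longrightarrow> L \<ge> 1 \<Longrightarrow> weight d \<alpha> L k > 0"
  by (simp add: weight_def)

text \<open>Diagonal dominance: each off-diagonal term is charged to its two diagonal entries with
  the factor 16^(-\<delta>)/2. Either share adds up to at most a quarter of the diagonal sum, so
  half of that sum survives.\<close>

lemma weight_functional_square:
  assumes "\<alpha> > 0" "L \<ge> 1"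
  shows "Re (weight_functional d \<alpha> L (map_poly cnj p * p)) \<ge>
    (\<Sum>i\<le>degree p. weight d \<alpha> L (2 * i) * (cmod (coeff p i))\<^sup>2) / 2"
proof -
  let ?w = "weight d \<alpha> L" and ?n = "degree p" and ?x = "\<lambda>i. cmod (coeff p i)"
  let ?\<delta> = "\<lambda>i j::nat. (i - j) + (j - i)"
  have deg: "degree (map_poly cnj p) = ?n" by (rule degree_map_poly) simp
  let ?t = "\<lambda>i j. of_real (?w (i + j)) * cnj (coeff p i) * coeff p j"
  have W: "weight_functional d \<alpha> L (map_poly cnj p * p) = (\<Sum>i\<le>?n. \<Sum>j\<le>?n. ?t i j)"
    by (simp add: weight_functional_mult deg coeff_map_poly)
  have off: "- Re (?t i j) \<le> (1 / 16) ^ ?\<delta> i j * (?w (2 * i) * (?x i)\<^sup>2) / 2 + (1 / 16) ^ ?\<delta> i j * (?w (2 * j) * (?x j)\<^sup>2) / 2" for i j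
  proof -
    have "- Re (?t i j) \<le> cmod (?t i j)" using complex_Re_le_cmod[of "- ?t i j"] by simp
    also have "\<dots> = ?w (i + j) * ?x i * ?x j"
      using weight_pos[OF assms, of d "i + j"] by (simp add: norm_mult)
    also have "\<dots> = (1 / 16) ^ ?\<delta> i j / 2 * (2 * (16 ^ ?\<delta> i j * ?w (i + j)) * ?x i * ?x j)"
      by (simp add: power_divide)
    also have "\<dots> \<le> (1 / 16) ^ ?\<delta> i j / 2 * (?w (2 * i) * (?x i)\<^sup>2 + ?w (2 * j) * (?x j)\<^sup>2)"
      using weight_pos[OF assms, of d] weight_log_convex[OF assms, of i j d]
      by (intro mult_left_mono weighted_amgm) (auto intro!: less_imp_le)
    finally show ?thesis by (simp add: algebra_simps)
  qed
  let ?D = "\<Sum>i\<le>?n. ?w (2 * i) * (?x i)\<^sup>2"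
  have one: "(\<Sum>i\<le>?n. \<Sum>j\<in>{..?n}-{i}. (1 / 16) ^ ?\<delta> i j * (?w (2 * i) * (?x i)\<^sup>2) / 2) \<le> ?D / 4"
  proof -
    have "(\<Sum>j\<in>{..?n}-{i}. (1 / 16) ^ ?\<delta> i j * (?w (2 * i) * (?x i)\<^sup>2) / 2) \<le> ?w (2 * i) * (?x i)\<^sup>2 / 4" for i
    proof -
      have "(\<Sum>j\<in>{..?n}-{i}. (1 / 16) ^ ?\<delta> i j * (?w (2 * i) * (?x i)\<^sup>2) / 2)
        = (\<Sum>j\<in>{..?n}-{i}. (1 / 16) ^ ?\<delta> i j) * (?w (2 * i) * (?x i)\<^sup>2 / 2)"
        by (simp add: sum_distrib_right)
      also have "\<dots> \<le> (1 / 2) * (?w (2 * i) * (?x i)\<^sup>2 / 2)"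
        using weight_pos[OF assms, of d "2 * i"] by (intro mult_right_mono sum_inverse_power_16_le) simp
      finally show ?thesis by simp
    qed
    then have "(\<Sum>i\<le>?n. \<Sum>j\<in>{..?n}-{i}. (1 / 16) ^ ?\<delta> i j * (?w (2 * i) * (?x i)\<^sup>2) / 2) \<le> (\<Sum>i\<le>?n. ?w (2 * i) * (?x i)\<^sup>2 / 4)"
      by (intro sum_mono)
    then show ?thesis by (simp add: sum_divide_distrib)
  qed
  \<comment> \<open>Exchanging the summation indices reduces the second share in \<open>off\<close>
    to the estimate \<open>one\<close>.\<close>
  have sw: "(\<Sum>i\<le>?n. \<Sum>j\<in>{..?n}-{i}. h i j) = (\<Sum>i\<le>?n. \<Sum>j\<in>{..?n}-{i}. h j i)" for h :: "nat \<Rightarrow> nat \<Rightarrow> real"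
  proof -
    have *: "(\<Sum>i\<le>?n. \<Sum>j\<in>{..?n}-{i}. h i j) = (\<Sum>i\<le>?n. \<Sum>j\<le>?n. if i = j then 0 else h i j)" for h :: "nat \<Rightarrow> nat \<Rightarrow> real"
      by (intro sum.cong refl sum.mono_neutral_cong_left) auto
    show ?thesis unfolding * by (subst sum.swap) (auto intro!: sum.cong)
  qed
  have two: "(\<Sum>i\<le>?n. \<Sum>j\<in>{..?n}-{i}. (1 / 16) ^ ?\<delta> i j * (?w (2 * j) * (?x j)\<^sup>2) / 2) \<le> ?D / 4"
    by (subst sw) (use one in \<open>simp add: add.commute\<close>)
  have "Re (weight_functional d \<alpha> L (map_poly cnj p * p)) = (\<Sum>i\<le>?n. \<Sum>j\<le>?n. Re (?t i j))"
    unfolding W by simp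
  also have "\<dots> = (\<Sum>i\<le>?n. Re (?t i i) + (\<Sum>j\<in>{..?n}-{i}. Re (?t i j)))"
    by (intro sum.cong refl sum.remove) auto
  also have "\<dots> = ?D + (\<Sum>i\<le>?n. \<Sum>j\<in>{..?n}-{i}. Re (?t i j))"
  proof -
    have "Re (?t i i) = ?w (2 * i) * (?x i)\<^sup>2" for i
      by (simp only: cmod_power2) (simp add: mult_2 mult_2_right power2_eq_square algebra_simps)
    then show ?thesis by (simp only: sum.distrib)
  qed
  finally have main: "Re (weight_functional d \<alpha> L (map_poly cnj p * p)) = ?D + (\<Sum>i\<le>?n. \<Sum>j\<in>{..?n}-{i}. Re (?t i j))" .
  have "(\<Sum>i\<le>?n. \<Sum>j\<in>{..?n}-{i}. Re (?t i j)) \<ge>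
     (\<Sum>i\<le>?n. \<Sum>j\<in>{..?n}-{i}. - ((1 / 16) ^ ?\<delta> i j * (?w (2 * i) * (?x i)\<^sup>2) / 2 + (1 / 16) ^ ?\<delta> i j * (?w (2 * j) * (?x j)\<^sup>2) / 2))"
  proof (rule sum_mono, rule sum_mono)
    show "- ((1 / 16) ^ ?\<delta> i j * (?w (2 * i) * (?x i)\<^sup>2) / 2 + (1 / 16) ^ ?\<delta> i j * (?w (2 * j) * (?x j)\<^sup>2) / 2) \<le> Re (?t i j)" for i j
      using off[of i j] by linarith
  qed
  also have "(\<Sum>i\<le>?n. \<Sum>j\<in>{..?n}-{i}. - ((1 / 16) ^ ?\<delta> i j * (?w (2 * i) * (?x i)\<^sup>2) / 2 + (1 / 16) ^ ?\<delta> i j * (?w (2 * j) * (?x j)\<^sup>2) / 2))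
    = - ((\<Sum>i\<le>?n. \<Sum>j\<in>{..?n}-{i}. (1 / 16) ^ ?\<delta> i j * (?w (2 * i) * (?x i)\<^sup>2) / 2)
      + (\<Sum>i\<le>?n. \<Sum>j\<in>{..?n}-{i}. (1 / 16) ^ ?\<delta> i j * (?w (2 * j) * (?x j)\<^sup>2) / 2))"
    by (simp only: sum_negf sum.distrib)
  finally have "?D + (\<Sum>i\<le>?n. \<Sum>j\<in>{..?n}-{i}. Re (?t i j)) \<ge> ?D / 2"
    using one two by linarith
  then show ?thesis unfolding main .
qed

section \<open>Noncommutative polynomials\<close>

text \<open>A list of pairs \<open>(c, w)\<close> stands for the sum of the monomials \<open>c * w\<close>, a word \<open>w\<close> being a
  list of indices of selfadjoint letters.\<close>

type_synonym ncpoly = "(complex \<times> nat list) list"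

definition ncmult :: "ncpoly \<Rightarrow> ncpoly \<Rightarrow> ncpoly"
  where "ncmult P Q = concat (map (\<lambda>(a, u). map (\<lambda>(b, v). (a * b, u @ v)) Q) P)"

definition ncscale :: "complex \<Rightarrow> ncpoly \<Rightarrow> ncpoly"
  where "ncscale c P = map (\<lambda>(a, u). (c * a, u)) P"

definition ncadj :: "ncpoly \<Rightarrow> ncpoly"
  where "ncadj P = map (\<lambda>(a, u). (cnj a, rev u)) P"

definition nclin :: "(nat list \<Rightarrow> complex) \<Rightarrow> ncpoly \<Rightarrow> complex"
  where "nclin f P = (\<Sum>(c, w)\<leftarrow>P. c * f w)"

lemma nclin_Nil [simp]: "nclin f [] = 0"
  and nclin_Cons [simp]: "nclin f ((c, w) # P) = c * f w + nclin f P"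
  and nclin_append [simp]: "nclin f (P @ Q) = nclin f P + nclin f Q"
  by (simp_all add: nclin_def)

lemma ncmult_Nil [simp]: "ncmult [] Q = []"
  and ncmult_Cons: "ncmult ((a, u) # P) Q = map (\<lambda>(b, v). (a * b, u @ v)) Q @ ncmult P Q"
  by (simp_all add: ncmult_def)

lemma nclin_map_mult: "nclin f (map (\<lambda>(b, v). (a * b, u @ v)) Q) = a * nclin (\<lambda>v. f (u @ v)) Q"
  by (induction Q) (auto simp: algebra_simps)

lemma nclin_mult: "nclin f (ncmult P Q) = nclin (\<lambda>u. nclin (\<lambda>v. f (u @ v)) Q) P"
  by (induction P) (auto simp: ncmult_Cons nclin_map_mult)

lemma nclin_add_fun: "nclin (\<lambda>w. f w + g w) P = nclin f P + nclin g P"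
  by (induction P) (auto simp: algebra_simps)

lemma nclin_mult_fun: "nclin (\<lambda>w. c * f w) P = c * nclin f P"
  by (induction P) (auto simp: algebra_simps)

lemma nclin_zero_fun: "nclin (\<lambda>w. 0) P = 0"
  by (induction P) auto

text \<open>Finite Fubini; it lifts commutation on words to traciality of the linear
  extension.\<close>

lemma nclin_swap: "nclin (\<lambda>u. nclin (\<lambda>v. f u v) Q) P = nclin (\<lambda>v. nclin (\<lambda>u. f u v) P) Q"
  by (induction P) (auto simp: nclin_add_fun nclin_mult_fun nclin_zero_fun)

lemma nclin_adj: "nclin f (ncadj P) = cnj (nclin (\<lambda>w. cnj (f (rev w))) P)"
  by (induction P) (auto simp: ncadj_def)

section \<open>The truncated Fock representation\<close>

text \<open>One parameter bounds both letters and length, so every word lies in all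
  \<open>words d\<close> from some \<open>d\<close> on. The factor 2 leaves room for products of two
  words of length at most \<open>d\<close>.\<close>

definition words :: "nat \<Rightarrow> nat list set"
  where "words d = {w. set w \<subseteq> {..<d} \<and> length w \<le> 2 * d}"

text \<open>The case \<open>u = i # v\<close> is creation and \<open>v = i # u\<close> is
  annihilation. Creation is cut off at length 2d, and a letter \<open>i \<ge> d\<close> acts as
  zero.\<close>

definition fock_gen :: "nat \<Rightarrow> nat \<Rightarrow> nat list \<Rightarrow> nat list \<Rightarrow> complex"
  where "fock_gen d i u v =
    (if u \<in> words d \<and> v \<in> words d \<and> (u = i # v \<or> v = i # u) then 1 else 0)"

primrec fock :: "nat \<Rightarrow> nat list \<Rightarrow> nat list \<Rightarrow> nat list \<Rightarrow> complex"
  where "fock d [] u v = (if u = v \<and> u \<in> words d then 1 else 0)"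
  | "fock d (i # w) u v = (\<Sum>z\<in>words d. fock_gen d i u z * fock d w z v)"

lemma finite_words [simp]: "finite (words d)"
  unfolding words_def by (rule finite_lists_length_le) simp

lemma Nil_in_words [simp]: "[] \<in> words d"
  by (simp add: words_def)

lemma rev_in_words [simp]: "rev w \<in> words d \<longleftrightarrow> w \<in> words d"
  by (simp add: words_def)

lemma append_commute_words: "u @ v \<in> words d \<longleftrightarrow> v @ u \<in> words d"
  by (auto simp: words_def)

lemma fock_outside: "u \<notin> words d \<Longrightarrow> fock d w u v = 0" "v \<notin> words d \<Longrightarrow> fock d w u v = 0"
  by (induction w arbitrary: u) (auto simp: fock_gen_def)

lemma sum_delta_words:
  "u \<in> words d \<Longrightarrow> (\<Sum>z\<in>words d. (if u = z \<and> u \<in> words d then 1 else 0) * f z) = (f u :: complex)"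
  by (simp add: if_distrib[of "\<lambda>x. x * _"] cong: if_cong)

lemma fock_append: "fock d (a @ b) u v = (\<Sum>z\<in>words d. fock d a u z * fock d b z v)"
proof (induction a arbitrary: u)
  case Nil
  show ?case
  proof (cases "u \<in> words d")
    case True
    then show ?thesis using sum_delta_words[of u d "\<lambda>z. fock d b z v"] by simp
  qed (simp add: fock_outside)
next
  case (Cons i a)
  have "fock d ((i # a) @ b) u v = (\<Sum>y\<in>words d. \<Sum>z\<in>words d. fock_gen d i u y * fock d a y z * fock d b z v)"
    using Cons by (simp add: sum_distrib_left mult.assoc)
  also have "\<dots> = (\<Sum>z\<in>words d. \<Sum>y\<in>words d. fock_gen d i u y * fock d a y z * fock d b z v)"
    by (rule sum.swap)
  finally show ?case by (simp add: sum_distrib_right)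
qed

lemma fock_gen_commute: "fock_gen d i u v = fock_gen d i v u"
  by (auto simp: fock_gen_def)

lemma fock_single: "fock d [i] u v = fock_gen d i u v"
proof (cases "v \<in> words d")
  case True
  have "(\<Sum>z\<in>words d. fock_gen d i u z * (if z = v \<and> z \<in> words d then 1 else 0))
    = (\<Sum>z\<in>words d. if z = v then fock_gen d i u z else 0)"
    by (intro sum.cong) auto
  then show ?thesis using True by simp
qed (auto simp: fock_gen_def intro!: sum.neutral)

lemma fock_rev: "fock d (rev w) u v = fock d w v u"
proof (induction w arbitrary: u v)
  case (Cons i w)
  have "fock d (rev (i # w)) u v = (\<Sum>z\<in>words d. fock d w z u * fock_gen d i v z)"
    by (simp add: fock_append Cons fock_single fock_gen_commute[of d i v] del: fock.simps(2))
  then show ?case by (simp add: mult.commute)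
qed auto

lemma cnj_fock: "cnj (fock d w u v) = fock d w u v"
  by (induction w arbitrary: u) (auto simp: fock_gen_def intro!: sum.cong)

text \<open>A word of length at most \<open>length v\<close> reaches \<open>v\<close> from the vacuum only by creating all its
  letters.\<close>

lemma fock_vacuum:
  "length w \<le> length v \<Longrightarrow> fock d w v [] = (if w = v \<and> v \<in> words d then 1 else 0)"
proof (induction w arbitrary: v)
  case (Cons i w)
  then obtain j z where v: "v = j # z" and len: "length w \<le> length z" by (cases v) auto
  have "fock_gen d i v y * fock d w y [] = (if y = z \<and> i = j \<and> w = z \<and> v \<in> words d then 1 else 0)"
    if y: "y \<in> words d" for y
  proof (cases "fock_gen d i v y = 0")
    case True
    have "\<not> (y = z \<and> i = j \<and> v \<in> words d)" using True y v by (auto simp: fock_gen_def split: if_splits)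
    then show ?thesis using True by auto
  next
    case False
    then have f: "v \<in> words d" "(v = i # y \<or> y = i # v)" "fock_gen d i v y = 1"
      by (auto simp: fock_gen_def split: if_splits)
    have ly: "length w \<le> length y" using f(2) v len by auto
    \<comment> \<open>In the annihilation case \<open>y = i # v\<close> the word \<open>w\<close> is
      too short to create \<open>y\<close>, so the induction hypothesis gives 0.\<close>
    show ?thesis using f(2) Cons.IH[OF ly] f v y len by auto
  qed
  then have "fock d (i # w) v [] = (\<Sum>y\<in>words d. if y = z \<and> i = j \<and> w = z \<and> v \<in> words d then 1 else 0)"
    by simp
  also have "\<dots> = (if i # w = v \<and> v \<in> words d then 1 else 0)"
  proof (cases "i # w = v \<and> v \<in> words d")
    case True
    then have "z \<in> words d" using v by (auto simp: words_def)
    then show ?thesis using True v by simp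
  qed (use v in auto)
  finally show ?case .
qed auto

definition ncmat :: "nat \<Rightarrow> ncpoly \<Rightarrow> nat list \<Rightarrow> nat list \<Rightarrow> complex poly"
  where "ncmat d P = (\<lambda>u v. \<Sum>(c, w)\<leftarrow>P. monom (c * fock d w u v) (length w))"

lemma ncmat_Nil [simp]: "ncmat d [] u v = 0"
  and ncmat_Cons: "ncmat d ((c, w) # P) u v = monom (c * fock d w u v) (length w) + ncmat d P u v"
  and ncmat_append: "ncmat d (P @ Q) u v = ncmat d P u v + ncmat d Q u v"
  by (simp_all add: ncmat_def)

lemma ncmat_scale: "ncmat d (ncscale c P) u v = smult c (ncmat d P u v)"
  by (induction P) (auto simp: ncscale_def ncmat_Cons smult_add_right smult_monom mult.assoc)

lemma ncmat_outside: "u \<notin> words d \<Longrightarrow> ncmat d P u v = 0" "v \<notin> words d \<Longrightarrow> ncmat d P u v = 0"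
  by (induction P) (auto simp: ncmat_Cons fock_outside)

lemma ncmat_one: "ncmat d [(1, [])] = mat_one (words d)"
  by (auto simp: ncmat_Cons mat_one_def fun_eq_iff)

lemma ncmat_mult_single:
  "ncmat d (map (\<lambda>(b, y). (a * b, w @ y)) Q) u v = (\<Sum>z\<in>words d. monom (a * fock d w u z) (length w) * ncmat d Q z v)"
proof (induction Q)
  case (Cons p Q)
  obtain b y where p: "p = (b, y)" by (cases p)
  have "monom (a * b * fock d (w @ y) u v) (length w + length y) =
    (\<Sum>z\<in>words d. monom (a * fock d w u z) (length w) * monom (b * fock d y z v) (length y))"
    by (simp add: fock_append mult_monom monom_sum[symmetric] sum_distrib_left mult.assoc mult.left_commute)
  then show ?case using Cons by (simp add: p ncmat_Cons distrib_left sum.distrib)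
qed simp

lemma ncmat_mult: "ncmat d (ncmult P Q) = mat_mult (words d) (ncmat d P) (ncmat d Q)"
proof (intro ext)
  show "ncmat d (ncmult P Q) u v = mat_mult (words d) (ncmat d P) (ncmat d Q) u v" for u v
    by (induction P) (auto simp: mat_mult_def ncmult_Cons ncmat_append ncmat_mult_single ncmat_Cons distrib_right sum.distrib)
qed

text \<open>Only coefficients are conjugated: the indeterminate is selfadjoint.\<close>

definition mat_adj :: "('w \<Rightarrow> 'w \<Rightarrow> complex poly) \<Rightarrow> 'w \<Rightarrow> 'w \<Rightarrow> complex poly"
  where "mat_adj F = (\<lambda>u v. map_poly cnj (F v u))"

lemma map_poly_cnj_add: "map_poly cnj (p + q) = map_poly cnj p + map_poly cnj q"
  by (rule poly_eqI) (simp add: coeff_map_poly)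

lemma map_poly_cnj_mult: "map_poly cnj (p * q) = map_poly cnj p * map_poly cnj q"
  by (rule poly_eqI) (simp add: coeff_map_poly coeff_mult)

lemma map_poly_cnj_sum: "map_poly cnj (\<Sum>i\<in>I. f i) = (\<Sum>i\<in>I. map_poly cnj (f i))"
  by (induction I rule: infinite_finite_induct) (simp_all add: map_poly_cnj_add)

lemma map_poly_cnj_smult: "map_poly cnj (smult c p) = smult (cnj c) (map_poly cnj p)"
  by (rule poly_eqI) (simp add: coeff_map_poly)

lemma map_poly_cnj_monom: "map_poly cnj (monom c k) = monom (cnj c) k"
  by (rule poly_eqI) (simp add: coeff_map_poly)

lemma ncmat_adj: "ncmat d (ncadj P) = mat_adj (ncmat d P)"
proof (intro ext)
  show "ncmat d (ncadj P) u v = mat_adj (ncmat d P) u v" for u v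
    by (induction P) (auto simp: ncadj_def mat_adj_def ncmat_Cons map_poly_cnj_add map_poly_cnj_monom cnj_fock fock_rev)
qed

lemma mat_adj_adj: "mat_adj (mat_adj F) = F"
  by (intro ext poly_eqI) (simp add: mat_adj_def coeff_map_poly)

lemma mat_adj_mult: "mat_adj (mat_mult W F G) = mat_mult W (mat_adj G) (mat_adj F)"
  by (intro ext) (simp add: mat_adj_def mat_mult_def map_poly_cnj_sum map_poly_cnj_mult mult.commute)

lemma mat_mult_assoc: "mat_mult W (mat_mult W F G) H = mat_mult W F (mat_mult W G H)"
proof (intro ext)
  fix u v
  have "mat_mult W (mat_mult W F G) H u v = (\<Sum>z\<in>W. \<Sum>y\<in>W. F u y * G y z * H z v)"
    by (simp add: mat_mult_def sum_distrib_right)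
  also have "\<dots> = (\<Sum>y\<in>W. \<Sum>z\<in>W. F u y * G y z * H z v)" by (rule sum.swap)
  also have "\<dots> = mat_mult W F (mat_mult W G H) u v"
    by (simp add: mat_mult_def sum_distrib_left mult.assoc)
  finally show "mat_mult W (mat_mult W F G) H u v = mat_mult W F (mat_mult W G H) u v" .
qed

section \<open>A trace on the truncated Fock algebra\<close>

definition word_coeff :: "(nat list \<Rightarrow> nat list \<Rightarrow> complex poly) \<Rightarrow> nat list \<Rightarrow> complex"
  where "word_coeff F w = coeff (F w []) (length w)"

text \<open>This makes functionals on words well defined on matrices: \<open>nclin g P\<close>
  depends on \<open>P\<close> only through \<open>ncmat d P\<close>. Words of a length different
  from that of \<open>w\<close> contribute to another degree, and words of the same length are
  separated by \<open>fock_vacuum\<close>.\<close>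

lemma nclin_word_coeff:
  assumes g: "\<And>w. w \<notin> words d \<Longrightarrow> g w = 0"
  shows "nclin g P = (\<Sum>w\<in>words d. word_coeff (ncmat d P) w * g w)"
proof (induction P)
  case (Cons p P)
  obtain c y where p: "p = (c, y)" by (cases p)
  have "coeff (monom (c * fock d y w []) (length y)) (length w) * g w = (if w = y then c * g y else 0)"
    if "w \<in> words d" for w
    using that fock_vacuum[of y w d] by (cases "length y = length w") (auto simp: coeff_monom)
  then have "(\<Sum>w\<in>words d. coeff (monom (c * fock d y w []) (length y)) (length w) * g w)
     = (\<Sum>w\<in>words d. if w = y then c * g y else 0)" by (rule sum.cong[OF refl])
  also have "\<dots> = c * g y" using g[of y] by simp
  finally show ?case using Cons
    by (simp add: p word_coeff_def ncmat_Cons distrib_right sum.distrib)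
qed (simp add: word_coeff_def)

text \<open>Defined on matrices, so that no choice of a representing polynomial enters;
  \<open>truncated_trace_ncmat\<close> recovers the intended values on words.\<close>

definition truncated_trace :: "nat \<Rightarrow> (nat list \<Rightarrow> complex) \<Rightarrow> (nat list \<Rightarrow> nat list \<Rightarrow> complex poly) \<Rightarrow> complex"
  where "truncated_trace d t F = (\<Sum>w\<in>words d. word_coeff F w * t w)"

lemma truncated_trace_ncmat:
  "truncated_trace d t (ncmat d P) = nclin (\<lambda>w. if w \<in> words d then t w else 0) P"
  by (subst nclin_word_coeff[of d]) (simp_all add: truncated_trace_def)

text \<open>Summing over the whole diagonal, instead of taking the vacuum entry, gives a tracial
  functional, since polynomials commute.\<close>

definition weight_trace :: "nat \<Rightarrow> real \<Rightarrow> real \<Rightarrow> (nat list \<Rightarrow> nat list \<Rightarrow> complex poly) \<Rightarrow> complex"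
  where "weight_trace d \<alpha> L F = (\<Sum>u\<in>words d. weight_functional d \<alpha> L (F u u))"

lemma weight_trace_commute:
  "weight_trace d \<alpha> L (mat_mult (words d) F G) = weight_trace d \<alpha> L (mat_mult (words d) G F)"
  unfolding weight_trace_def mat_mult_def weight_functional_sum
  by (subst sum.swap) (simp add: mult.commute)

lemma weight_trace_adj: "weight_trace d \<alpha> L (mat_adj F) = cnj (weight_trace d \<alpha> L F)"
  by (simp add: weight_trace_def mat_adj_def weight_functional_cnj)

text \<open>The block of \<open>g\<close> outside \<open>V\<close> vanishes, so only mixed terms
  have to be absorbed. By AM-GM the pair (u, v) and its mirror image cost at most (b u + b v) / (4
  |W|) with b w = a w |f w|^2, and each index occurs in at most |W| pairs. Hence the constant 4 C
  |W| in the last hypothesis.\<close>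

lemma mixed_terms_bound:
  fixes f :: "'w \<Rightarrow> complex" and g :: "'w \<Rightarrow> 'w \<Rightarrow> complex" and a :: "'w \<Rightarrow> real"
  assumes W: "finite W" and V: "V \<subseteq> W" and C: "C \<ge> 0"
    and g: "\<And>u v. cmod (g u v) \<le> C"
    and g0: "\<And>u v. u \<in> W - V \<Longrightarrow> v \<in> W - V \<Longrightarrow> g u v = 0"
    and a0: "\<And>w. a w \<ge> 0"
    and a: "\<And>u v. u \<in> V \<Longrightarrow> v \<in> W - V \<Longrightarrow> (4 * C * card W)\<^sup>2 \<le> a u * a v"
  shows "Re (\<Sum>u\<in>W. \<Sum>v\<in>W. cnj (f u) * f v * g u v) \<ge>
    Re (\<Sum>u\<in>V. \<Sum>v\<in>V. cnj (f u) * f v * g u v) - (\<Sum>w\<in>W. a w * (cmod (f w))\<^sup>2) / 4"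
proof (cases "W = {}")
  case False
  let ?N = "real (card W)" and ?U = "W - V"
  let ?h = "\<lambda>u v. cnj (f u) * f v * g u v" and ?b = "\<lambda>w. a w * (cmod (f w))\<^sup>2"
  have N: "?N > 0" using False W by (simp add: card_gt_0_iff)
  have fin: "finite V" "finite ?U" using W V finite_subset by auto
  have Wu: "W = V \<union> ?U" using V by auto
  have split: "sum k W = sum k V + sum k ?U" for k :: "'w \<Rightarrow> complex"
    by (subst Wu, subst sum.union_disjoint) (use fin in auto)
  have splitr: "sum k W = sum k V + sum k ?U" for k :: "'w \<Rightarrow> real"
    by (subst Wu, subst sum.union_disjoint) (use fin in auto)
  have "(\<Sum>u\<in>W. \<Sum>v\<in>W. ?h u v) = (\<Sum>u\<in>V. \<Sum>v\<in>V. ?h u v) + (\<Sum>u\<in>V. \<Sum>v\<in>?U. ?h u v)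
      + ((\<Sum>u\<in>?U. \<Sum>v\<in>V. ?h u v) + (\<Sum>u\<in>?U. \<Sum>v\<in>?U. ?h u v))"
    by (simp only: split sum.distrib add.assoc add.commute add.left_commute)
  also have "(\<Sum>u\<in>?U. \<Sum>v\<in>?U. ?h u v) = 0" by (intro sum.neutral ballI) (simp add: g0)
  also have "(\<Sum>u\<in>?U. \<Sum>v\<in>V. ?h u v) = (\<Sum>u\<in>V. \<Sum>v\<in>?U. ?h v u)" by (rule sum.swap)
  finally have e: "Re (\<Sum>u\<in>W. \<Sum>v\<in>W. ?h u v) = Re (\<Sum>u\<in>V. \<Sum>v\<in>V. ?h u v) + (\<Sum>u\<in>V. \<Sum>v\<in>?U. Re (?h u v) + Re (?h v u))"
    by (simp add: sum.distrib)
  have lower: "- Re (?h u v) \<le> C * cmod (f u) * cmod (f v)" for u v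
  proof -
    have "- Re (?h u v) \<le> cmod (?h u v)" using complex_Re_le_cmod[of "- ?h u v"] by simp
    also have "\<dots> = cmod (g u v) * (cmod (f u) * cmod (f v))" by (simp add: norm_mult)
    also have "\<dots> \<le> C * (cmod (f u) * cmod (f v))" by (intro mult_right_mono g) simp
    finally show ?thesis by (simp add: mult.assoc)
  qed
  have "Re (?h u v) + Re (?h v u) \<ge> - ((?b u + ?b v) / (4 * ?N))" if "u \<in> V" "v \<in> ?U" for u v
  proof -
    have "2 * (4 * C * ?N) * cmod (f u) * cmod (f v) \<le> ?b u + ?b v"
      by (rule weighted_amgm) (use a[OF that] a0 C in auto)
    then have "2 * C * cmod (f u) * cmod (f v) \<le> (?b u + ?b v) / (4 * ?N)"
      using N by (simp add: field_simps)
    moreover have "C * cmod (f v) * cmod (f u) = C * cmod (f u) * cmod (f v)" by simp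
    ultimately show ?thesis using lower[of u v] lower[of v u] by linarith
  qed
  then have "(\<Sum>u\<in>V. \<Sum>v\<in>?U. Re (?h u v) + Re (?h v u)) \<ge> (\<Sum>u\<in>V. \<Sum>v\<in>?U. - ((?b u + ?b v) / (4 * ?N)))"
    by (intro sum_mono)
  moreover have "(\<Sum>u\<in>V. \<Sum>v\<in>?U. - ((?b u + ?b v) / (4 * ?N))) = - ((card ?U * sum ?b V + card V * sum ?b ?U) / (4 * ?N))"
    by (simp add: sum_negf sum_divide_distrib[symmetric] sum.distrib sum_distrib_left)
  moreover have "- ((?N * sum ?b W) / (4 * ?N)) \<le> - ((card ?U * sum ?b V + card V * sum ?b ?U) / (4 * ?N))"
  proof -
    have "card ?U * sum ?b V \<le> ?N * sum ?b V" "card V * sum ?b ?U \<le> ?N * sum ?b ?U"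
      using W V by (auto intro!: mult_right_mono sum_nonneg card_mono simp: a0)
    then have "card ?U * sum ?b V + card V * sum ?b ?U \<le> ?N * sum ?b W"
      by (simp add: splitr distrib_left)
    then have "(card ?U * sum ?b V + card V * sum ?b ?U) / (4 * ?N) \<le> (?N * sum ?b W) / (4 * ?N)"
      by (intro divide_right_mono) auto
    then show ?thesis by simp
  qed
  moreover have "- ((?N * sum ?b W) / (4 * ?N)) = - (sum ?b W / 4)" using N by simp
  ultimately show ?thesis unfolding e by linarith
qed (use V in auto)

text \<open>The moments of a tracial state on the free algebra in selfadjoint letters. Positivity
  speaks of real parts only; \<open>t_rev\<close> makes the sums real.\<close>

locale word_trace =
  fixes t :: "nat list \<Rightarrow> complex"
  assumes t_Nil: "t [] = 1"
    and t_rev: "t (rev w) = cnj (t w)"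
    and t_commute: "t (u @ v) = t (v @ u)"
    and t_positive: "finite V \<Longrightarrow> Re (\<Sum>u\<in>V. \<Sum>v\<in>V. cnj (f u) * f v * t (rev u @ v)) \<ge> 0"
begin

text \<open>Membership in \<open>words d\<close> depends only on the letters and the total length,
  which rotating a word preserves, so the cut-off does not spoil traciality.\<close>

lemma truncated_trace_commute:
  "truncated_trace d t (mat_mult (words d) (ncmat d P) (ncmat d Q)) =
    truncated_trace d t (mat_mult (words d) (ncmat d Q) (ncmat d P))"
proof -
  have e: "(if u @ v \<in> words d then t (u @ v) else 0) = (if v @ u \<in> words d then t (v @ u) else 0)" for u v
    by (simp add: append_commute_words t_commute)
  show ?thesis
    unfolding ncmat_mult[symmetric] truncated_trace_ncmat nclin_mult
    by (subst e, rule nclin_swap)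
qed

lemma truncated_trace_adj:
  "truncated_trace d t (mat_adj (ncmat d P)) = cnj (truncated_trace d t (ncmat d P))"
proof -
  have "(\<lambda>w. cnj (if rev w \<in> words d then t (rev w) else 0)) = (\<lambda>w. if w \<in> words d then t w else 0)"
    by (auto simp: t_rev)
  then show ?thesis
    unfolding ncmat_adj[symmetric] truncated_trace_ncmat nclin_adj by simp
qed

text \<open>The square becomes a Gram form in the word coefficients: \<open>g\<close> vanishes when
  either argument leaves \<open>words d\<close>, so \<open>nclin_word_coeff\<close> applies in both
  variables.\<close>

lemma truncated_trace_square:
  fixes d :: nat and P :: ncpoly
  defines "g \<equiv> \<lambda>u v. if rev u @ v \<in> words d then t (rev u @ v) else 0"
  shows "truncated_trace d t (mat_mult (words d) (mat_adj (ncmat d P)) (ncmat d P)) =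
    (\<Sum>u\<in>words d. \<Sum>v\<in>words d. cnj (word_coeff (ncmat d P) u) * word_coeff (ncmat d P) v * g u v)"
proof -
  let ?f = "word_coeff (ncmat d P)"
  have 1: "nclin (\<lambda>v. g u v) P = (\<Sum>v\<in>words d. ?f v * g u v)" for u
    by (rule nclin_word_coeff) (auto simp: g_def words_def)
  have "truncated_trace d t (mat_mult (words d) (mat_adj (ncmat d P)) (ncmat d P))
    = nclin (\<lambda>u. nclin (\<lambda>v. g (rev u) v) P) (ncadj P)"
    unfolding ncmat_adj[symmetric] ncmat_mult[symmetric] truncated_trace_ncmat nclin_mult g_def by (simp cong: if_cong)
  also have "\<dots> = cnj (nclin (\<lambda>u. cnj (nclin (\<lambda>v. g u v) P)) P)"
    by (simp add: nclin_adj)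
  also have "nclin (\<lambda>u. cnj (nclin (\<lambda>v. g u v) P)) P = (\<Sum>u\<in>words d. ?f u * cnj (nclin (\<lambda>v. g u v) P))"
  proof (rule nclin_word_coeff)
    fix u assume "u \<notin> words d"
    then have "g u v = 0" for v by (auto simp: g_def words_def)
    then have "g u = (\<lambda>v. 0)" by blast
    then show "cnj (nclin (g u) P) = 0" by (simp add: nclin_zero_fun)
  qed
  finally show ?thesis by (simp add: 1 sum_distrib_left mult.assoc)
qed

text \<open>The positive part of the truncated trace lives on words of length at most \<open>d\<close>; a large \<open>L\<close>
  makes the weights of longer words absorb the remaining mixed terms.\<close>

lemma trace_square_lower_bound:
  fixes d :: nat and P :: ncpoly
  assumes \<alpha>: "\<alpha> > 0" and L: "L \<ge> 1" and C: "C \<ge> 0" "\<And>w. w \<in> words d \<Longrightarrow> cmod (t w) \<le> C"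
    and big: "(4 * C * card (words d))\<^sup>2 \<le> \<alpha>\<^sup>2 * L"
  defines "F \<equiv> ncmat d P"
  shows "Re (truncated_trace d t (mat_mult (words d) (mat_adj F) F)) + Re (weight_trace d \<alpha> L (mat_mult (words d) (mat_adj F) F))
    \<ge> (\<Sum>u\<in>words d. \<Sum>z\<in>words d. \<Sum>i\<le>degree (F z u). weight d \<alpha> L (2 * i) * (cmod (coeff (F z u) i))\<^sup>2) / 4"
    (is "_ \<ge> ?D / 4")
proof -
  let ?W = "words d" and ?f = "word_coeff F"
  define V where "V = {w \<in> ?W. length w \<le> d}"
  define g where "g = (\<lambda>u v. if rev u @ v \<in> ?W then t (rev u @ v) else 0)"
  define a where "a = (\<lambda>w::nat list. weight d \<alpha> L (2 * length w))"
  have wp: "weight d \<alpha> L k \<ge> 0" for k using weight_pos[OF \<alpha> L, of d k] by simp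
  \<comment> \<open>Everything that the truncated trace reads off is found in the vacuum column at
    degree \<open>length w\<close>, so \<open>?D\<close> controls it.\<close>
  have inner: "weight d \<alpha> L (2 * length w) * (cmod (?f w))\<^sup>2 \<le>
      (\<Sum>i\<le>degree (F w []). weight d \<alpha> L (2 * i) * (cmod (coeff (F w []) i))\<^sup>2)" for w
  proof (cases "length w \<le> degree (F w [])")
    case True
    then show ?thesis unfolding word_coeff_def
      by (intro member_le_sum[of "length w" _ "\<lambda>i. weight d \<alpha> L (2 * i) * (cmod (coeff (F w []) i))\<^sup>2"])
        (auto simp: wp)
  next
    case False
    then have "?f w = 0" by (simp add: word_coeff_def coeff_eq_0)
    then show ?thesis by (simp add: sum_nonneg wp)
  qed
  have aD: "(\<Sum>w\<in>?W. a w * (cmod (?f w))\<^sup>2) \<le> ?D"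
  proof -
    have "(\<Sum>w\<in>?W. a w * (cmod (?f w))\<^sup>2) \<le>
       (\<Sum>z\<in>?W. \<Sum>i\<le>degree (F z []). weight d \<alpha> L (2 * i) * (cmod (coeff (F z []) i))\<^sup>2)"
      unfolding a_def by (intro sum_mono inner)
    also have "\<dots> \<le> ?D"
      by (rule member_le_sum[of "[]" _ "\<lambda>u. \<Sum>z\<in>?W. \<Sum>i\<le>degree (F z u). weight d \<alpha> L (2 * i) * (cmod (coeff (F z u) i))\<^sup>2"])
        (auto intro!: sum_nonneg simp: wp)
    finally show ?thesis .
  qed
  have gV: "g u v = t (rev u @ v)" if "u \<in> V" "v \<in> V" for u v
    using that by (auto simp: g_def V_def words_def)
  have "Re (truncated_trace d t (mat_mult ?W (mat_adj F) F)) = Re (\<Sum>u\<in>?W. \<Sum>v\<in>?W. cnj (?f u) * ?f v * g u v)"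
    unfolding F_def truncated_trace_square g_def ..
  also have "\<dots> \<ge> Re (\<Sum>u\<in>V. \<Sum>v\<in>V. cnj (?f u) * ?f v * g u v) - (\<Sum>w\<in>?W. a w * (cmod (?f w))\<^sup>2) / 4"
  proof (rule mixed_terms_bound[where C = C])
    show "V \<subseteq> ?W" by (auto simp: V_def)
    show "cmod (g u v) \<le> C" for u v using C by (auto simp: g_def)
    \<comment> \<open>Two words longer than \<open>d\<close> concatenate to more than 2d
      letters.\<close>
    show "g u v = 0" if "u \<in> ?W - V" "v \<in> ?W - V" for u v
      using that by (auto simp: g_def V_def words_def)
    show "a w \<ge> 0" for w by (simp add: a_def wp)
    show "(4 * C * card ?W)\<^sup>2 \<le> a u * a v" if u: "u \<in> V" and v: "v \<in> ?W - V" for u v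
    proof -
      have "2 * length u - 2 * d = 0" using u by (simp add: V_def)
      then have au: "\<alpha> \<le> a u" using \<alpha> by (simp add: a_def weight_def)
      \<comment> \<open>Since \<open>v\<close> is longer than \<open>d\<close>, its weight contains
        at least one factor \<open>L\<close>, while that of \<open>u\<close> contains none.\<close>
      have "L ^ 1 \<le> L ^ (2 * length v - 2 * d)" using v L by (intro power_increasing) (auto simp: V_def)
      then have av: "\<alpha> * L \<le> a v" unfolding a_def weight_def
        using \<alpha> L by (intro mult_mono) (auto intro: order_trans[OF _ mult_left_mono[of 1]])
      have "\<alpha> * (\<alpha> * L) \<le> a u * a v" using au av \<alpha> L by (intro mult_mono) auto
      then show ?thesis using big by (simp add: power2_eq_square mult.assoc)
    qed
  qed (use C in auto)
  also have "(\<Sum>u\<in>V. \<Sum>v\<in>V. cnj (?f u) * ?f v * g u v) = (\<Sum>u\<in>V. \<Sum>v\<in>V. cnj (?f u) * ?f v * t (rev u @ v))"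
    by (intro sum.cong refl) (simp add: gV)
  finally have T: "Re (truncated_trace d t (mat_mult ?W (mat_adj F) F)) \<ge> - ?D / 4"
    using t_positive[of V ?f] aD finite_subset[of V ?W] by (simp add: V_def)
  have "Re (weight_trace d \<alpha> L (mat_mult ?W (mat_adj F) F)) =
      (\<Sum>u\<in>?W. \<Sum>z\<in>?W. Re (weight_functional d \<alpha> L (map_poly cnj (F z u) * F z u)))"
    by (simp add: weight_trace_def mat_mult_def mat_adj_def weight_functional_sum)
  also have "\<dots> \<ge> (\<Sum>u\<in>?W. \<Sum>z\<in>?W. (\<Sum>i\<le>degree (F z u). weight d \<alpha> L (2 * i) * (cmod (coeff (F z u) i))\<^sup>2) / 2)"
    by (intro sum_mono weight_functional_square \<alpha> L)
  finally have "Re (weight_trace d \<alpha> L (mat_mult ?W (mat_adj F) F)) \<ge> ?D / 2"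
    by (simp add: sum_divide_distrib)
  \<comment> \<open>The weights contribute half of \<open>?D\<close>, and the mixed terms cost a
    quarter.\<close>
  with T show ?thesis by linarith
qed

text \<open>The divisor is the value of the numerator at the unit: 1 from the truncated trace and
  \<alpha> from each basis word.\<close>

definition fock_trace :: "nat \<Rightarrow> real \<Rightarrow> real \<Rightarrow> (nat list \<Rightarrow> nat list \<Rightarrow> complex poly) \<Rightarrow> complex"
  where "fock_trace d \<alpha> L F =
    (truncated_trace d t F + weight_trace d \<alpha> L F) / of_real (1 + \<alpha> * card (words d))"

lemma fock_trace_commute:
  "fock_trace d \<alpha> L (mat_mult (words d) (ncmat d P) (ncmat d Q)) =
    fock_trace d \<alpha> L (mat_mult (words d) (ncmat d Q) (ncmat d P))"
  by (simp add: fock_trace_def truncated_trace_commute weight_trace_commute)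

lemma fock_trace_one:
  assumes "\<alpha> > 0"
  shows "fock_trace d \<alpha> L (mat_one (words d)) = 1"
proof -
  have "truncated_trace d t (mat_one (words d)) = 1"
    unfolding ncmat_one[symmetric] truncated_trace_ncmat by (simp add: t_Nil)
  moreover have "weight_functional d \<alpha> L 1 = of_real \<alpha>"
    using weight_functional_monom[of d \<alpha> L 1 0] by (simp add: weight_def)
  then have "weight_trace d \<alpha> L (mat_one (words d)) = of_real (\<alpha> * card (words d))"
    by (simp add: weight_trace_def mat_one_def)
  moreover have "1 + \<alpha> * card (words d) \<noteq> 0" using assms by (smt (verit) mult_nonneg_nonneg of_nat_0_le_iff)
  ultimately show ?thesis unfolding fock_trace_def
    by (metis of_real_1 of_real_add of_real_eq_0_iff divide_self)
qed

lemma fock_trace_add: "fock_trace d \<alpha> L (\<lambda>u v. F u v + G u v) = fock_trace d \<alpha> L F + fock_trace d \<alpha> L G"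
  by (simp add: fock_trace_def truncated_trace_def weight_trace_def word_coeff_def
      weight_functional_add sum.distrib distrib_right add_divide_distrib)

lemma fock_trace_scale: "fock_trace d \<alpha> L (\<lambda>u v. smult c (F u v)) = c * fock_trace d \<alpha> L F"
proof -
  have "truncated_trace d t (\<lambda>u v. smult c (F u v)) = c * truncated_trace d t F"
    by (simp add: truncated_trace_def word_coeff_def sum_distrib_left mult.assoc)
  moreover have "weight_trace d \<alpha> L (\<lambda>u v. smult c (F u v)) = c * weight_trace d \<alpha> L F"
    by (simp add: weight_trace_def weight_functional_smult sum_distrib_left)
  ultimately show ?thesis by (simp add: fock_trace_def distrib_left)
qed

lemma fock_trace_square_real:
  "Im (fock_trace d \<alpha> L (mat_mult (words d) (mat_adj (ncmat d P)) (ncmat d P))) = 0"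
proof -
  let ?G = "mat_mult (words d) (mat_adj (ncmat d P)) (ncmat d P)"
  have G: "?G = ncmat d (ncmult (ncadj P) P)" by (simp add: ncmat_mult ncmat_adj)
  have self: "mat_adj ?G = ?G" by (simp add: mat_adj_mult mat_adj_adj)
  have "cnj (truncated_trace d t ?G) = truncated_trace d t ?G"
    using truncated_trace_adj[of d "ncmult (ncadj P) P"] self G by simp
  moreover have "cnj (weight_trace d \<alpha> L ?G) = weight_trace d \<alpha> L ?G"
    using weight_trace_adj[of d \<alpha> L ?G] self by simp
  ultimately have "cnj (fock_trace d \<alpha> L ?G) = fock_trace d \<alpha> L ?G"
    by (simp add: fock_trace_def)
  then show ?thesis by (metis Im_complex_of_real Reals_cases Reals_cnj_iff)
qed

text \<open>Faithfulness: the lower bound contains every coefficient of every entry with positive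
  weight, so a vanishing trace of the square kills all leading coefficients.\<close>

lemma fock_trace_square:
  fixes d :: nat and P :: ncpoly
  assumes \<alpha>: "\<alpha> > 0" and L: "L \<ge> 1" and C: "C \<ge> 0" "\<And>w. w \<in> words d \<Longrightarrow> cmod (t w) \<le> C"
    and big: "(4 * C * card (words d))\<^sup>2 \<le> \<alpha>\<^sup>2 * L"
  defines "F \<equiv> ncmat d P"
  shows "Re (fock_trace d \<alpha> L (mat_mult (words d) (mat_adj F) F)) \<ge> 0"
    and "fock_trace d \<alpha> L (mat_mult (words d) (mat_adj F) F) = 0 \<Longrightarrow> F = (\<lambda>u v. 0)"
proof -
  let ?G = "mat_mult (words d) (mat_adj F) F"
  let ?D = "\<Sum>u\<in>words d. \<Sum>z\<in>words d. \<Sum>i\<le>degree (F z u). weight d \<alpha> L (2 * i) * (cmod (coeff (F z u) i))\<^sup>2"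
  have wp: "weight d \<alpha> L k > 0" for k by (rule weight_pos[OF \<alpha> L])
  have pos: "1 + \<alpha> * card (words d) > 0" using \<alpha> by (smt (verit) mult_nonneg_nonneg of_nat_0_le_iff)
  have D0: "?D \<ge> 0" by (intro sum_nonneg mult_nonneg_nonneg order.strict_implies_order[OF wp] zero_le_power2)
  have lb: "Re (truncated_trace d t ?G) + Re (weight_trace d \<alpha> L ?G) \<ge> ?D / 4"
    unfolding F_def by (rule trace_square_lower_bound[OF \<alpha> L C big])
  have re: "Re (fock_trace d \<alpha> L ?G) = (Re (truncated_trace d t ?G) + Re (weight_trace d \<alpha> L ?G)) / (1 + \<alpha> * card (words d))"
    unfolding fock_trace_def Re_divide_of_real by simp
  show "Re (fock_trace d \<alpha> L ?G) \<ge> 0" unfolding re using lb D0 pos by simp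
  assume "fock_trace d \<alpha> L ?G = 0"
  then have "Re (truncated_trace d t ?G) + Re (weight_trace d \<alpha> L ?G) = 0"
    using re pos by simp
  then have D: "?D = 0" using lb D0 by linarith
  have "F z u = 0" for z u
  proof (cases "z \<in> words d \<and> u \<in> words d")
    case True
    have "(\<Sum>z\<in>words d. \<Sum>i\<le>degree (F z u). weight d \<alpha> L (2 * i) * (cmod (coeff (F z u) i))\<^sup>2) = 0"
      using D True wp by (subst (asm) sum_nonneg_eq_0_iff) (auto intro!: sum_nonneg simp: less_imp_le)
    then have "(\<Sum>i\<le>degree (F z u). weight d \<alpha> L (2 * i) * (cmod (coeff (F z u) i))\<^sup>2) = 0"
      using True wp by (subst (asm) sum_nonneg_eq_0_iff) (auto intro!: sum_nonneg simp: less_imp_le)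
    then have "weight d \<alpha> L (2 * degree (F z u)) * (cmod (coeff (F z u) (degree (F z u))))\<^sup>2 = 0"
      using wp by (subst (asm) sum_nonneg_eq_0_iff) (auto simp: less_imp_le)
    then show ?thesis using wp[of "2 * degree (F z u)"] by simp
  next
    case False
    then show ?thesis by (auto simp: F_def ncmat_outside)
  qed
  then show "F = (\<lambda>u v. 0)" by blast
qed

text \<open>The error is proportional to \<alpha> and independent of \<open>L\<close>, because
  weights at degrees up to 2d do not involve \<open>L\<close>. This allows \<alpha> to be fixed
  before \<open>L\<close>.\<close>

lemma fock_trace_word:
  assumes \<alpha>: "\<alpha> > 0" and w: "w \<in> words d"
  shows "cmod (fock_trace d \<alpha> L (ncmat d [(1, w)]) - t w) \<le>
    \<alpha> * (16 ^ (length w * length w) * (\<Sum>u\<in>words d. cmod (fock d w u u)) + cmod (t w) * card (words d))"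
proof -
  let ?N = "\<alpha> * card (words d)" and ?S = "weight_trace d \<alpha> L (ncmat d [(1, w)])"
  have N: "?N \<ge> 0" using \<alpha> by simp
  have wt: "weight d \<alpha> L (length w) = \<alpha> * 16 ^ (length w * length w)"
    using w by (simp add: weight_def words_def)
  have "?S = (\<Sum>u\<in>words d. of_real (weight d \<alpha> L (length w)) * fock d w u u)"
    by (simp add: weight_trace_def ncmat_Cons weight_functional_monom)
  also have "cmod \<dots> \<le> (\<Sum>u\<in>words d. cmod (of_real (weight d \<alpha> L (length w)) * fock d w u u))"
    by (rule norm_sum)
  also have "\<dots> = \<alpha> * 16 ^ (length w * length w) * (\<Sum>u\<in>words d. cmod (fock d w u u))"
    using \<alpha> by (simp add: wt norm_mult sum_distrib_left norm_power)
  finally have S: "cmod ?S \<le> \<alpha> * 16 ^ (length w * length w) * (\<Sum>u\<in>words d. cmod (fock d w u u))" .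
  have "fock_trace d \<alpha> L (ncmat d [(1, w)]) = (t w + ?S) / of_real (1 + ?N)"
    unfolding fock_trace_def truncated_trace_ncmat using w by simp
  then have "fock_trace d \<alpha> L (ncmat d [(1, w)]) - t w = (?S - of_real ?N * t w) / of_real (1 + ?N)"
    using N by (simp add: field_simps add_nonneg_eq_0_iff complex_eq_iff)
  then have "cmod (fock_trace d \<alpha> L (ncmat d [(1, w)]) - t w) = cmod (?S - of_real ?N * t w) / (1 + ?N)"
    using N by (simp only: norm_divide norm_of_real)
  also have "\<dots> \<le> cmod (?S - of_real ?N * t w)" using N divide_left_mono[of 1 "1 + ?N" "cmod (?S - of_real ?N * t w)"] by simp
  also have "\<dots> \<le> cmod ?S + ?N * cmod (t w)"
    using norm_triangle_ineq4[of ?S "of_real ?N * t w"] N by (simp only: norm_mult norm_of_real abs_of_nonneg)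
  finally show ?thesis using S by (simp add: algebra_simps)
qed

end

section \<open>The truncated Fock algebra\<close>

text \<open>The theorem prescribes the carrier type \<open>nat \<Rightarrow> complex\<close> for all
  approximating algebras, so a matrix of polynomials is stored as the sequence of all its
  coefficients.\<close>

definition encode_mat :: "(nat list \<Rightarrow> nat list \<Rightarrow> complex poly) \<Rightarrow> nat \<Rightarrow> complex"
  where "encode_mat F = (\<lambda>m. case prod_decode m of (k, n) \<Rightarrow>
    case prod_decode n of (a, b) \<Rightarrow> coeff (F (from_nat a) (from_nat b)) k)"

lemma inj_encode_mat: "inj encode_mat"
proof (rule injI, intro ext poly_eqI)
  fix F G :: "nat list \<Rightarrow> nat list \<Rightarrow> complex poly" and u v k
  have e: "encode_mat F (prod_encode (k, prod_encode (to_nat u, to_nat v))) = coeff (F u v) k" for F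
    by (simp add: encode_mat_def)
  assume "encode_mat F = encode_mat G"
  then show "coeff (F u v) k = coeff (G u v) k" by (metis e)
qed

definition decode_mat :: "(nat \<Rightarrow> complex) \<Rightarrow> nat list \<Rightarrow> nat list \<Rightarrow> complex poly"
  where "decode_mat = inv_into UNIV encode_mat"

lemma decode_encode_mat [simp]: "decode_mat (encode_mat F) = F"
  by (simp add: decode_mat_def inj_encode_mat)

definition fock_algebra ::
    "nat \<Rightarrow> ((nat list \<Rightarrow> nat list \<Rightarrow> complex poly) \<Rightarrow> complex) \<Rightarrow> (nat \<Rightarrow> complex) tracial_algebra"
  where "fock_algebra d \<phi> =
    \<lparr>carrier = range (\<lambda>P. encode_mat (ncmat d P)),
     mult = (\<lambda>x y. encode_mat (mat_mult (words d) (decode_mat x) (decode_mat y))),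
     one = encode_mat (mat_one (words d)),
     zero = encode_mat (\<lambda>u v. 0),
     add = (\<lambda>x y. encode_mat (\<lambda>u v. decode_mat x u v + decode_mat y u v)),
     module.smult = (\<lambda>c x. encode_mat (\<lambda>u v. smult c (decode_mat x u v))),
     invol = (\<lambda>x. encode_mat (mat_adj (decode_mat x))),
     tau = (\<lambda>x. \<phi> (decode_mat x))\<rparr>"

definition fock_elem :: "nat \<Rightarrow> ncpoly \<Rightarrow> nat \<Rightarrow> complex"
  where "fock_elem d P = encode_mat (ncmat d P)"

lemma fock_elem_eq_iff: "fock_elem d P = fock_elem d Q \<longleftrightarrow> ncmat d P = ncmat d Q"
  by (auto simp: fock_elem_def inj_encode_mat[THEN inj_eq])

lemma ncmat_Nil_fun: "ncmat d [] = (\<lambda>u v. 0)"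
  by (intro ext) (rule ncmat_Nil)

lemma ncmat_append_fun: "ncmat d (P @ Q) = (\<lambda>u v. ncmat d P u v + ncmat d Q u v)"
  by (intro ext) (rule ncmat_append)

lemma ncmat_scale_fun: "ncmat d (ncscale c P) = (\<lambda>u v. smult c (ncmat d P u v))"
  by (intro ext) (rule ncmat_scale)

lemma fock_algebra_simps:
  "carrier (fock_algebra d \<phi>) = range (fock_elem d)"
  "mult (fock_algebra d \<phi>) (fock_elem d P) (fock_elem d Q) = fock_elem d (ncmult P Q)"
  "one (fock_algebra d \<phi>) = fock_elem d [(1, [])]"
  "zero (fock_algebra d \<phi>) = fock_elem d []"
  "add (fock_algebra d \<phi>) (fock_elem d P) (fock_elem d Q) = fock_elem d (P @ Q)"
  "c \<odot>\<^bsub>fock_algebra d \<phi>\<^esub> fock_elem d P = fock_elem d (ncscale c P)"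
  "invol (fock_algebra d \<phi>) (fock_elem d P) = fock_elem d (ncadj P)"
  "tau (fock_algebra d \<phi>) (fock_elem d P) = \<phi> (ncmat d P)"
  by (simp_all add: fock_algebra_def fock_elem_def ncmat_mult ncmat_one ncmat_adj
      ncmat_scale_fun ncmat_append_fun ncmat_Nil_fun image_def)

lemma mat_mult_one:
  "mat_mult (words d) (mat_one (words d)) (ncmat d P) = ncmat d P"
  "mat_mult (words d) (ncmat d P) (mat_one (words d)) = ncmat d P"
proof -
  have "mat_mult (words d) (mat_one (words d)) (ncmat d P) u v = ncmat d P u v" for u v
  proof (cases "u \<in> words d")
    case True
    have "(\<Sum>z\<in>words d. mat_one (words d) u z * ncmat d P z v) = (\<Sum>z\<in>words d. if u = z then ncmat d P z v else 0)"
      by (intro sum.cong) (auto simp: mat_one_def)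
    then show ?thesis using True by (simp add: mat_mult_def)
  qed (simp add: mat_mult_def mat_one_def ncmat_outside)
  then show "mat_mult (words d) (mat_one (words d)) (ncmat d P) = ncmat d P" by blast
  have "mat_mult (words d) (ncmat d P) (mat_one (words d)) u v = ncmat d P u v" for u v
  proof (cases "v \<in> words d")
    case True
    have "(\<Sum>z\<in>words d. ncmat d P u z * mat_one (words d) z v) = (\<Sum>z\<in>words d. if z = v then ncmat d P u z else 0)"
      by (intro sum.cong) (auto simp: mat_one_def)
    then show ?thesis using True by (simp add: mat_mult_def)
  next
    case False
    then show ?thesis by (auto simp: mat_mult_def mat_one_def ncmat_outside intro!: sum.neutral)
  qed
  then show "mat_mult (words d) (ncmat d P) (mat_one (words d)) = ncmat d P" by blast
qed

lemma mat_mult_add: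
  "mat_mult W (\<lambda>u v. F u v + G u v) H = (\<lambda>u v. mat_mult W F H u v + mat_mult W G H u v)"
  "mat_mult W H (\<lambda>u v. F u v + G u v) = (\<lambda>u v. mat_mult W H F u v + mat_mult W H G u v)"
  by (simp_all add: mat_mult_def sum.distrib distrib_left distrib_right fun_eq_iff)

lemma smult_sum_poly: "smult c (\<Sum>i\<in>I. f i) = (\<Sum>i\<in>I. smult c (f i))"
  by (induction I rule: infinite_finite_induct) (simp_all add: smult_add_right)

lemma mat_mult_smult:
  "mat_mult W (\<lambda>u v. smult c (F u v)) H = (\<lambda>u v. smult c (mat_mult W F H u v))"
  "mat_mult W H (\<lambda>u v. smult c (F u v)) = (\<lambda>u v. smult c (mat_mult W H F u v))"
  by (simp_all add: mat_mult_def fun_eq_iff smult_sum_poly)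

lemma cring_complex_ring: "cring complex_ring"
proof (rule cringI)
  show "abelian_group complex_ring"
    by (rule abelian_groupI) (auto simp: algebra_simps intro: exI[of _ "- _"] left_minus)
  show "comm_monoid complex_ring"
    by (rule comm_monoidI) (auto simp: algebra_simps)
qed (auto simp: algebra_simps)

lemma ring_fock_algebra: "ring (fock_algebra d \<phi>)"
proof (rule ringI)
  have inv: "add (fock_algebra d \<phi>) (fock_elem d (ncscale (-1) P)) (fock_elem d P) = zero (fock_algebra d \<phi>)" for P
    by (simp add: fock_algebra_simps fock_elem_eq_iff ncmat_append_fun ncmat_scale_fun ncmat_Nil_fun)
  show "abelian_group (fock_algebra d \<phi>)"
  proof (rule abelian_groupI)
    show "\<exists>y\<in>carrier (fock_algebra d \<phi>). add (fock_algebra d \<phi>) y x = zero (fock_algebra d \<phi>)"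
      if "x \<in> carrier (fock_algebra d \<phi>)" for x
      using that inv by (auto simp: fock_algebra_simps(1))
  qed (auto simp: fock_algebra_simps fock_elem_eq_iff ncmat_append_fun ncmat_Nil_fun add.commute add.left_commute intro: rangeI)
  show "monoid (fock_algebra d \<phi>)"
    by (rule monoidI) (auto simp: fock_algebra_simps fock_elem_eq_iff ncmat_mult mat_mult_assoc ncmat_one mat_mult_one intro: rangeI)
qed (auto simp: fock_algebra_simps fock_elem_eq_iff ncmat_mult ncmat_append_fun mat_mult_add)

lemma module_fock_algebra: "Module.module complex_ring (fock_algebra d \<phi>)"
proof (rule moduleI)
  show "abelian_group (fock_algebra d \<phi>)"
    using ring_fock_algebra by (rule ring.axioms)
qed (auto simp: cring_complex_ring fock_algebra_simps fock_elem_eq_iff ncmat_scale_fun ncmat_append_fun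
    smult_add_left smult_add_right intro: rangeI)

lemma (in word_trace) trace_reduced_fock_algebra:
  assumes \<alpha>: "\<alpha> > 0" and L: "L \<ge> 1" and C: "C \<ge> 0" "\<And>w. w \<in> words d \<Longrightarrow> cmod (t w) \<le> C"
    and big: "(4 * C * card (words d))\<^sup>2 \<le> \<alpha>\<^sup>2 * L"
  shows "trace_reduced_algebra (fock_algebra d (fock_trace d \<alpha> L))"
proof -
  let ?A = "fock_algebra d (fock_trace d \<alpha> L)"
  note sq = fock_trace_square[OF \<alpha> L C big]
  interpret ring ?A by (rule ring_fock_algebra)
  interpret Module.module complex_ring ?A by (rule module_fock_algebra)
  show ?thesis
  proof unfold_locales
    show "tau ?A (invol ?A x \<otimes>\<^bsub>?A\<^esub> x) \<in> \<real>\<^sub>\<ge>\<^sub>0" if "x \<in> carrier ?A" for x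
      using that fock_trace_square_real sq(1)
      by (auto simp: fock_algebra_simps ncmat_mult ncmat_adj complex_nonneg_Reals_iff)
    show "x = \<zero>\<^bsub>?A\<^esub>" if "x \<in> carrier ?A" "tau ?A (invol ?A x \<otimes>\<^bsub>?A\<^esub> x) = 0" for x
      using that sq(2) by (auto simp: fock_algebra_simps ncmat_mult ncmat_adj fock_elem_eq_iff ncmat_Nil_fun)
    show "tau ?A \<one>\<^bsub>?A\<^esub> = 1" by (simp add: fock_algebra_simps ncmat_one fock_trace_one[OF \<alpha>])
    show "tau ?A (x \<otimes>\<^bsub>?A\<^esub> y) = tau ?A (y \<otimes>\<^bsub>?A\<^esub> x)" if "x \<in> carrier ?A" "y \<in> carrier ?A" for x y
      using that fock_trace_commute by (auto simp: fock_algebra_simps ncmat_mult)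
  qed (auto simp: fock_algebra_simps fock_elem_eq_iff ncmat_mult ncmat_scale_fun ncmat_append_fun ncmat_adj
      mat_mult_smult mat_adj_adj mat_adj_mult fock_trace_add fock_trace_scale,
      auto simp: mat_adj_def map_poly_cnj_add map_poly_cnj_smult)
qed

lemma finsum_fock_elem:
  assumes "finite S"
  shows "finsum (fock_algebra d \<phi>) (\<lambda>s. fock_elem d (f s)) S = encode_mat (\<lambda>u v. \<Sum>s\<in>S. ncmat d (f s) u v)"
  using assms
proof (induction S rule: finite_induct)
  case empty
  interpret ring "fock_algebra d \<phi>" by (rule ring_fock_algebra)
  show ?case by (subst finsum_empty) (simp add: fock_algebra_def)
next
  case (insert s S)
  interpret ring "fock_algebra d \<phi>" by (rule ring_fock_algebra)
  have "finsum (fock_algebra d \<phi>) (\<lambda>s. fock_elem d (f s)) (insert s S) =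
    add (fock_algebra d \<phi>) (fock_elem d (f s)) (finsum (fock_algebra d \<phi>) (\<lambda>s. fock_elem d (f s)) S)"
    using insert by (intro finsum_insert) (auto simp: fock_algebra_simps)
  then show ?case
    using insert by (simp add: fock_algebra_def fock_elem_def)
qed

text \<open>Elements are matrices indexed by \<open>words d\<close>, and the degree 2k exceeds the
  number of matrix positions, so the identity holds in each row of \<open>words d\<close>; all other
  rows are zero.\<close>

lemma type_I_le_fock_algebra:
  assumes "(card (words d))\<^sup>2 < 2 * k"
  shows "type_I_le k (fock_algebra d \<phi>)"
  unfolding type_I_le_def
proof (rule ballI)
  let ?A = "fock_algebra d \<phi>" and ?S = "{\<sigma>. \<sigma> permutes {1..2 * k}}"
  fix a assume a: "a \<in> {1..2 * k} \<rightarrow> carrier ?A"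
  then have "\<forall>i\<in>{1..2 * k}. \<exists>P. a i = fock_elem d P" by (auto simp: fock_algebra_simps(1))
  then obtain p where p: "\<And>i. i \<in> {1..2 * k} \<Longrightarrow> a i = fock_elem d (p i)" by metis
  define q where "q = (\<lambda>\<sigma>. foldr ncmult (map (\<lambda>i. p (\<sigma> i)) [1..<Suc (2 * k)]) [(1, [])])"
  have fold: "foldr (mult ?A) (map (\<lambda>i. fock_elem d (P i)) is) \<one>\<^bsub>?A\<^esub> = fock_elem d (foldr ncmult (map P is) [(1, [])])" for P "is"
    by (induction "is") (simp_all add: fock_algebra_simps)
  have matq: "ncmat d (foldr ncmult (map P is) [(1, [])]) = foldr (mat_mult (words d)) (map (\<lambda>i. ncmat d (P i)) is) (mat_one (words d))" for P :: "nat \<Rightarrow> ncpoly" and "is"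
    by (induction "is") (simp_all add: ncmat_one ncmat_mult)
  have prod: "foldr (mult ?A) (map (\<lambda>i. a (\<sigma> i)) [1..<Suc (2 * k)]) \<one>\<^bsub>?A\<^esub> = fock_elem d (q \<sigma>)" if "\<sigma> \<in> ?S" for \<sigma>
  proof -
    have "\<sigma> i \<in> {1..2 * k}" if "i \<in> {1..2 * k}" for i
      using \<open>\<sigma> \<in> ?S\<close> that by (metis mem_Collect_eq permutes_in_image)
    then have "map (\<lambda>i. a (\<sigma> i)) [1..<Suc (2 * k)] = map (\<lambda>i. fock_elem d (p (\<sigma> i))) [1..<Suc (2 * k)]"
      by (intro map_cong refl p) (auto simp del: upt_Suc)
    then show ?thesis by (simp only: fold q_def)
  qed
  interpret ring ?A by (rule ring_fock_algebra)
  have "standard_identity ?A k a = finsum ?A (\<lambda>\<sigma>. fock_elem d (ncscale (of_int (sign \<sigma>)) (q \<sigma>))) ?S"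
    unfolding standard_identity_def
  proof (rule finsum_cong'[OF refl])
    show "of_int (sign \<sigma>) \<odot>\<^bsub>?A\<^esub> foldr (mult ?A) (map (\<lambda>i. a (\<sigma> i)) [1..<Suc (2 * k)]) \<one>\<^bsub>?A\<^esub>
      = fock_elem d (ncscale (of_int (sign \<sigma>)) (q \<sigma>))" if "\<sigma> \<in> ?S" for \<sigma>
      unfolding prod[OF that] by (rule fock_algebra_simps)
  qed (simp add: fock_algebra_simps(1))
  also have "\<dots> = encode_mat (\<lambda>u v. \<Sum>\<sigma>\<in>?S. ncmat d (ncscale (of_int (sign \<sigma>)) (q \<sigma>)) u v)"
    by (rule finsum_fock_elem) (simp add: finite_permutations)
  also have "(\<lambda>u v. \<Sum>\<sigma>\<in>?S. ncmat d (ncscale (of_int (sign \<sigma>)) (q \<sigma>)) u v) = (\<lambda>u v. 0)"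
  proof (intro ext)
    fix u v
    show "(\<Sum>\<sigma>\<in>?S. ncmat d (ncscale (of_int (sign \<sigma>)) (q \<sigma>)) u v) = 0"
    proof (cases "u \<in> words d")
      case True
      have "smult (of_int z) r = of_int z * r" for z and r :: "complex poly"
        by (simp add: of_int_poly)
      then show ?thesis
        using matrix_standard_identity[OF finite_words assms True, of "\<lambda>i. ncmat d (p i)" v]
        by (simp add: ncmat_scale q_def matq del: upt_Suc)
    qed (simp add: ncmat_outside)
  qed
  finally show "standard_identity ?A k a = \<zero>\<^bsub>?A\<^esub>" by (simp add: fock_algebra_def)
qed

lemma fock_elem_word:
  "foldr (mult (fock_algebra d \<phi>)) (map (\<lambda>i. fock_elem d [(1, [i])]) w) (one (fock_algebra d \<phi>)) = fock_elem d [(1, w)]"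
  by (induction w) (simp_all add: fock_algebra_simps ncmult_def)

text \<open>The constants are chosen in the order \<open>C\<close>, \<open>M\<close>, \<alpha>,
  \<open>L\<close>: \<alpha> brings the error of all moments below 1/(d+1), and only then is
  \<open>L\<close> taken large enough for positivity, at a size that grows as \<alpha>
  shrinks.\<close>

lemma (in word_trace) approximate_word_trace:
  fixes d :: nat
  shows "\<exists>(B :: (nat \<Rightarrow> complex) tracial_algebra) x. trace_reduced_algebra B \<and>
    (\<forall>k. (card (words d))\<^sup>2 < 2 * k \<longrightarrow> type_I_le k B) \<and>
    (\<forall>i. x i \<in> carrier B \<and> invol B (x i) = x i) \<and>
    (\<forall>w\<in>words d. cmod (tau B (foldr (mult B) (map x w) (one B)) - t w) \<le> 1 / real (Suc d))"
proof -
  define C where "C = 1 + (\<Sum>w\<in>words d. cmod (t w))"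
  have C: "C \<ge> 0" "\<And>w. w \<in> words d \<Longrightarrow> cmod (t w) \<le> C"
    unfolding C_def using member_le_sum[of _ "words d" "\<lambda>w. cmod (t w)"]
    by (auto intro!: add_nonneg_nonneg sum_nonneg intro: add_increasing)
  define K where "K = (\<lambda>w. 16 ^ (length w * length w) * (\<Sum>u\<in>words d. cmod (fock d w u u)) + cmod (t w) * card (words d))"
  have K: "K w \<ge> 0" for w by (simp add: K_def sum_nonneg)
  define M where "M = 1 + (\<Sum>w\<in>words d. K w)"
  have M: "M > 0" "\<And>w. w \<in> words d \<Longrightarrow> K w \<le> M"
    unfolding M_def using member_le_sum[of _ "words d" K]
    by (auto intro!: add_pos_nonneg sum_nonneg intro: add_increasing simp: K)
  define \<alpha> where "\<alpha> = 1 / (real (Suc d) * M)"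
  have \<alpha>: "\<alpha> > 0" using M by (simp add: \<alpha>_def)
  define L where "L = 1 + (4 * C * card (words d))\<^sup>2 / \<alpha>\<^sup>2"
  have L: "L \<ge> 1" by (simp add: L_def)
  have big: "(4 * C * card (words d))\<^sup>2 \<le> \<alpha>\<^sup>2 * L" using \<alpha> by (simp add: L_def field_simps)
  let ?B = "fock_algebra d (fock_trace d \<alpha> L)" and ?x = "\<lambda>i. fock_elem d [(1, [i])]"
  have "cmod (tau ?B (foldr (mult ?B) (map ?x w) (one ?B)) - t w) \<le> 1 / real (Suc d)" if w: "w \<in> words d" for w
  proof -
    have "cmod (tau ?B (foldr (mult ?B) (map ?x w) (one ?B)) - t w) \<le> \<alpha> * K w"
      unfolding fock_elem_word fock_algebra_simps(8) K_def by (rule fock_trace_word[OF \<alpha> w])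
    also have "\<dots> \<le> \<alpha> * M" using M(2)[OF w] \<alpha> by simp
    also have "\<dots> = 1 / real (Suc d)" using M(1) by (simp add: \<alpha>_def)
    finally show ?thesis .
  qed
  moreover have "?x i \<in> carrier ?B \<and> invol ?B (?x i) = ?x i" for i
    by (simp add: fock_algebra_simps ncadj_def)
  moreover have tr: "trace_reduced_algebra ?B"
    using trace_reduced_fock_algebra[OF \<alpha> L C(1) C(2) big] by blast
  ultimately show ?thesis
    using tr type_I_le_fock_algebra[of d]
    by (intro exI[of _ ?B] exI[of _ ?x] conjI allI impI ballI) blast+
qed

section \<open>Evaluation of noncommutative polynomials\<close>

definition ncsub :: "ncpoly \<Rightarrow> ncpoly \<Rightarrow> ncpoly"
  where "ncsub P Q = P @ ncscale (-1) Q"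

primrec ncpow :: "ncpoly \<Rightarrow> nat \<Rightarrow> ncpoly"
  where "ncpow P 0 = [(1, [])]" | "ncpow P (Suc n) = ncmult (ncpow P n) P"

context tracial_star_algebra
begin

definition nceval :: "(nat \<Rightarrow> 'b) \<Rightarrow> ncpoly \<Rightarrow> 'b"
  where "nceval s P = foldr (\<lambda>(c, w) y. c \<odot> lprod (map s w) \<oplus> y) P \<zero>"

lemma nceval_Nil [simp]: "nceval s [] = \<zero>"
  and nceval_Cons: "nceval s ((c, w) # P) = c \<odot> lprod (map s w) \<oplus> nceval s P"
  by (simp_all add: nceval_def)

context
  fixes s :: "nat \<Rightarrow> 'b"
  assumes s: "\<And>i. s i \<in> carrier A" "\<And>i. invol A (s i) = s i"
begin

lemma word_closed [simp]: "lprod (map s w) \<in> carrier A"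
  using s by (intro lprod_closed) auto

lemma nceval_closed [simp]: "nceval s P \<in> carrier A"
  by (induction P) (auto simp: nceval_Cons)

lemma word_append: "lprod (map s (u @ v)) = lprod (map s u) \<otimes> lprod (map s v)"
  unfolding map_append by (rule lprod_append) (use s in auto)

lemma invol_word: "invol A (lprod (map s w)) = lprod (map s (rev w))"
proof (induction w)
  case (Cons i w)
  have "lprod (map s (rev (i # w))) = lprod (map s (rev w)) \<otimes> lprod (map s [i])"
    unfolding rev.simps word_append ..
  then show ?case using Cons s by (simp add: invol_mult)
qed simp

lemma nceval_append: "nceval s (P @ Q) = nceval s P \<oplus> nceval s Q"
  by (induction P) (auto simp: nceval_Cons a_assoc)

lemma nceval_scale: "nceval s (ncscale c P) = c \<odot> nceval s P"
  by (induction P) (auto simp: ncscale_def nceval_Cons scale_add_right scale_scale)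

lemma nceval_map_mult:
  "nceval s (map (\<lambda>(b, v). (a * b, u @ v)) Q) = a \<odot> lprod (map s u) \<otimes> nceval s Q"
proof (induction Q)
  case (Cons p Q)
  obtain b v where p: "p = (b, v)" by (cases p)
  show ?case using Cons
    by (simp add: p nceval_Cons word_append r_distr smult_mult_left smult_mult_right scale_scale mult.commute del: map_append)
qed simp

lemma nceval_mult: "nceval s (ncmult P Q) = nceval s P \<otimes> nceval s Q"
  by (induction P) (auto simp: ncmult_Cons nceval_append nceval_map_mult nceval_Cons l_distr)

lemma nceval_adj: "nceval s (ncadj P) = invol A (nceval s P)"
  by (induction P) (auto simp: ncadj_def nceval_Cons invol_add invol_smult invol_word)

lemma nceval_one: "nceval s [(1, [])] = \<one>"
  by (simp add: nceval_Cons)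

lemma nceval_sub: "nceval s (ncsub P Q) = nceval s P \<ominus> nceval s Q"
  by (simp add: ncsub_def nceval_append nceval_scale minus_eq_scale)

lemma nceval_pow: "nceval s (ncpow P n) = nceval s P [^] n"
  by (induction n) (simp_all add: nceval_one nceval_mult)

lemma tau_nceval: "tau A (nceval s P) = nclin (\<lambda>w. tau A (lprod (map s w))) P"
  by (induction P) (auto simp: nceval_Cons tau_add tau_smult)

text \<open>A dyadic norm is a continuous function of finitely many word moments, so it converges
  with them.\<close>

lemma N_nceval:
  "N (Suc k) (nceval s P) = root (2 ^ Suc k) (Re (nclin (\<lambda>w. tau A (lprod (map s w))) (ncpow (ncmult (ncadj P) P) (2 ^ k))))"
  by (simp add: N_def pnorm_def tau_nceval[symmetric] nceval_pow nceval_mult nceval_adj)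

text \<open>Positivity is that of the trace on P* P, where the polynomial P has coefficient
  \<open>f u\<close> at each word \<open>u\<close> of \<open>V\<close>.\<close>

lemma word_trace_tau: "word_trace (\<lambda>w. tau A (lprod (map s w)))"
proof
  fix f :: "nat list \<Rightarrow> complex" and V :: "nat list set"
  assume "finite V"
  then obtain vs where vs: "set vs = V" "distinct vs" using finite_distinct_list by blast
  define P where "P = map (\<lambda>u. (f u, u)) vs"
  have lin: "nclin g P = (\<Sum>u\<in>V. f u * g u)" for g
    using vs by (simp add: P_def nclin_def comp_def sum_list_distinct_conv_sum_set)
  have lin': "nclin g (ncadj P) = (\<Sum>u\<in>V. cnj (f u) * g (rev u))" for g
    by (simp add: nclin_adj lin)
  have "Re (tau A (nceval s (ncmult (ncadj P) P))) \<ge> 0"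
    unfolding nceval_mult nceval_adj by (rule tau_square) simp
  then show "0 \<le> Re (\<Sum>u\<in>V. \<Sum>v\<in>V. cnj (f u) * f v * tau A (lprod (map s (rev u @ v))))"
    by (simp only: tau_nceval nclin_mult lin lin' sum_distrib_left mult.assoc)
next
  show "tau A (lprod (map s (u @ v))) = tau A (lprod (map s (v @ u)))" for u v
    unfolding word_append by (rule tau_commute) simp_all
  show "tau A (lprod (map s (rev w))) = cnj (tau A (lprod (map s w)))" for w
    unfolding invol_word[symmetric] by (rule tau_invol) simp
qed (simp add: tau_one)

lemma complex_subalgebra_nceval: "complex_subalgebra (range (nceval s)) A"
  unfolding complex_subalgebra_def
proof (intro conjI allI ballI)
  show "subring (range (nceval s)) A"
  proof (rule subringI)
    show "\<one> \<in> range (nceval s)" by (metis nceval_one rangeI)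
    show "\<ominus> h \<in> range (nceval s)" if "h \<in> range (nceval s)" for h
      using that by (auto simp: uminus_eq_scale nceval_scale[symmetric])
  qed (auto simp: nceval_mult[symmetric] nceval_append[symmetric])
qed (auto simp: nceval_scale[symmetric])

end

text \<open>From p q - a b = (p - a) q + a (q - b). One dyadic level is lost to
  \<open>N_mult\<close>, and \<open>\<delta> \<le> 1\<close> bounds the norm of q by C + 1.\<close>

lemma N_mult_diff_le:
  assumes c: "p \<in> carrier A" "q \<in> carrier A" "a \<in> carrier A" "b \<in> carrier A"
    and d: "N (Suc (Suc k)) (p \<ominus> a) < \<delta>" "N (Suc (Suc k)) (q \<ominus> b) < \<delta>" "\<delta> \<le> 1"
    and C: "N (Suc (Suc k)) a \<le> C" "N (Suc (Suc k)) b \<le> C"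
  shows "N (Suc k) (p \<otimes> q \<ominus> a \<otimes> b) \<le> \<delta> * (2 * C + 1)"
proof -
  let ?N = "N (Suc (Suc k))"
  have e: "p \<otimes> q \<ominus> a \<otimes> q = (p \<ominus> a) \<otimes> q" "a \<otimes> q \<ominus> a \<otimes> b = a \<otimes> (q \<ominus> b)"
    using c by (simp_all add: minus_eq l_distr r_distr l_minus r_minus)
  have "N (Suc k) (p \<otimes> q \<ominus> a \<otimes> b) \<le> N (Suc k) ((p \<ominus> a) \<otimes> q) + N (Suc k) (a \<otimes> (q \<ominus> b))"
    using N_triangle_minus[of "p \<otimes> q" "a \<otimes> q" "a \<otimes> b" k] c unfolding e by simp
  also have "\<dots> \<le> ?N (p \<ominus> a) * ?N q + ?N a * ?N (q \<ominus> b)"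
    using c by (intro add_mono N_mult) simp_all
  finally have main: "N (Suc k) (p \<otimes> q \<ominus> a \<otimes> b) \<le> ?N (p \<ominus> a) * ?N q + ?N a * ?N (q \<ominus> b)" .
  have "?N q \<le> 1 + C"
  proof -
    have "q = (q \<ominus> b) \<oplus> b" using c by (simp add: minus_eq a_assoc l_neg)
    then have "?N q \<le> ?N (q \<ominus> b) + ?N b" using N_triangle[of "q \<ominus> b" b "Suc k"] c by simp
    then show ?thesis using d C by linarith
  qed
  then have "?N (p \<ominus> a) * ?N q \<le> \<delta> * (1 + C)"
    using d(1) N_nonneg[of "p \<ominus> a" "Suc (Suc k)"] N_nonneg[of q "Suc (Suc k)"] c by (intro mult_mono) auto
  moreover have "?N a * ?N (q \<ominus> b) \<le> C * \<delta>"
    using d(2) C(1) N_nonneg[of "q \<ominus> b" "Suc (Suc k)"] N_nonneg[of a "Suc (Suc k)"] c by (intro mult_mono) auto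
  moreover have "\<delta> * (1 + C) + C * \<delta> = \<delta> * (2 * C + 1)" by (simp add: algebra_simps)
  ultimately show ?thesis using main by linarith
qed

section \<open>The quotient by the null ideal\<close>

text \<open>By Cauchy-Schwarz the null elements form the radical of the bilinear form tau(y x). This
  condition is linear in x, which makes the ideal properties easy.\<close>

lemma null_ideal_eq: "null_ideal A = {x \<in> carrier A. \<forall>y\<in>carrier A. tau A (y \<otimes> x) = 0}"
proof (intro equalityI subsetI)
  fix x assume "x \<in> null_ideal A"
  then have x: "x \<in> carrier A" "tau A (invol A x \<otimes> x) = 0" by (auto simp: null_ideal_def)
  have "tau A (y \<otimes> x) = 0" if y: "y \<in> carrier A" for y
  proof -
    have "(N (Suc 0) x)\<^sup>2 = 0" using x by (simp add: N_one_eq)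
    then show ?thesis using tau_Cauchy_Schwarz[OF y x(1)] by simp
  qed
  then show "x \<in> {x \<in> carrier A. \<forall>y\<in>carrier A. tau A (y \<otimes> x) = 0}" using x by simp
qed (auto simp: null_ideal_def)

lemma ideal_null_ideal: "ideal (null_ideal A) A"
proof (rule idealI[OF ring_axioms])
  show "subgroup (null_ideal A) (add_monoid A)"
  proof (rule add.subgroupI)
    show "null_ideal A \<subseteq> carrier A" by (auto simp: null_ideal_eq)
    show "null_ideal A \<noteq> {}" by (auto simp: null_ideal_eq intro!: exI[of _ "\<zero>"])
    show "\<ominus> a \<in> null_ideal A" if "a \<in> null_ideal A" for a
      using that by (auto simp: null_ideal_eq uminus_eq_scale smult_mult_right tau_smult)
    show "a \<oplus> b \<in> null_ideal A" if "a \<in> null_ideal A" "b \<in> null_ideal A" for a b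
      using that by (auto simp: null_ideal_eq r_distr tau_add)
  qed
  show "x \<otimes> a \<in> null_ideal A" if "a \<in> null_ideal A" "x \<in> carrier A" for a x
    using that by (auto simp: null_ideal_eq m_assoc[symmetric])
  show "a \<otimes> x \<in> null_ideal A" if "a \<in> null_ideal A" "x \<in> carrier A" for a x
  proof -
    have "tau A (y \<otimes> (a \<otimes> x)) = tau A ((x \<otimes> y) \<otimes> a)" if "y \<in> carrier A" for y
      using that \<open>a \<in> null_ideal A\<close> \<open>x \<in> carrier A\<close> tau_commute[of x "y \<otimes> a"]
      by (simp add: null_ideal_eq m_assoc)
    then show ?thesis using that by (auto simp: null_ideal_eq)
  qed
qed

lemma null_ideal_scale: "x \<in> null_ideal A \<Longrightarrow> c \<odot> x \<in> null_ideal A"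
  by (auto simp: null_ideal_eq smult_mult_right tau_smult)

lemma null_ideal_invol: "x \<in> null_ideal A \<Longrightarrow> invol A x \<in> null_ideal A"
  using tau_commute[of x "invol A x"] by (auto simp: null_ideal_def invol_invol)

lemma tau_null_ideal: "x \<in> null_ideal A \<Longrightarrow> tau A x = 0"
  using null_ideal_eq by (auto dest: bspec[of _ _ "\<one>"])

lemma coset_eq_iff:
  assumes "x \<in> carrier A" "y \<in> carrier A"
  shows "null_ideal A +> x = null_ideal A +> y \<longleftrightarrow> x \<ominus> y \<in> null_ideal A"
  using quotient_eq_iff_same_a_r_cos[OF ideal_null_ideal assms] by blast

lemma coset_members:
  assumes "x \<in> carrier A"
  shows "y \<in> null_ideal A +> x \<longleftrightarrow> y \<in> carrier A \<and> y \<ominus> x \<in> null_ideal A"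
proof
  assume "y \<in> null_ideal A +> x"
  then obtain h where h: "h \<in> null_ideal A" "y = h \<oplus> x" by (auto simp: a_r_coset_def')
  then have "h \<in> carrier A" by (simp add: null_ideal_eq)
  then have "y \<ominus> x = h" using h(2) assms by (simp add: minus_eq a_assoc r_neg)
  then show "y \<in> carrier A \<and> y \<ominus> x \<in> null_ideal A" using h \<open>h \<in> carrier A\<close> assms by simp
next
  assume y: "y \<in> carrier A \<and> y \<ominus> x \<in> null_ideal A"
  then have "y = (y \<ominus> x) \<oplus> x" using assms by (simp add: minus_eq a_assoc l_neg)
  then show "y \<in> null_ideal A +> x" using y by (auto simp: a_r_coset_def')
qed

text \<open>The quotient operations collect the results over all representatives. These agree
  because the null ideal is stable under scaling and involution and the trace vanishes on
  it.\<close>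

lemma quotient_algebra_coset:
  defines "Q \<equiv> quotient_algebra A (null_ideal A)" and "q \<equiv> \<lambda>x. null_ideal A +> x"
  shows "q \<in> ring_hom A Q"
    and "x \<in> carrier A \<Longrightarrow> c \<odot>\<^bsub>Q\<^esub> q x = q (c \<odot> x)"
    and "x \<in> carrier A \<Longrightarrow> invol Q (q x) = q (invol A x)"
    and "x \<in> carrier A \<Longrightarrow> tau Q (q x) = tau A x"
proof -
  interpret I: ideal "null_ideal A" A by (rule ideal_null_ideal)
  show "q \<in> ring_hom A Q"
    using I.rcos_ring_hom unfolding q_def Q_def quotient_algebra_def
    by (simp add: ring_hom_def)
  assume x: "x \<in> carrier A"
  have self: "x \<in> q x" using x unfolding q_def by (rule I.a_rcos_self)
  have const: "(\<Union>y\<in>q x. q (f y)) = q (f x)" if "\<And>y. y \<in> q x \<Longrightarrow> q (f y) = q (f x)" for f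
  proof -
    have "(\<Union>y\<in>q x. q (f y)) = (\<Union>y\<in>q x. q (f x))" by (rule SUP_cong[OF refl]) (rule that)
    also have "\<dots> = q (f x)" using self by blast
    finally show ?thesis .
  qed
  show "c \<odot>\<^bsub>Q\<^esub> q x = q (c \<odot> x)"
  proof -
    have "q (c \<odot> y) = q (c \<odot> x)" if "y \<in> q x" for y
    proof -
      have y: "y \<in> carrier A" "y \<ominus> x \<in> null_ideal A" using that x by (auto simp: q_def coset_members)
      have "c \<odot> y \<ominus> c \<odot> x = c \<odot> (y \<ominus> x)"
        using x y by (simp add: minus_eq_scale scale_add_right scale_scale mult.commute)
      then show ?thesis unfolding q_def using x y null_ideal_scale by (simp add: coset_eq_iff)
    qed
    then show ?thesis using const[of "\<lambda>y. c \<odot> y"] by (simp add: Q_def quotient_algebra_def q_def)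
  qed
  show "invol Q (q x) = q (invol A x)"
  proof -
    have "q (invol A y) = q (invol A x)" if "y \<in> q x" for y
    proof -
      have y: "y \<in> carrier A" "y \<ominus> x \<in> null_ideal A" using that x by (auto simp: q_def coset_members)
      then show ?thesis unfolding q_def using x y null_ideal_invol[of "y \<ominus> x"] by (simp add: coset_eq_iff invol_minus)
    qed
    then show ?thesis using const[of "invol A"] by (simp add: Q_def quotient_algebra_def q_def)
  qed
  show "tau Q (q x) = tau A x"
  proof -
    have "tau A y = tau A x" if "y \<in> q x" for y
      using that x tau_null_ideal[of "y \<ominus> x"] by (auto simp: q_def coset_members tau_minus)
    then have "tau A ` q x = {tau A x}" using self by blast
    then show ?thesis by (simp add: Q_def quotient_algebra_def)
  qed
qed

end

section \<open>The bounded product\<close>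

text \<open>Bounded values stay in a compact disc, so the image filter has a cluster point, and for
  an ultrafilter a cluster point is a limit. Thus \<open>Lim\<close> denotes a genuine
  limit.\<close>

lemma ultrafilter_on_convergent:
  fixes f :: "'i \<Rightarrow> complex"
  assumes u: "ultrafilter_on I \<omega>" and b: "\<And>i. i \<in> I \<Longrightarrow> cmod (f i) \<le> C"
  shows "(f \<longlongrightarrow> Lim \<omega> f) \<omega>"
proof -
  have nb: "\<omega> \<noteq> bot" and I: "eventually (\<lambda>i. i \<in> I) \<omega>"
    and dich: "\<And>P. eventually P \<omega> \<or> eventually (\<lambda>i. \<not> P i) \<omega>"
    using u by (auto simp: ultrafilter_on_def)
  let ?F = "filtermap f \<omega>"
  have "?F \<noteq> bot" using nb by (simp add: filtermap_bot_iff)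
  moreover have "eventually (\<lambda>z. z \<in> cball 0 C) ?F"
    unfolding eventually_filtermap by (rule eventually_mono[OF I]) (simp add: b)
  moreover have "compact (cball (0::complex) C)" by (rule compact_cball)
  ultimately obtain l where l: "inf (nhds l) ?F \<noteq> bot"
    unfolding compact_filter by blast
  have "(f \<longlongrightarrow> l) \<omega>"
  proof (rule topological_tendstoI, rule ccontr)
    fix S assume S: "open S" "l \<in> S" and "\<not> eventually (\<lambda>x. f x \<in> S) \<omega>"
    then have "eventually (\<lambda>x. f x \<notin> S) \<omega>" using dich by blast
    then have "eventually (\<lambda>z. z \<notin> S) ?F" by (simp add: eventually_filtermap)
    moreover have "eventually (\<lambda>z. z \<in> S) (nhds l)" using S by (rule eventually_nhds_in_open)
    ultimately have "eventually (\<lambda>z. False) (inf (nhds l) ?F)"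
      unfolding eventually_inf by blast
    then show False using l by (simp add: trivial_limit_def)
  qed
  then show ?thesis using tendsto_Lim[OF nb] by metis
qed

locale tracial_family =
  fixes I :: "'i set" and A :: "'i \<Rightarrow> ('b, 'm) tracial_algebra_scheme" and \<omega> :: "'i filter"
  assumes tracial: "\<And>i. i \<in> I \<Longrightarrow> tracial_star_algebra (A i)"
    and ultrafilter: "ultrafilter_on I \<omega>"
begin

text \<open>The index is shifted: \<open>NN i k\<close> is the norm with exponent 2^(k+1), which
  avoids the degenerate level 0.\<close>

abbreviation NN :: "'i \<Rightarrow> nat \<Rightarrow> 'b \<Rightarrow> real"
  where "NN i k x \<equiv> tracial_star_algebra.N (A i) (Suc k) x"

abbreviation BP :: "('i \<Rightarrow> 'b) tracial_algebra"
  where "BP \<equiv> bounded_product I A \<omega>"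

lemma not_bot: "\<omega> \<noteq> bot" and eventually_I: "eventually (\<lambda>i. i \<in> I) \<omega>"
  using ultrafilter by (auto simp: ultrafilter_on_def)

text \<open>By \<open>pnorm_bound_N\<close>, bounds at the dyadic exponents imply bounds at all even
  ones, so the dyadic norm inequalities suffice for the closure properties.\<close>

lemma carrier_BP_iff:
  "a \<in> carrier BP \<longleftrightarrow> a \<in> (\<Pi>\<^sub>E i\<in>I. carrier (A i)) \<and> (\<forall>k. \<exists>C. \<forall>i\<in>I. NN i k (a i) \<le> C)"
proof
  assume a: "a \<in> carrier BP"
  have "\<exists>C. \<forall>i\<in>I. NN i k (a i) \<le> C" for k
  proof -
    have "even (2 ^ Suc k :: nat)" "2 \<le> (2 ^ Suc k :: nat)" by simp_all
    moreover have "\<forall>p. even p \<and> 2 \<le> p \<longrightarrow> (\<exists>C. \<forall>i\<in>I. pnorm (A i) p (a i) \<le> C)"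
      using a by (simp add: bounded_product_def)
    ultimately obtain C where "\<forall>i\<in>I. pnorm (A i) (2 ^ Suc k) (a i) \<le> C" by blast
    then show ?thesis using tracial by (auto simp: tracial_star_algebra.N_def)
  qed
  then show "a \<in> (\<Pi>\<^sub>E i\<in>I. carrier (A i)) \<and> (\<forall>k. \<exists>C. \<forall>i\<in>I. NN i k (a i) \<le> C)"
    using a by (simp add: bounded_product_def)
next
  assume a: "a \<in> (\<Pi>\<^sub>E i\<in>I. carrier (A i)) \<and> (\<forall>k. \<exists>C. \<forall>i\<in>I. NN i k (a i) \<le> C)"
  have "\<exists>C. \<forall>i\<in>I. pnorm (A i) p (a i) \<le> C" if p: "even p" "2 \<le> p" for p
  proof -
    have "p < 2 ^ p" by (rule less_exp)
    then have pk: "p \<le> 2 ^ Suc p" unfolding power_Suc by linarith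
    obtain C where C: "\<And>i. i \<in> I \<Longrightarrow> NN i p (a i) \<le> C" using a by blast
    have "pnorm (A i) p (a i) \<le> max 1 C ^ (2 ^ Suc p)" if i: "i \<in> I" for i
    proof -
      have "pnorm (A i) p (a i) \<le> max 1 (NN i p (a i)) ^ (2 ^ Suc p)"
        using a i by (intro tracial_star_algebra.pnorm_bound_N[OF tracial[OF i] _ p pk]) auto
      also have "\<dots> \<le> max 1 C ^ (2 ^ Suc p)"
        using C[OF i] by (intro power_mono) auto
      finally show ?thesis .
    qed
    then show ?thesis by blast
  qed
  then show "a \<in> carrier BP" using a by (simp add: bounded_product_def)
qed

lemma BP_component: "a \<in> carrier BP \<Longrightarrow> i \<in> I \<Longrightarrow> a i \<in> carrier (A i)"
  by (auto simp: carrier_BP_iff)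

lemma BP_restrict: "a \<in> carrier BP \<Longrightarrow> (\<And>i. i \<in> I \<Longrightarrow> f i = a i) \<Longrightarrow> restrict f I = a"
  by (auto simp: carrier_BP_iff PiE_def extensional_def fun_eq_iff)

lemma BP_bounded: "a \<in> carrier BP \<Longrightarrow> \<exists>C. \<forall>i\<in>I. NN i k (a i) \<le> C"
  by (simp add: carrier_BP_iff)

lemma BP_ops:
  "mult BP a b = (\<lambda>i\<in>I. a i \<otimes>\<^bsub>A i\<^esub> b i)"
  "one BP = (\<lambda>i\<in>I. \<one>\<^bsub>A i\<^esub>)"
  "zero BP = (\<lambda>i\<in>I. \<zero>\<^bsub>A i\<^esub>)"
  "add BP a b = (\<lambda>i\<in>I. a i \<oplus>\<^bsub>A i\<^esub> b i)"
  "c \<odot>\<^bsub>BP\<^esub> a = (\<lambda>i\<in>I. c \<odot>\<^bsub>A i\<^esub> a i)"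
  "invol BP a = (\<lambda>i\<in>I. invol (A i) (a i))"
  "tau BP a = Lim \<omega> (\<lambda>i. tau (A i) (a i))"
  by (simp_all add: bounded_product_def)

lemma BP_closedI:
  assumes "\<And>i. i \<in> I \<Longrightarrow> f i \<in> carrier (A i)" "\<And>k. \<exists>C. \<forall>i\<in>I. NN i k (f i) \<le> C"
  shows "restrict f I \<in> carrier BP"
  using assms by (auto simp: carrier_BP_iff)

lemma BP_closed:
  shows "one BP \<in> carrier BP" "zero BP \<in> carrier BP"
    and "a \<in> carrier BP \<Longrightarrow> b \<in> carrier BP \<Longrightarrow> mult BP a b \<in> carrier BP"
    and "a \<in> carrier BP \<Longrightarrow> b \<in> carrier BP \<Longrightarrow> add BP a b \<in> carrier BP"
    and "a \<in> carrier BP \<Longrightarrow> c \<odot>\<^bsub>BP\<^esub> a \<in> carrier BP"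
    and "a \<in> carrier BP \<Longrightarrow> invol BP a \<in> carrier BP"
proof -
  show "one BP \<in> carrier BP" unfolding BP_ops
  proof (rule BP_closedI)
    show "\<one>\<^bsub>A i\<^esub> \<in> carrier (A i)" if "i \<in> I" for i
    proof -
      interpret tracial_star_algebra "A i" by (rule tracial[OF that])
      show ?thesis by simp
    qed
    show "\<exists>C. \<forall>i\<in>I. NN i k \<one>\<^bsub>A i\<^esub> \<le> C" for k
      by (intro exI[of _ 1] ballI) (simp add: tracial_star_algebra.N_one[OF tracial])
  qed
  show "zero BP \<in> carrier BP" unfolding BP_ops
  proof (rule BP_closedI)
    show "\<zero>\<^bsub>A i\<^esub> \<in> carrier (A i)" if "i \<in> I" for i
    proof -
      interpret tracial_star_algebra "A i" by (rule tracial[OF that])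
      show ?thesis by simp
    qed
    show "\<exists>C. \<forall>i\<in>I. NN i k \<zero>\<^bsub>A i\<^esub> \<le> C" for k
      by (intro exI[of _ 0] ballI) (simp add: tracial_star_algebra.N_zero[OF tracial])
  qed
  assume a: "a \<in> carrier BP"
  note ac = BP_component[OF a]
  show "c \<odot>\<^bsub>BP\<^esub> a \<in> carrier BP" unfolding BP_ops
  proof (rule BP_closedI)
    show "c \<odot>\<^bsub>A i\<^esub> a i \<in> carrier (A i)" if "i \<in> I" for i
      using tracial_star_algebra.scale_closed[OF tracial[OF that] ac[OF that]] .
    fix k
    obtain C where C: "\<And>i. i \<in> I \<Longrightarrow> NN i k (a i) \<le> C" using BP_bounded[OF a] by blast
    show "\<exists>C. \<forall>i\<in>I. NN i k (c \<odot>\<^bsub>A i\<^esub> a i) \<le> C"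
      by (intro exI[of _ "cmod c * C"] ballI)
        (simp add: tracial_star_algebra.N_scale[OF tracial ac] C mult_left_mono)
  qed
  show "invol BP a \<in> carrier BP" unfolding BP_ops
  proof (rule BP_closedI)
    show "invol (A i) (a i) \<in> carrier (A i)" if "i \<in> I" for i
      using tracial_star_algebra.invol_closed[OF tracial[OF that] ac[OF that]] .
    show "\<exists>C. \<forall>i\<in>I. NN i k (invol (A i) (a i)) \<le> C" for k
      using BP_bounded[OF a, of k] by (simp add: tracial_star_algebra.N_invol[OF tracial ac])
  qed
  assume b: "b \<in> carrier BP"
  note bc = BP_component[OF b]
  show "mult BP a b \<in> carrier BP" unfolding BP_ops
  proof (rule BP_closedI)
    show "a i \<otimes>\<^bsub>A i\<^esub> b i \<in> carrier (A i)" if "i \<in> I" for i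
    proof -
      interpret tracial_star_algebra "A i" by (rule tracial[OF that])
      show ?thesis using ac[OF that] bc[OF that] by simp
    qed
    fix k
    \<comment> \<open>A product at one level needs bounds at the next; this is harmless because all
      levels are bounded.\<close>
    obtain C where C: "\<And>i. i \<in> I \<Longrightarrow> NN i (Suc k) (a i) \<le> C" using BP_bounded[OF a] by blast
    obtain D where D: "\<And>i. i \<in> I \<Longrightarrow> NN i (Suc k) (b i) \<le> D" using BP_bounded[OF b] by blast
    have "NN i k (a i \<otimes>\<^bsub>A i\<^esub> b i) \<le> C * D" if i: "i \<in> I" for i
    proof -
      interpret tracial_star_algebra "A i" by (rule tracial[OF i])
      have "N (Suc k) (a i \<otimes>\<^bsub>A i\<^esub> b i) \<le> N (Suc (Suc k)) (a i) * N (Suc (Suc k)) (b i)"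
        using ac[OF i] bc[OF i] by (rule N_mult)
      also have "\<dots> \<le> C * D"
        using C[OF i] D[OF i] N_nonneg[OF ac[OF i], of "Suc (Suc k)"] N_nonneg[OF bc[OF i], of "Suc (Suc k)"]
        by (intro mult_mono) auto
      finally show ?thesis .
    qed
    then show "\<exists>C. \<forall>i\<in>I. NN i k (a i \<otimes>\<^bsub>A i\<^esub> b i) \<le> C" by blast
  qed
  show "add BP a b \<in> carrier BP" unfolding BP_ops
  proof (rule BP_closedI)
    show "a i \<oplus>\<^bsub>A i\<^esub> b i \<in> carrier (A i)" if "i \<in> I" for i
    proof -
      interpret tracial_star_algebra "A i" by (rule tracial[OF that])
      show ?thesis using ac[OF that] bc[OF that] by simp
    qed
    fix k
    obtain C where C: "\<And>i. i \<in> I \<Longrightarrow> NN i k (a i) \<le> C" using BP_bounded[OF a] by blast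
    obtain D where D: "\<And>i. i \<in> I \<Longrightarrow> NN i k (b i) \<le> D" using BP_bounded[OF b] by blast
    have "NN i k (a i \<oplus>\<^bsub>A i\<^esub> b i) \<le> C + D" if i: "i \<in> I" for i
      using tracial_star_algebra.N_triangle[OF tracial[OF i] ac[OF i] bc[OF i], of k] C[OF i] D[OF i] by linarith
    then show "\<exists>C. \<forall>i\<in>I. NN i k (a i \<oplus>\<^bsub>A i\<^esub> b i) \<le> C" by blast
  qed
qed

lemma tendsto_tau_BP:
  assumes a: "a \<in> carrier BP"
  shows "((\<lambda>i. tau (A i) (a i)) \<longlongrightarrow> tau BP a) \<omega>"
proof -
  obtain C where C: "\<And>i. i \<in> I \<Longrightarrow> NN i 0 (a i) \<le> C" using BP_bounded[OF a] by blast
  have "cmod (tau (A i) (a i)) \<le> C" if i: "i \<in> I" for i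
    using tracial_star_algebra.cmod_tau_le[OF tracial[OF i] BP_component[OF a i], of 0] C[OF i] by linarith
  then show ?thesis unfolding BP_ops by (rule ultrafilter_on_convergent[OF ultrafilter])
qed

lemma tau_BP_eqI:
  assumes "\<And>i. i \<in> I \<Longrightarrow> tau (A i) (a i) = f i" "(f \<longlongrightarrow> l) \<omega>"
  shows "tau BP a = l"
proof -
  have "((\<lambda>i. tau (A i) (a i)) \<longlongrightarrow> l) \<omega>"
    using assms(2) by (rule Lim_transform_eventually) (rule eventually_mono[OF eventually_I], simp add: assms)
  then show ?thesis unfolding BP_ops by (rule tendsto_Lim[OF not_bot])
qed

lemma abelian_group_BP: "abelian_group BP"
proof (rule abelian_groupI)
  fix x y z assume x: "x \<in> carrier BP" and y: "y \<in> carrier BP" and z: "z \<in> carrier BP"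
  note c = BP_component[OF x] BP_component[OF y] BP_component[OF z]
  show "x \<oplus>\<^bsub>BP\<^esub> y \<oplus>\<^bsub>BP\<^esub> z = x \<oplus>\<^bsub>BP\<^esub> (y \<oplus>\<^bsub>BP\<^esub> z)"
    unfolding BP_ops
  proof (rule restrict_ext)
    fix i assume i: "i \<in> I"
    interpret tracial_star_algebra "A i" by (rule tracial[OF i])
    show "(\<lambda>i\<in>I. x i \<oplus>\<^bsub>A i\<^esub> y i) i \<oplus>\<^bsub>A i\<^esub> z i = x i \<oplus>\<^bsub>A i\<^esub> (\<lambda>i\<in>I. y i \<oplus>\<^bsub>A i\<^esub> z i) i"
      using i c[OF i] by (simp add: a_assoc)
  qed
next
  fix x y assume x: "x \<in> carrier BP" and y: "y \<in> carrier BP"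
  note c = BP_component[OF x] BP_component[OF y]
  show "x \<oplus>\<^bsub>BP\<^esub> y = y \<oplus>\<^bsub>BP\<^esub> x"
    unfolding BP_ops
  proof (rule restrict_ext)
    fix i assume i: "i \<in> I"
    interpret tracial_star_algebra "A i" by (rule tracial[OF i])
    show "x i \<oplus>\<^bsub>A i\<^esub> y i = y i \<oplus>\<^bsub>A i\<^esub> x i" using c[OF i] by (rule a_comm)
  qed
next
  fix x assume x: "x \<in> carrier BP"
  note c = BP_component[OF x]
  show "\<zero>\<^bsub>BP\<^esub> \<oplus>\<^bsub>BP\<^esub> x = x"
    unfolding BP_ops
  proof (rule BP_restrict[OF x])
    fix i assume i: "i \<in> I"
    interpret tracial_star_algebra "A i" by (rule tracial[OF i])
    show "(\<lambda>i\<in>I. \<zero>\<^bsub>A i\<^esub>) i \<oplus>\<^bsub>A i\<^esub> x i = x i" using i c[OF i] by simp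
  qed
  have "((-1) \<odot>\<^bsub>BP\<^esub> x) \<oplus>\<^bsub>BP\<^esub> x = \<zero>\<^bsub>BP\<^esub>"
    unfolding BP_ops
  proof (rule restrict_ext)
    fix i assume i: "i \<in> I"
    interpret tracial_star_algebra "A i" by (rule tracial[OF i])
    show "(\<lambda>i\<in>I. (-1) \<odot>\<^bsub>A i\<^esub> x i) i \<oplus>\<^bsub>A i\<^esub> x i = \<zero>\<^bsub>A i\<^esub>"
      using i c[OF i] uminus_eq_scale[OF c[OF i]] l_neg[OF c[OF i]] by simp
  qed
  then show "\<exists>y\<in>carrier BP. y \<oplus>\<^bsub>BP\<^esub> x = \<zero>\<^bsub>BP\<^esub>" using BP_closed(5)[OF x] by blast
qed (use BP_closed in auto)

lemma BP_pointwise_eq: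
  assumes "\<And>i. tracial_star_algebra (A i) \<Longrightarrow> i \<in> I \<Longrightarrow> f i = g i"
  shows "restrict f I = restrict g I"
  using assms tracial by (intro restrict_ext) auto

lemma ring_BP: "ring BP"
proof (rule ringI)
  show "abelian_group BP" by (rule abelian_group_BP)
  show "monoid BP"
  proof (rule monoidI)
    fix x y z assume x: "x \<in> carrier BP" and y: "y \<in> carrier BP" and z: "z \<in> carrier BP"
    note c = BP_component[OF x] BP_component[OF y] BP_component[OF z]
    show "x \<otimes>\<^bsub>BP\<^esub> y \<otimes>\<^bsub>BP\<^esub> z = x \<otimes>\<^bsub>BP\<^esub> (y \<otimes>\<^bsub>BP\<^esub> z)"
      unfolding BP_ops
    proof (rule BP_pointwise_eq)
      fix i assume "tracial_star_algebra (A i)" and i: "i \<in> I"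
      then interpret tracial_star_algebra "A i" by simp
      show "(\<lambda>i\<in>I. x i \<otimes>\<^bsub>A i\<^esub> y i) i \<otimes>\<^bsub>A i\<^esub> z i = x i \<otimes>\<^bsub>A i\<^esub> (\<lambda>i\<in>I. y i \<otimes>\<^bsub>A i\<^esub> z i) i"
        using i c[OF i] by (simp add: m_assoc)
    qed
  next
    fix x assume x: "x \<in> carrier BP"
    note c = BP_component[OF x]
    show "\<one>\<^bsub>BP\<^esub> \<otimes>\<^bsub>BP\<^esub> x = x" "x \<otimes>\<^bsub>BP\<^esub> \<one>\<^bsub>BP\<^esub> = x"
      unfolding BP_ops
    proof (rule_tac [!] BP_restrict[OF x])
      fix i assume i: "i \<in> I"
      interpret tracial_star_algebra "A i" by (rule tracial[OF i])
      show "(\<lambda>i\<in>I. \<one>\<^bsub>A i\<^esub>) i \<otimes>\<^bsub>A i\<^esub> x i = x i" "x i \<otimes>\<^bsub>A i\<^esub> (\<lambda>i\<in>I. \<one>\<^bsub>A i\<^esub>) i = x i"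
        using i c[OF i] by simp_all
    qed
  qed (use BP_closed in auto)
next
  fix x y z assume x: "x \<in> carrier BP" and y: "y \<in> carrier BP" and z: "z \<in> carrier BP"
  note c = BP_component[OF x] BP_component[OF y] BP_component[OF z]
  show "(x \<oplus>\<^bsub>BP\<^esub> y) \<otimes>\<^bsub>BP\<^esub> z = x \<otimes>\<^bsub>BP\<^esub> z \<oplus>\<^bsub>BP\<^esub> y \<otimes>\<^bsub>BP\<^esub> z"
    unfolding BP_ops
  proof (rule BP_pointwise_eq)
    fix i assume "tracial_star_algebra (A i)" and i: "i \<in> I"
    then interpret tracial_star_algebra "A i" by simp
    show "(\<lambda>i\<in>I. x i \<oplus>\<^bsub>A i\<^esub> y i) i \<otimes>\<^bsub>A i\<^esub> z i =
        (\<lambda>i\<in>I. x i \<otimes>\<^bsub>A i\<^esub> z i) i \<oplus>\<^bsub>A i\<^esub> (\<lambda>i\<in>I. y i \<otimes>\<^bsub>A i\<^esub> z i) i"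
      using i c[OF i] by (simp add: l_distr)
  qed
  show "z \<otimes>\<^bsub>BP\<^esub> (x \<oplus>\<^bsub>BP\<^esub> y) = z \<otimes>\<^bsub>BP\<^esub> x \<oplus>\<^bsub>BP\<^esub> z \<otimes>\<^bsub>BP\<^esub> y"
    unfolding BP_ops
  proof (rule BP_pointwise_eq)
    fix i assume "tracial_star_algebra (A i)" and i: "i \<in> I"
    then interpret tracial_star_algebra "A i" by simp
    show "z i \<otimes>\<^bsub>A i\<^esub> (\<lambda>i\<in>I. x i \<oplus>\<^bsub>A i\<^esub> y i) i =
        (\<lambda>i\<in>I. z i \<otimes>\<^bsub>A i\<^esub> x i) i \<oplus>\<^bsub>A i\<^esub> (\<lambda>i\<in>I. z i \<otimes>\<^bsub>A i\<^esub> y i) i"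
      using i c[OF i] by (simp add: r_distr)
  qed
qed

lemma module_BP: "Module.module complex_ring BP"
proof (rule moduleI)
  show "abelian_group BP" by (rule abelian_group_BP)
  fix a b x y assume x: "x \<in> carrier BP" and y: "y \<in> carrier BP"
  note c = BP_component[OF x] BP_component[OF y]
  show "(a \<oplus>\<^bsub>complex_ring\<^esub> b) \<odot>\<^bsub>BP\<^esub> x = a \<odot>\<^bsub>BP\<^esub> x \<oplus>\<^bsub>BP\<^esub> b \<odot>\<^bsub>BP\<^esub> x"
    unfolding BP_ops
    by (rule BP_pointwise_eq) (use c in \<open>simp add: tracial_star_algebra.scale_add_left\<close>)
  show "a \<odot>\<^bsub>BP\<^esub> (x \<oplus>\<^bsub>BP\<^esub> y) = a \<odot>\<^bsub>BP\<^esub> x \<oplus>\<^bsub>BP\<^esub> a \<odot>\<^bsub>BP\<^esub> y"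
    unfolding BP_ops
    by (rule BP_pointwise_eq) (use c in \<open>simp add: tracial_star_algebra.scale_add_right\<close>)
  show "(a \<otimes>\<^bsub>complex_ring\<^esub> b) \<odot>\<^bsub>BP\<^esub> x = a \<odot>\<^bsub>BP\<^esub> (b \<odot>\<^bsub>BP\<^esub> x)"
    unfolding BP_ops
    by (rule BP_pointwise_eq) (use c in \<open>simp add: tracial_star_algebra.scale_scale\<close>)
  show "\<one>\<^bsub>complex_ring\<^esub> \<odot>\<^bsub>BP\<^esub> x = x"
    unfolding BP_ops
    by (rule BP_restrict[OF x]) (use c tracial in \<open>simp add: tracial_star_algebra.scale_one\<close>)
qed (use BP_closed cring_complex_ring in auto)

lemma tracial_BP: "tracial_star_algebra BP"
proof (rule tracial_star_algebra.intro[OF module_BP ring_BP], unfold_locales)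
  fix x y c assume x: "x \<in> carrier BP" and y: "y \<in> carrier BP"
  note cx = BP_component[OF x] and cy = BP_component[OF y]
  note c = cx cy
  show "(c \<odot>\<^bsub>BP\<^esub> x) \<otimes>\<^bsub>BP\<^esub> y = c \<odot>\<^bsub>BP\<^esub> (x \<otimes>\<^bsub>BP\<^esub> y)"
    unfolding BP_ops
    by (rule BP_pointwise_eq) (use c in \<open>simp add: tracial_star_algebra.smult_mult_left\<close>)
  show "x \<otimes>\<^bsub>BP\<^esub> (c \<odot>\<^bsub>BP\<^esub> y) = c \<odot>\<^bsub>BP\<^esub> (x \<otimes>\<^bsub>BP\<^esub> y)"
    unfolding BP_ops
    by (rule BP_pointwise_eq) (use c in \<open>simp add: tracial_star_algebra.smult_mult_right\<close>)
  show "invol BP (x \<oplus>\<^bsub>BP\<^esub> y) = invol BP x \<oplus>\<^bsub>BP\<^esub> invol BP y"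
    unfolding BP_ops
    by (rule BP_pointwise_eq) (use c in \<open>simp add: tracial_star_algebra.invol_add\<close>)
  show "invol BP (x \<otimes>\<^bsub>BP\<^esub> y) = invol BP y \<otimes>\<^bsub>BP\<^esub> invol BP x"
    unfolding BP_ops
    by (rule BP_pointwise_eq) (use c in \<open>simp add: tracial_star_algebra.invol_mult\<close>)
  show "tau BP (x \<oplus>\<^bsub>BP\<^esub> y) = tau BP x + tau BP y"
    by (rule tau_BP_eqI[OF _ tendsto_add[OF tendsto_tau_BP[OF x] tendsto_tau_BP[OF y]]])
      (use c in \<open>simp add: BP_ops tracial_star_algebra.tau_add[OF tracial]\<close>)
  show "tau BP (x \<otimes>\<^bsub>BP\<^esub> y) = tau BP (y \<otimes>\<^bsub>BP\<^esub> x)"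
    by (rule tau_BP_eqI[OF _ tendsto_tau_BP[OF BP_closed(3)[OF y x]]])
      (use c in \<open>simp add: BP_ops tracial_star_algebra.tau_commute[OF tracial]\<close>)
next
  fix x c assume x: "x \<in> carrier BP"
  note cx = BP_component[OF x]
  show "invol BP x \<in> carrier BP" by (rule BP_closed(6)[OF x])
  show "invol BP (invol BP x) = x"
    unfolding BP_ops
    by (rule BP_restrict[OF x]) (use cx tracial in \<open>simp add: tracial_star_algebra.invol_invol\<close>)
  show "invol BP (c \<odot>\<^bsub>BP\<^esub> x) = cnj c \<odot>\<^bsub>BP\<^esub> invol BP x"
    unfolding BP_ops
    by (rule BP_pointwise_eq) (use cx in \<open>simp add: tracial_star_algebra.invol_smult\<close>)
  show "tau BP (c \<odot>\<^bsub>BP\<^esub> x) = c * tau BP x"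
    by (rule tau_BP_eqI[OF _ tendsto_mult[OF tendsto_const tendsto_tau_BP[OF x]]])
      (use cx in \<open>simp add: BP_ops tracial_star_algebra.tau_smult[OF tracial]\<close>)
  let ?y = "invol BP x \<otimes>\<^bsub>BP\<^esub> x"
  have y: "?y \<in> carrier BP" by (rule BP_closed(3)[OF BP_closed(6)[OF x] x])
  have sq: "tau (A i) (?y i) \<in> \<real>\<^sub>\<ge>\<^sub>0" if "i \<in> I" for i
    using tracial_star_algebra.tau_positive[OF tracial[OF that] cx[OF that]] that by (simp add: BP_ops)
  have "Re (tau BP ?y) \<ge> 0"
    by (rule tendsto_lowerbound[OF tendsto_Re[OF tendsto_tau_BP[OF y]] _ not_bot])
      (rule eventually_mono[OF eventually_I], use sq in \<open>auto simp: complex_nonneg_Reals_iff\<close>)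
  moreover have "Im (tau BP ?y) = 0"
  proof (rule tendsto_unique[OF not_bot tendsto_Im[OF tendsto_tau_BP[OF y]]])
    show "((\<lambda>i. Im (tau (A i) (?y i))) \<longlongrightarrow> 0) \<omega>"
      by (rule tendsto_eventually) (rule eventually_mono[OF eventually_I], use sq in \<open>auto simp: complex_nonneg_Reals_iff\<close>)
  qed
  ultimately show "tau BP ?y \<in> \<real>\<^sub>\<ge>\<^sub>0" by (simp add: complex_nonneg_Reals_iff)
next
  show "tau BP \<one>\<^bsub>BP\<^esub> = 1"
    by (rule tau_BP_eqI[OF _ tendsto_const]) (simp add: BP_ops tracial_star_algebra.tau_one[OF tracial])
qed

end

section \<open>Convergence of moments yields an embedding\<close>

context tracial_star_algebra
begin

lemma N_add_diff_le:
  assumes "p \<in> carrier A" "q \<in> carrier A" "a \<in> carrier A" "b \<in> carrier A"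
  shows "N (Suc k) ((p \<oplus> q) \<ominus> (a \<oplus> b)) \<le> N (Suc k) (p \<ominus> a) + N (Suc k) (q \<ominus> b)"
proof -
  have "(p \<oplus> q) \<ominus> (a \<oplus> b) = (p \<ominus> a) \<oplus> (q \<ominus> b)"
    using assms by (simp add: minus_eq minus_add a_ac)
  then show ?thesis using N_triangle[of "p \<ominus> a" "q \<ominus> b" k] assms by simp
qed

lemma N_scale_diff:
  assumes "p \<in> carrier A" "a \<in> carrier A"
  shows "N (Suc k) (c \<odot> p \<ominus> c \<odot> a) = cmod c * N (Suc k) (p \<ominus> a)"
proof -
  have "c \<odot> p \<ominus> c \<odot> a = c \<odot> (p \<ominus> a)"
    using assms by (simp add: minus_eq_scale scale_add_right scale_scale mult.commute)
  then show ?thesis using N_scale[of "p \<ominus> a" k c] assms by simp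
qed

lemma N_invol_diff:
  assumes "p \<in> carrier A" "a \<in> carrier A"
  shows "N (Suc k) (invol A p \<ominus> invol A a) = N (Suc k) (p \<ominus> a)"
  using N_invol[of "p \<ominus> a" k] assms by (simp add: invol_minus)

lemma N_le_N_diff:
  assumes "p \<in> carrier A" "a \<in> carrier A"
  shows "N (Suc k) p \<le> N (Suc k) a + N (Suc k) (p \<ominus> a)"
  using N_triangle[of "p \<ominus> a" a k] assms by (simp add: minus_eq a_assoc l_neg)

lemma cmod_tau_diff_le:
  assumes "p \<in> carrier A" "a \<in> carrier A"
  shows "cmod (tau A p - tau A a) \<le> N (Suc k) (p \<ominus> a)"
  using cmod_tau_le[of "p \<ominus> a" k] assms by (simp add: tau_minus)

lemma minus_self: "p \<in> carrier A \<Longrightarrow> p \<ominus> p = \<zero>"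
  by (simp add: minus_eq r_neg)

end

lemma tendsto_nclin:
  assumes "\<And>w. ((\<lambda>n. f n w) \<longlongrightarrow> g w) F"
  shows "((\<lambda>n. nclin (f n) P) \<longlongrightarrow> nclin g P) F"
proof (induction P)
  case (Cons p P)
  then show ?case
    by (cases p) (auto intro!: tendsto_intros assms)
qed simp

text \<open>In \<open>dense\<close> one norm at a time suffices, since the dyadic norms grow with
  \<open>k\<close>. The assumption \<open>tail\<close> turns limits of sequences into limits along
  \<omega>, and is how nonprincipality enters.\<close>

locale moment_family =
  tracial_family "{1..}" B \<omega> + T: trace_reduced_algebra A
  for A :: "('a, 'm) tracial_algebra_scheme" and B :: "nat \<Rightarrow> ('b, 'n) tracial_algebra_scheme"
    and \<omega> :: "nat filter" +
  fixes s :: "nat \<Rightarrow> 'a" and x :: "nat \<Rightarrow> nat \<Rightarrow> 'b"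
  assumes s: "s i \<in> carrier A" "invol A (s i) = s i"
    and x: "1 \<le> n \<Longrightarrow> x n i \<in> carrier (B n)" "1 \<le> n \<Longrightarrow> invol (B n) (x n i) = x n i"
    and moments: "(\<lambda>n. tau (B n) (foldr (mult (B n)) (map (x n) w) (one (B n))))
      \<longlonglongrightarrow> tau A (foldr (mult A) (map s w) (one A))"
    and dense: "a \<in> carrier A \<Longrightarrow> 0 < e \<Longrightarrow> \<exists>P. T.N (Suc k) (T.nceval s P \<ominus>\<^bsub>A\<^esub> a) < e"
    and tail: "\<omega> \<le> sequentially"
begin

abbreviation pA :: "ncpoly \<Rightarrow> 'a" where "pA \<equiv> T.nceval s"

abbreviation pB :: "nat \<Rightarrow> ncpoly \<Rightarrow> 'b" where "pB n \<equiv> tracial_star_algebra.nceval (B n) (x n)"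

lemma pA_closed [simp]: "pA P \<in> carrier A"
  by (rule T.nceval_closed[OF s])

lemma trB: "1 \<le> n \<Longrightarrow> tracial_star_algebra (B n)"
  by (rule tracial) simp

lemma pB_closed: "1 \<le> n \<Longrightarrow> pB n P \<in> carrier (B n)"
  by (rule tracial_star_algebra.nceval_closed[OF trB x])

lemma BP_at:
  assumes "1 \<le> n"
  shows "(z \<oplus>\<^bsub>BP\<^esub> y) n = z n \<oplus>\<^bsub>B n\<^esub> y n" "(z \<otimes>\<^bsub>BP\<^esub> y) n = z n \<otimes>\<^bsub>B n\<^esub> y n"
    "(c \<odot>\<^bsub>BP\<^esub> z) n = c \<odot>\<^bsub>B n\<^esub> z n" "(invol BP z) n = invol (B n) (z n)" "\<one>\<^bsub>BP\<^esub> n = \<one>\<^bsub>B n\<^esub>"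
  unfolding BP_ops using assms by (simp_all del: One_nat_def)

lemma ge1: "\<forall>\<^sub>F n in \<omega>. 1 \<le> n"
  using eventually_I by simp

lemma tendsto_tau_pB: "(\<lambda>n. tau (B n) (pB n P)) \<longlonglongrightarrow> tau A (pA P)"
proof -
  have "(\<lambda>n. nclin (\<lambda>w. tau (B n) (foldr (mult (B n)) (map (x n) w) (one (B n)))) P)
     \<longlonglongrightarrow> nclin (\<lambda>w. tau A (foldr (mult A) (map s w) (one A))) P"
    by (rule tendsto_nclin[OF moments])
  then show ?thesis
    unfolding T.tau_nceval[OF s]
    by (rule Lim_transform_eventually)
      (rule eventually_sequentiallyI[of 1], simp add: tracial_star_algebra.tau_nceval[OF trB x])
qed

lemma tendsto_N_pB: "(\<lambda>n. NN n k (pB n P)) \<longlonglongrightarrow> T.N (Suc k) (pA P)"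
proof -
  have "(\<lambda>n. root (2 ^ Suc k) (Re (nclin (\<lambda>w. tau (B n) (foldr (mult (B n)) (map (x n) w) (one (B n))))
      (ncpow (ncmult (ncadj P) P) (2 ^ k))))) \<longlonglongrightarrow> T.N (Suc k) (pA P)"
    unfolding T.N_nceval[OF s] by (intro tendsto_intros tendsto_nclin[OF moments])
  then show ?thesis
    by (rule Lim_transform_eventually)
      (rule eventually_sequentiallyI[of 1], simp add: tracial_star_algebra.N_nceval[OF trB x])
qed

definition near :: "nat \<Rightarrow> real \<Rightarrow> 'a \<Rightarrow> (nat \<Rightarrow> 'b) \<Rightarrow> ncpoly \<Rightarrow> bool"
  where "near k e a z P \<longleftrightarrow> T.N (Suc k) (pA P \<ominus>\<^bsub>A\<^esub> a) < e \<and>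
    (\<forall>\<^sub>F n in \<omega>. NN n k (pB n P \<ominus>\<^bsub>B n\<^esub> z n) < e)"

text \<open>The graph of the embedding as a relation: the same polynomials approximate both
  \<open>a\<close> and \<open>z\<close>. Compatibility with the operations is thereby shown before
  \<open>z\<close> is chosen, which is unique only modulo the null ideal.\<close>

definition approx :: "'a \<Rightarrow> (nat \<Rightarrow> 'b) \<Rightarrow> bool"
  where "approx a z \<longleftrightarrow> a \<in> carrier A \<and> z \<in> carrier BP \<and> (\<forall>k. \<forall>e>0. \<exists>P. near k e a z P)"

lemma approxD:
  "approx a z \<Longrightarrow> a \<in> carrier A" "approx a z \<Longrightarrow> z \<in> carrier BP"
  "approx a z \<Longrightarrow> 1 \<le> n \<Longrightarrow> z n \<in> carrier (B n)"
  by (auto simp: approx_def intro: BP_component)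

lemma approx_add:
  assumes az: "approx a z" and bz: "approx b y"
  shows "approx (a \<oplus>\<^bsub>A\<^esub> b) (z \<oplus>\<^bsub>BP\<^esub> y)"
  unfolding approx_def
proof (intro conjI allI impI)
  fix k and e :: real assume e: "e > 0"
  then obtain P Q where P: "near k (e / 2) a z P" and Q: "near k (e / 2) b y Q"
    using az bz unfolding approx_def by (meson half_gt_zero)
  have "T.N (Suc k) (pA (P @ Q) \<ominus>\<^bsub>A\<^esub> (a \<oplus>\<^bsub>A\<^esub> b)) < e"
    using T.N_add_diff_le[OF pA_closed[of P] pA_closed[of Q] approxD(1)[OF az] approxD(1)[OF bz], of k] P Q
    unfolding near_def T.nceval_append[OF s] by linarith
  moreover have "\<forall>\<^sub>F n in \<omega>. NN n k (pB n P \<ominus>\<^bsub>B n\<^esub> z n) < e / 2 \<and> NN n k (pB n Q \<ominus>\<^bsub>B n\<^esub> y n) < e / 2 \<and> 1 \<le> n"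
    using P Q ge1 unfolding near_def by (auto intro: eventually_conj)
  then have "\<forall>\<^sub>F n in \<omega>. NN n k (pB n (P @ Q) \<ominus>\<^bsub>B n\<^esub> (z \<oplus>\<^bsub>BP\<^esub> y) n) < e"
  proof (rule eventually_mono)
    fix n assume h: "NN n k (pB n P \<ominus>\<^bsub>B n\<^esub> z n) < e / 2 \<and> NN n k (pB n Q \<ominus>\<^bsub>B n\<^esub> y n) < e / 2 \<and> 1 \<le> n"
    then have n: "1 \<le> n" by simp
    show "NN n k (pB n (P @ Q) \<ominus>\<^bsub>B n\<^esub> (z \<oplus>\<^bsub>BP\<^esub> y) n) < e"
      using tracial_star_algebra.N_add_diff_le[OF trB[OF n] pB_closed[OF n] pB_closed[OF n]
          approxD(3)[OF az n] approxD(3)[OF bz n], of k P Q] h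
      unfolding BP_at[OF n] tracial_star_algebra.nceval_append[OF trB[OF n] x[OF n]] by linarith
  qed
  ultimately show "\<exists>P. near k e (a \<oplus>\<^bsub>A\<^esub> b) (z \<oplus>\<^bsub>BP\<^esub> y) P" unfolding near_def by blast
qed (use approxD[OF az] approxD[OF bz] BP_closed(4) in auto)

lemma approx_scale:
  assumes az: "approx a z"
  shows "approx (c \<odot>\<^bsub>A\<^esub> a) (c \<odot>\<^bsub>BP\<^esub> z)"
  unfolding approx_def
proof (intro conjI allI impI)
  fix k and e :: real assume e: "e > 0"
  define \<delta> where "\<delta> = e / (cmod c + 1)"
  have c1: "cmod c + 1 > 0" using norm_ge_zero[of c] by linarith
  have \<delta>: "\<delta> > 0" using e c1 by (simp add: \<delta>_def)
  have le: "cmod c * t < e" if "t < \<delta>" "0 \<le> t" for t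
  proof -
    have "cmod c * t \<le> (cmod c + 1) * t" using that by (simp add: algebra_simps)
    also have "\<dots> < (cmod c + 1) * \<delta>" using that c1 by simp
    also have "\<dots> = e" using c1 by (simp add: \<delta>_def)
    finally show ?thesis .
  qed
  obtain P where P: "near k \<delta> a z P" using az \<delta> unfolding approx_def by blast
  have "T.N (Suc k) (pA (ncscale c P) \<ominus>\<^bsub>A\<^esub> c \<odot>\<^bsub>A\<^esub> a) < e"
    unfolding T.nceval_scale[OF s] T.N_scale_diff[OF pA_closed approxD(1)[OF az]]
    using P approxD(1)[OF az] by (intro le T.N_nonneg) (auto simp: near_def)
  moreover have "\<forall>\<^sub>F n in \<omega>. NN n k (pB n P \<ominus>\<^bsub>B n\<^esub> z n) < \<delta> \<and> 1 \<le> n"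
    using P ge1 unfolding near_def by (auto intro: eventually_conj)
  then have "\<forall>\<^sub>F n in \<omega>. NN n k (pB n (ncscale c P) \<ominus>\<^bsub>B n\<^esub> (c \<odot>\<^bsub>BP\<^esub> z) n) < e"
  proof (rule eventually_mono)
    fix n assume h: "NN n k (pB n P \<ominus>\<^bsub>B n\<^esub> z n) < \<delta> \<and> 1 \<le> n"
    then have n: "1 \<le> n" by simp
    interpret Bn: tracial_star_algebra "B n" by (rule trB[OF n])
    have "cmod c * NN n k (pB n P \<ominus>\<^bsub>B n\<^esub> z n) < e"
      using h pB_closed[OF n, of P] approxD(3)[OF az n] by (intro le Bn.N_nonneg) auto
    then show "NN n k (pB n (ncscale c P) \<ominus>\<^bsub>B n\<^esub> (c \<odot>\<^bsub>BP\<^esub> z) n) < e"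
      unfolding BP_at[OF n] Bn.nceval_scale[OF x[OF n]]
        Bn.N_scale_diff[OF pB_closed[OF n] approxD(3)[OF az n]] .
  qed
  ultimately show "\<exists>P. near k e (c \<odot>\<^bsub>A\<^esub> a) (c \<odot>\<^bsub>BP\<^esub> z) P" unfolding near_def by blast
qed (use approxD[OF az] BP_closed(5) in auto)

lemma approx_invol:
  assumes az: "approx a z"
  shows "approx (invol A a) (invol BP z)"
  unfolding approx_def
proof (intro conjI allI impI)
  fix k and e :: real assume e: "e > 0"
  obtain P where P: "near k e a z P" using az e unfolding approx_def by blast
  have "T.N (Suc k) (pA (ncadj P) \<ominus>\<^bsub>A\<^esub> invol A a) < e"
    using P unfolding T.nceval_adj[OF s] T.N_invol_diff[OF pA_closed approxD(1)[OF az]] near_def by simp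
  moreover have "\<forall>\<^sub>F n in \<omega>. NN n k (pB n P \<ominus>\<^bsub>B n\<^esub> z n) < e \<and> 1 \<le> n"
    using P ge1 unfolding near_def by (auto intro: eventually_conj)
  then have "\<forall>\<^sub>F n in \<omega>. NN n k (pB n (ncadj P) \<ominus>\<^bsub>B n\<^esub> (invol BP z) n) < e"
  proof (rule eventually_mono)
    fix n assume h: "NN n k (pB n P \<ominus>\<^bsub>B n\<^esub> z n) < e \<and> 1 \<le> n"
    then have n: "1 \<le> n" by simp
    interpret Bn: tracial_star_algebra "B n" by (rule trB[OF n])
    show "NN n k (pB n (ncadj P) \<ominus>\<^bsub>B n\<^esub> (invol BP z) n) < e"
      using h unfolding BP_at[OF n] Bn.nceval_adj[OF x[OF n]]
        Bn.N_invol_diff[OF pB_closed[OF n] approxD(3)[OF az n]] by blast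
  qed
  ultimately show "\<exists>P. near k e (invol A a) (invol BP z) P" unfolding near_def by blast
qed (use approxD[OF az] BP_closed(6) in auto)

lemma approx_mult:
  assumes az: "approx a z" and bz: "approx b y"
  shows "approx (a \<otimes>\<^bsub>A\<^esub> b) (z \<otimes>\<^bsub>BP\<^esub> y)"
  unfolding approx_def
proof (intro conjI allI impI)
  fix k and e :: real assume e: "e > 0"
  obtain C1 where C1: "\<And>n. 1 \<le> n \<Longrightarrow> NN n (Suc k) (z n) \<le> C1" using BP_bounded[OF approxD(2)[OF az]] by force
  obtain C2 where C2: "\<And>n. 1 \<le> n \<Longrightarrow> NN n (Suc k) (y n) \<le> C2" using BP_bounded[OF approxD(2)[OF bz]] by force
  define C where "C = Max {0, C1, C2, T.N (Suc (Suc k)) a, T.N (Suc (Suc k)) b}"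
  have C: "0 \<le> C" "C1 \<le> C" "C2 \<le> C" "T.N (Suc (Suc k)) a \<le> C" "T.N (Suc (Suc k)) b \<le> C"
    unfolding C_def by (auto intro!: Max_ge)
  \<comment> \<open>The minimum with 1 is required by \<open>N_mult_diff_le\<close>; 2C + 2 in place
    of 2C + 1 makes the final bound strict.\<close>
  define \<delta> where "\<delta> = min 1 (e / (2 * C + 2))"
  have \<delta>: "\<delta> > 0" "\<delta> \<le> 1" using e C by (auto simp: \<delta>_def)
  have "\<delta> * (2 * C + 1) < \<delta> * (2 * C + 2)" using \<delta> by simp
  also have "\<dots> \<le> e / (2 * C + 2) * (2 * C + 2)" using C by (intro mult_right_mono) (auto simp: \<delta>_def)
  also have "\<dots> = e" using C by simp
  finally have \<delta>e: "\<delta> * (2 * C + 1) < e" .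
  obtain P Q where P: "near (Suc k) \<delta> a z P" and Q: "near (Suc k) \<delta> b y Q"
    using az bz \<delta> unfolding approx_def by meson
  have "T.N (Suc k) (pA (ncmult P Q) \<ominus>\<^bsub>A\<^esub> a \<otimes>\<^bsub>A\<^esub> b) \<le> \<delta> * (2 * C + 1)"
    unfolding T.nceval_mult[OF s]
    by (rule T.N_mult_diff_le) (use P Q \<delta> C approxD(1)[OF az] approxD(1)[OF bz] in \<open>auto simp: near_def\<close>)
  then have "T.N (Suc k) (pA (ncmult P Q) \<ominus>\<^bsub>A\<^esub> a \<otimes>\<^bsub>A\<^esub> b) < e" using \<delta>e by linarith
  moreover have "\<forall>\<^sub>F n in \<omega>. NN n (Suc k) (pB n P \<ominus>\<^bsub>B n\<^esub> z n) < \<delta> \<and> NN n (Suc k) (pB n Q \<ominus>\<^bsub>B n\<^esub> y n) < \<delta> \<and> 1 \<le> n"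
    using P Q ge1 unfolding near_def by (auto intro: eventually_conj)
  then have "\<forall>\<^sub>F n in \<omega>. NN n k (pB n (ncmult P Q) \<ominus>\<^bsub>B n\<^esub> (z \<otimes>\<^bsub>BP\<^esub> y) n) < e"
  proof (rule eventually_mono)
    fix n assume h: "NN n (Suc k) (pB n P \<ominus>\<^bsub>B n\<^esub> z n) < \<delta> \<and> NN n (Suc k) (pB n Q \<ominus>\<^bsub>B n\<^esub> y n) < \<delta> \<and> 1 \<le> n"
    then have n: "1 \<le> n" by simp
    interpret Bn: tracial_star_algebra "B n" by (rule trB[OF n])
    have "NN n k (pB n P \<otimes>\<^bsub>B n\<^esub> pB n Q \<ominus>\<^bsub>B n\<^esub> z n \<otimes>\<^bsub>B n\<^esub> y n) \<le> \<delta> * (2 * C + 1)"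
      by (rule Bn.N_mult_diff_le)
        (use h \<delta> C(2,3) C1[OF n] C2[OF n] pB_closed[OF n] approxD(3)[OF az n] approxD(3)[OF bz n] in auto)
    then show "NN n k (pB n (ncmult P Q) \<ominus>\<^bsub>B n\<^esub> (z \<otimes>\<^bsub>BP\<^esub> y) n) < e"
      using \<delta>e unfolding BP_at[OF n] Bn.nceval_mult[OF x[OF n]] by linarith
  qed
  ultimately show "\<exists>P. near k e (a \<otimes>\<^bsub>A\<^esub> b) (z \<otimes>\<^bsub>BP\<^esub> y) P" unfolding near_def by blast
qed (use approxD[OF az] approxD[OF bz] BP_closed(3) in auto)

lemma approx_one: "approx \<one>\<^bsub>A\<^esub> \<one>\<^bsub>BP\<^esub>"
  unfolding approx_def
proof (intro conjI allI impI)
  fix k and e :: real assume e: "e > 0"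
  have "NN n k (pB n [(1, [])] \<ominus>\<^bsub>B n\<^esub> \<one>\<^bsub>BP\<^esub> n) < e" if n: "1 \<le> n" for n
  proof -
    interpret Bn: tracial_star_algebra "B n" by (rule trB[OF n])
    show ?thesis unfolding BP_at[OF n] Bn.nceval_one[OF x[OF n]] using e by (simp add: Bn.minus_self Bn.N_zero)
  qed
  then have "near k e \<one>\<^bsub>A\<^esub> \<one>\<^bsub>BP\<^esub> [(1, [])]"
    unfolding near_def using e ge1
    by (auto simp: T.nceval_one[OF s] T.minus_self T.N_zero elim: eventually_mono)
  then show "\<exists>P. near k e \<one>\<^bsub>A\<^esub> \<one>\<^bsub>BP\<^esub> P" ..
qed (use BP_closed(1) in auto)

lemma approx_tau:
  assumes az: "approx a z"
  shows "tau BP z = tau A a"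
proof (rule ccontr)
  assume ne: "tau BP z \<noteq> tau A a"
  \<comment> \<open>Four errors below \<open>e\<close> contradict a distance of 4e. They separate
    the traces of \<open>a\<close>, \<open>pA P\<close>, \<open>pB n P\<close>, \<open>z n\<close>
    and the limit along \<omega>.\<close>
  define e where "e = cmod (tau BP z - tau A a) / 4"
  have e: "e > 0" using ne by (simp add: e_def)
  obtain P where P: "near 0 e a z P" using az e unfolding approx_def by blast
  have 1: "cmod (tau A (pA P) - tau A a) < e"
    using T.cmod_tau_diff_le[OF pA_closed[of P] approxD(1)[OF az], of 0] P unfolding near_def by linarith
  have ev1: "\<forall>\<^sub>F n in \<omega>. cmod (tau (B n) (pB n P) - tau A (pA P)) < e"
    using tendsto_tau_pB[THEN filterlim_mono[OF _ order_refl tail], of P] e by (simp add: tendsto_iff dist_norm)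
  have ev2: "\<forall>\<^sub>F n in \<omega>. cmod (tau (B n) (z n) - tau BP z) < e"
    using tendsto_tau_BP[OF approxD(2)[OF az]] e by (simp add: tendsto_iff dist_norm)
  have "\<forall>\<^sub>F n in \<omega>. NN n 0 (pB n P \<ominus>\<^bsub>B n\<^esub> z n) < e" using P unfolding near_def by simp
  then have "\<forall>\<^sub>F n in \<omega>. False"
    using ev1 ev2 ge1
  proof eventually_elim
    case (elim n)
    have "cmod (tau (B n) (pB n P) - tau (B n) (z n)) < e"
      using tracial_star_algebra.cmod_tau_diff_le[OF trB[OF elim(4)] pB_closed[OF elim(4), of P] approxD(3)[OF az elim(4)], where k = 0]
        elim(1) by linarith
    then have "cmod (tau BP z - tau A a) < 4 * e"
      using elim 1 by norm
    then show ?case by (simp add: e_def)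
  qed
  then show False using not_bot by (simp add: trivial_limit_def)
qed

text \<open>The difference approximates zero, so its square has trace 0 by
  \<open>approx_tau\<close>. The proof of \<open>approx_inj\<close> runs the same argument
  backwards, using that \<open>A\<close> is trace-reduced.\<close>

lemma approx_unique:
  assumes "approx a z" "approx a y"
  shows "z \<ominus>\<^bsub>BP\<^esub> y \<in> null_ideal BP"
proof -
  interpret R: tracial_star_algebra BP by (rule tracial_BP)
  have a: "a \<in> carrier A" by (rule approxD[OF assms(1)])
  have d: "approx (a \<oplus>\<^bsub>A\<^esub> (-1) \<odot>\<^bsub>A\<^esub> a) (z \<oplus>\<^bsub>BP\<^esub> (-1) \<odot>\<^bsub>BP\<^esub> y)"
    by (intro approx_add approx_scale assms)
  have za: "a \<oplus>\<^bsub>A\<^esub> (-1) \<odot>\<^bsub>A\<^esub> a = \<zero>\<^bsub>A\<^esub>" using a T.minus_eq_scale[OF a a] T.minus_self[OF a] by simp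
  have e: "z \<ominus>\<^bsub>BP\<^esub> y = z \<oplus>\<^bsub>BP\<^esub> (-1) \<odot>\<^bsub>BP\<^esub> y"
    by (rule R.minus_eq_scale[OF approxD(2)[OF assms(1)] approxD(2)[OF assms(2)]])
  have "approx \<zero>\<^bsub>A\<^esub> (z \<ominus>\<^bsub>BP\<^esub> y)" using d unfolding za e .
  from approx_tau[OF approx_mult[OF approx_invol[OF this] this]]
  have "tau BP (invol BP (z \<ominus>\<^bsub>BP\<^esub> y) \<otimes>\<^bsub>BP\<^esub> (z \<ominus>\<^bsub>BP\<^esub> y)) = 0" by simp
  then show ?thesis unfolding null_ideal_def using approxD(2)[OF \<open>approx \<zero>\<^bsub>A\<^esub> (z \<ominus>\<^bsub>BP\<^esub> y)\<close>] by simp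
qed

lemma approx_inj:
  assumes "approx a z" "approx b y" "z \<ominus>\<^bsub>BP\<^esub> y \<in> null_ideal BP"
  shows "a = b"
proof -
  interpret R: tracial_star_algebra BP by (rule tracial_BP)
  have ab: "a \<in> carrier A" "b \<in> carrier A" using approxD assms by auto
  have "approx (a \<oplus>\<^bsub>A\<^esub> (-1) \<odot>\<^bsub>A\<^esub> b) (z \<oplus>\<^bsub>BP\<^esub> (-1) \<odot>\<^bsub>BP\<^esub> y)"
    by (intro approx_add approx_scale assms)
  then have d: "approx (a \<ominus>\<^bsub>A\<^esub> b) (z \<ominus>\<^bsub>BP\<^esub> y)"
    using T.minus_eq_scale[OF ab] R.minus_eq_scale[OF approxD(2)[OF assms(1)] approxD(2)[OF assms(2)]] by simp
  have "tau A (invol A (a \<ominus>\<^bsub>A\<^esub> b) \<otimes>\<^bsub>A\<^esub> (a \<ominus>\<^bsub>A\<^esub> b)) = 0"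
    using approx_tau[OF approx_mult[OF approx_invol[OF d] d]] assms(3) by (simp add: null_ideal_def)
  then have "a \<ominus>\<^bsub>A\<^esub> b = \<zero>\<^bsub>A\<^esub>" using T.trace_reduced[of "a \<ominus>\<^bsub>A\<^esub> b"] ab by simp
  then show ?thesis using ab T.r_right_minus_eq by simp
qed

end

lemma eventually_bounded_imp_bounded:
  fixes f :: "nat \<Rightarrow> real"
  assumes "\<forall>n\<ge>m. f n \<le> C"
  shows "\<exists>C. \<forall>n. f n \<le> C"
proof (intro exI allI)
  fix n
  show "f n \<le> max C (Max (f ` {..m}))"
  proof (cases "n \<le> m")
    case True
    then have "f n \<le> Max (f ` {..m})" by (intro Max_ge) auto
    then show ?thesis by simp
  next
    case False
    then show ?thesis using assms by (simp add: le_max_iff_disj)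
  qed
qed

context moment_family
begin

text \<open>Diagonal argument: at stage \<open>n\<close> evaluate the latest approximant whose distances to the
  earlier ones are already as small as in the limit.\<close>

lemma approx_exists:
  assumes a: "a \<in> carrier A"
  shows "\<exists>z. approx a z"
proof -
  have "\<exists>P. T.N (Suc j) (pA P \<ominus>\<^bsub>A\<^esub> a) < (1 / 2) ^ j" for j
    by (rule dense[OF a]) simp
  then obtain P where P: "\<And>j. T.N (Suc j) (pA (P j) \<ominus>\<^bsub>A\<^esub> a) < (1 / 2) ^ j" by metis
  have Pk: "T.N (Suc i) (pA (P j) \<ominus>\<^bsub>A\<^esub> a) < (1 / 2) ^ j" if "i \<le> j" for i j
    using T.N_mono[of "pA (P j) \<ominus>\<^bsub>A\<^esub> a" i j] P[of j] a that by simp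
  \<comment> \<open>In \<open>A\<close> the corresponding distance is less than 2 (1/2)^i. The
    threshold lies strictly above this limit value, so \<open>good j n\<close> holds for all large
    \<open>n\<close>.\<close>
  define good where "good = (\<lambda>j n. \<forall>i\<le>j. NN n i (pB n (ncsub (P i) (P j))) < 3 * (1 / 2) ^ i)"
  have D: "T.N (Suc i) (pA (ncsub (P i) (P j))) < 3 * (1 / 2) ^ i" if ij: "i \<le> j" for i j
  proof -
    have "T.N (Suc i) (pA (P i) \<ominus>\<^bsub>A\<^esub> pA (P j)) \<le> T.N (Suc i) (pA (P i) \<ominus>\<^bsub>A\<^esub> a) + T.N (Suc i) (a \<ominus>\<^bsub>A\<^esub> pA (P j))"
      by (rule T.N_triangle_minus) (simp_all add: a)
    also have "\<dots> < (1 / 2) ^ i + (1 / 2) ^ j"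
      using Pk[of i i] Pk[OF ij] T.N_minus_commute[OF a pA_closed[of "P j"]] by simp
    also have "(1 / 2 :: real) ^ j \<le> (1 / 2) ^ i" using ij by (intro power_decreasing) auto
    also have "(1 / 2 :: real) ^ i + (1 / 2) ^ i \<le> 3 * (1 / 2) ^ i" by simp
    finally show ?thesis unfolding T.nceval_sub[OF s] by simp
  qed
  have "\<forall>\<^sub>F n in sequentially. good j n" for j
  proof -
    have "\<forall>\<^sub>F n in sequentially. \<forall>i\<in>{..j}. NN n i (pB n (ncsub (P i) (P j))) < 3 * (1 / 2) ^ i"
      by (rule eventually_ball_finite) (auto intro!: order_tendstoD(2)[OF tendsto_N_pB] D)
    then show ?thesis unfolding good_def Ball_def atMost_iff .
  qed
  then obtain M where M: "\<And>j n. M j \<le> n \<Longrightarrow> good j n" unfolding eventually_sequentially by metis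
  \<comment> \<open>Stage 0 compares \<open>P 0\<close> with itself, so the maximum defining
    \<open>J\<close> is over a nonempty set for every n \<ge> 1.\<close>
  have good0: "good 0 n" if n: "1 \<le> n" for n
  proof -
    interpret Bn: tracial_star_algebra "B n" by (rule trB[OF n])
    show ?thesis
      by (simp add: good_def Bn.nceval_sub[OF x[OF n]] Bn.minus_self[OF pB_closed[OF n]] Bn.N_zero)
  qed
  define J where "J = (\<lambda>n. Max {j. j \<le> n \<and> good j n})"
  have fin: "finite {j. j \<le> n \<and> good j n}" for n by simp
  have goodJ: "good (J n) n" if "1 \<le> n" for n
  proof -
    have "J n \<in> {j. j \<le> n \<and> good j n}"
      unfolding J_def using good0[OF that] by (intro Max_in[OF fin]) auto
    then show ?thesis by simp
  qed
  \<comment> \<open>So \<open>J n\<close> tends to infinity, and each fixed \<open>P i\<close> is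
    eventually among the approximants that \<open>goodJ\<close> compares with
    \<open>P (J n)\<close>.\<close>
  have Jge: "i \<le> J n" if "max i (M i) \<le> n" for i n
    unfolding J_def using that M by (intro Max_ge[OF fin]) auto
  define z where "z = (\<lambda>n\<in>{1..}. pB n (P (J n)))"
  have zn: "z n = pB n (P (J n))" if "1 \<le> n" for n
    using that unfolding z_def by (simp del: One_nat_def)
  have close: "NN n i (pB n (P i) \<ominus>\<^bsub>B n\<^esub> z n) < 3 * (1 / 2) ^ i" if n: "1 \<le> n" and m: "max i (M i) \<le> n" for n i
  proof -
    interpret Bn: tracial_star_algebra "B n" by (rule trB[OF n])
    have "NN n i (pB n (ncsub (P i) (P (J n)))) < 3 * (1 / 2) ^ i"
      using goodJ[OF n] Jge[OF m] unfolding good_def by blast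
    then show ?thesis unfolding zn[OF n] Bn.nceval_sub[OF x[OF n]] .
  qed
  have zc: "z \<in> carrier BP"
    unfolding z_def
  proof (rule BP_closedI)
    show "pB n (P (J n)) \<in> carrier (B n)" if "n \<in> {1..}" for n
      using that by (intro pB_closed) simp
    fix k
    have "\<forall>\<^sub>F n in sequentially. NN n k (pB n (P k)) < T.N (Suc k) (pA (P k)) + 1"
      by (rule order_tendstoD(2)[OF tendsto_N_pB]) simp
    then obtain m where m: "\<And>n. m \<le> n \<Longrightarrow> NN n k (pB n (P k)) < T.N (Suc k) (pA (P k)) + 1"
      unfolding eventually_sequentially by blast
    have "\<forall>n\<ge>max (max m 1) (max k (M k)). NN n k (pB n (P (J n))) \<le> T.N (Suc k) (pA (P k)) + 1 + 3 * (1 / 2) ^ k"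
    proof (intro allI impI)
      fix n assume n: "max (max m 1) (max k (M k)) \<le> n"
      then have n1: "1 \<le> n" and nm: "m \<le> n" and nk: "max k (M k) \<le> n" by auto
      interpret Bn: tracial_star_algebra "B n" by (rule trB[OF n1])
      have zcn: "z n \<in> carrier (B n)" unfolding zn[OF n1] by (rule pB_closed[OF n1])
      have "NN n k (z n) \<le> NN n k (pB n (P k)) + NN n k (z n \<ominus>\<^bsub>B n\<^esub> pB n (P k))"
        by (rule Bn.N_le_N_diff[OF zcn pB_closed[OF n1]])
      then show "NN n k (pB n (P (J n))) \<le> T.N (Suc k) (pA (P k)) + 1 + 3 * (1 / 2) ^ k"
        using m[OF nm] close[OF n1 nk] Bn.N_minus_commute[OF zcn pB_closed[OF n1, of "P k"], of k]
        unfolding zn[OF n1] by linarith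
    qed
    from eventually_bounded_imp_bounded[OF this]
    show "\<exists>C. \<forall>n\<in>{1..}. NN n k (pB n (P (J n))) \<le> C" by blast
  qed
  have "\<exists>Q. near k e a z Q" if e: "e > 0" for k and e :: real
  proof -
    obtain i0 where i0: "(1 / 2 :: real) ^ i0 < e / 3" using real_arch_pow_inv[of "e / 3" "1 / 2"] e by auto
    define i where "i = max i0 k"
    have "(1 / 2 :: real) ^ i \<le> (1 / 2) ^ i0" unfolding i_def by (intro power_decreasing) auto
    then have i: "3 * (1 / 2 :: real) ^ i < e" using i0 by linarith
    have ik: "k \<le> i" by (simp add: i_def)
    have "0 \<le> (1 / 2 :: real) ^ i" by simp
    moreover have "T.N (Suc k) (pA (P i) \<ominus>\<^bsub>A\<^esub> a) \<le> T.N (Suc i) (pA (P i) \<ominus>\<^bsub>A\<^esub> a)"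
      using a ik by (intro T.N_mono) simp_all
    ultimately have "T.N (Suc k) (pA (P i) \<ominus>\<^bsub>A\<^esub> a) < e" using Pk[OF order_refl, of i] i by linarith
    moreover have "\<forall>\<^sub>F n in sequentially. NN n k (pB n (P i) \<ominus>\<^bsub>B n\<^esub> z n) < e"
    proof (rule eventually_sequentiallyI[of "max 1 (max i (M i))"])
      fix n assume n: "max 1 (max i (M i)) \<le> n"
      then have n1: "1 \<le> n" and ni: "max i (M i) \<le> n" by auto
      interpret Bn: tracial_star_algebra "B n" by (rule trB[OF n1])
      have "NN n k (pB n (P i) \<ominus>\<^bsub>B n\<^esub> z n) \<le> NN n i (pB n (P i) \<ominus>\<^bsub>B n\<^esub> z n)"
        by (rule Bn.N_mono[OF _ ik]) (intro Bn.minus_closed pB_closed[OF n1] BP_component[OF zc], use n1 in simp)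
      then show "NN n k (pB n (P i) \<ominus>\<^bsub>B n\<^esub> z n) < e" using close[OF n1 ni] i by linarith
    qed
    then have "\<forall>\<^sub>F n in \<omega>. NN n k (pB n (P i) \<ominus>\<^bsub>B n\<^esub> z n) < e" using tail by (rule filter_leD[rotated])
    ultimately show ?thesis unfolding near_def by blast
  qed
  then show ?thesis using a zc unfolding approx_def by blast
qed

text \<open>By \<open>uniq\<close> any approximant of \<open>a\<close> may replace the chosen
  \<open>f a\<close> modulo the null ideal, so each homomorphism law is a closure property of
  \<open>approx\<close>.\<close>

theorem embedding: "\<exists>\<iota>. trace_preserving_embedding A (metric_ultraproduct {1..} B \<omega>) \<iota>"
proof -
  interpret R: tracial_star_algebra BP by (rule tracial_BP)
  let ?Q = "metric_ultraproduct {1..} B \<omega>"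
  define q where "q = (\<lambda>z. null_ideal BP +>\<^bsub>BP\<^esub> z)"
  have Q: "q \<in> ring_hom BP ?Q"
    "\<And>z c. z \<in> carrier BP \<Longrightarrow> c \<odot>\<^bsub>?Q\<^esub> q z = q (c \<odot>\<^bsub>BP\<^esub> z)"
    "\<And>z. z \<in> carrier BP \<Longrightarrow> invol ?Q (q z) = q (invol BP z)"
    "\<And>z. z \<in> carrier BP \<Longrightarrow> tau ?Q (q z) = tau BP z"
    unfolding metric_ultraproduct_def q_def by (rule R.quotient_algebra_coset; assumption?)+
  obtain f where f: "\<And>a. a \<in> carrier A \<Longrightarrow> approx a (f a)" using approx_exists by metis
  note fc = approxD(2)[OF f]
  have uniq: "q (f a) = q z" if "approx a z" for a z
  proof -
    have a: "a \<in> carrier A" by (rule approxD(1)[OF that])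
    show ?thesis unfolding q_def
      using R.coset_eq_iff[OF fc[OF a] approxD(2)[OF that]] approx_unique[OF f[OF a] that] by blast
  qed
  have "trace_preserving_embedding A ?Q (\<lambda>a. q (f a))"
    unfolding trace_preserving_embedding_def
  proof (intro conjI ballI allI)
    show "(\<lambda>a. q (f a)) \<in> ring_hom A ?Q"
    proof (rule ring_hom_memI)
      show "q (f a) \<in> carrier ?Q" if "a \<in> carrier A" for a
        using ring_hom_closed[OF Q(1) fc[OF that]] .
      show "q (f (a \<otimes>\<^bsub>A\<^esub> b)) = q (f a) \<otimes>\<^bsub>?Q\<^esub> q (f b)" if "a \<in> carrier A" "b \<in> carrier A" for a b
        using uniq[OF approx_mult[OF f f]] ring_hom_mult[OF Q(1) fc fc] that by metis
      show "q (f (a \<oplus>\<^bsub>A\<^esub> b)) = q (f a) \<oplus>\<^bsub>?Q\<^esub> q (f b)" if "a \<in> carrier A" "b \<in> carrier A" for a b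
        using uniq[OF approx_add[OF f f]] ring_hom_add[OF Q(1) fc fc] that by metis
      show "q (f \<one>\<^bsub>A\<^esub>) = \<one>\<^bsub>?Q\<^esub>"
        using uniq[OF approx_one] ring_hom_one[OF Q(1)] by metis
    qed
    show "inj_on (\<lambda>a. q (f a)) (carrier A)"
    proof (rule inj_onI)
      fix a b assume ab: "a \<in> carrier A" "b \<in> carrier A" "q (f a) = q (f b)"
      then have "f a \<ominus>\<^bsub>BP\<^esub> f b \<in> null_ideal BP"
        using R.coset_eq_iff[OF fc[OF ab(1)] fc[OF ab(2)]] unfolding q_def by blast
      then show "a = b" using approx_inj[OF f[OF ab(1)] f[OF ab(2)]] by blast
    qed
    fix a assume a: "a \<in> carrier A"
    show "q (f (c \<odot>\<^bsub>A\<^esub> a)) = c \<odot>\<^bsub>?Q\<^esub> q (f a)" for c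
      unfolding Q(2)[OF fc[OF a]] by (rule uniq[OF approx_scale[OF f[OF a]]])
    show "q (f (invol A a)) = invol ?Q (q (f a))"
      unfolding Q(3)[OF fc[OF a]] by (rule uniq[OF approx_invol[OF f[OF a]]])
    show "tau ?Q (q (f a)) = tau A a"
      unfolding Q(4)[OF fc[OF a]] by (rule approx_tau[OF f[OF a]])
  qed
  then show ?thesis by blast
qed

end

text \<open>If the complement of some {i} were not in \<omega>, then {i} would be, and \<omega>
  would be principal. Finite intersections of such complements give all tails.\<close>

lemma nonprincipal_ultrafilter_le_sequentially:
  fixes \<omega> :: "nat filter"
  assumes "ultrafilter_on {1..} \<omega>" "nonprincipal \<omega>"
  shows "\<omega> \<le> sequentially"
proof -
  have nb: "\<omega> \<noteq> bot" and dich: "\<And>P. eventually P \<omega> \<or> eventually (\<lambda>i. \<not> P i) \<omega>"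
    using assms by (auto simp: ultrafilter_on_def)
  have ne: "eventually (\<lambda>n. n \<noteq> i) \<omega>" for i
  proof (rule ccontr)
    assume "\<not> ?thesis"
    then have i: "eventually (\<lambda>n. n = i) \<omega>" using dich[of "\<lambda>n. n = i"] by blast
    have "P i" if "eventually P \<omega>" for P
    proof (rule ccontr)
      assume "\<not> P i"
      have "eventually (\<lambda>n. False) \<omega>"
        using i that by eventually_elim (use \<open>\<not> P i\<close> in blast)
      then show False using nb by (simp add: trivial_limit_def)
    qed
    moreover have "eventually P \<omega>" if "P i" for P
      using i by (rule eventually_mono) (use that in blast)
    ultimately have "\<omega> = principal {i}"
      unfolding filter_eq_iff eventually_principal by blast
    then show False using assms(2) by (simp add: nonprincipal_def)
  qed
  show ?thesis
  proof (rule filter_leI)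
    fix P :: "nat \<Rightarrow> bool" assume "eventually P sequentially"
    then obtain m where m: "\<And>n. m \<le> n \<Longrightarrow> P n" unfolding eventually_sequentially by blast
    have "eventually (\<lambda>n. \<forall>i\<in>{..<m}. n \<noteq> i) \<omega>"
      by (rule eventually_ball_finite) (auto intro: ne)
    then show "eventually P \<omega>" by (rule eventually_mono) (use m in \<open>force simp: not_less[symmetric]\<close>)
  qed
qed

section \<open>Density and selfadjoint generators\<close>

context tracial_star_algebra
begin

text \<open>Open norm balls are the form in which density enters: a dense set meets each of them.
  The triangle inequality leaves room 1/(m+1) around each point of the ball.\<close>

lemma pnorm_open_N_ball:
  assumes a: "a \<in> carrier A"
  shows "pnorm_open A {y \<in> carrier A. N (Suc k) (y \<ominus> a) < e}"
  unfolding pnorm_open_def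
proof (intro conjI ballI)
  fix y assume "y \<in> {y \<in> carrier A. N (Suc k) (y \<ominus> a) < e}"
  then have y: "y \<in> carrier A" "N (Suc k) (y \<ominus> a) < e" by auto
  obtain m where m: "1 / real (Suc m) < e - N (Suc k) (y \<ominus> a)"
    using y reals_Archimedean[of "e - N (Suc k) (y \<ominus> a)"] by (auto simp: inverse_eq_divide)
  let ?F = "{(Suc m, 2 ^ Suc k)} :: (nat \<times> nat) set"
  have "y \<oplus> x \<in> {y \<in> carrier A. N (Suc k) (y \<ominus> a) < e}" if "x \<in> pnorm_nbhd A ?F" for x
  proof -
    have x: "x \<in> carrier A" "N (Suc k) x < 1 / real (Suc m)"
      using that by (auto simp: pnorm_nbhd_def N_def)
    have "(y \<oplus> x) \<ominus> a = (y \<ominus> a) \<oplus> x" using x y a by (simp add: minus_eq a_ac)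
    then have "N (Suc k) ((y \<oplus> x) \<ominus> a) \<le> N (Suc k) (y \<ominus> a) + N (Suc k) x"
      using N_triangle[of "y \<ominus> a" x k] x y a by simp
    then show ?thesis using x y m by simp
  qed
  moreover have "?F \<subseteq> {(n, p). 1 \<le> n \<and> 2 \<le> p \<and> even p}" by simp
  ultimately show "\<exists>F\<subseteq>{(n, p). 1 \<le> n \<and> 2 \<le> p \<and> even p}. finite F \<and>
      (\<forall>x\<in>pnorm_nbhd A F. y \<oplus> x \<in> {y \<in> carrier A. N (Suc k) (y \<ominus> a) < e})"
    by (intro exI[of _ ?F]) blast
qed auto

text \<open>Each generator is split into real part (even index) and imaginary part (odd index),
  because the letters of words are selfadjoint. Adding zero to \<open>S\<close> makes it nonempty,
  as the enumeration requires.\<close>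

lemma selfadjoint_generators:
  assumes S: "S \<subseteq> carrier A" "countable S"
  shows "\<exists>s. (\<forall>i. s i \<in> carrier A \<and> invol A (s i) = s i) \<and>
    (\<lambda>C. complex_subalgebra C A) hull S \<subseteq> range (nceval s)"
proof -
  define g where "g = from_nat_into (insert \<zero> S)"
  have rg: "range g = insert \<zero> S" unfolding g_def using S by (intro range_from_nat_into) auto
  have g: "g j \<in> carrier A" for j
    using S(1) rangeI[of g j] unfolding rg by auto
  define s where "s = (\<lambda>i. if even i then (1 / 2) \<odot> (g (i div 2) \<oplus> invol A (g (i div 2)))
    else (- \<i> / 2) \<odot> (g (i div 2) \<ominus> invol A (g (i div 2))))"
  have s: "s i \<in> carrier A" "invol A (s i) = s i" for i
    using g[of "i div 2"]
    by (auto simp: s_def invol_smult invol_add invol_invol minus_eq_scale a_comm scale_add_right scale_scale)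
  have "g j = nceval s [(1, [2 * j]), (\<i>, [2 * j + 1])]" for j
  proof -
    have "nceval s [(1, [2 * j]), (\<i>, [2 * j + 1])] = s (2 * j) \<oplus> \<i> \<odot> s (2 * j + 1)"
      using s by (simp add: nceval_Cons)
    also have "\<dots> = ((1 / 2) \<odot> g j \<oplus> (1 / 2) \<odot> invol A (g j)) \<oplus> ((1 / 2) \<odot> g j \<oplus> (- 1 / 2) \<odot> invol A (g j))"
      using g[of j] by (simp add: s_def minus_eq_scale scale_add_right scale_scale)
    also have "\<dots> = ((1 / 2) \<odot> g j \<oplus> (1 / 2) \<odot> g j) \<oplus> ((1 / 2) \<odot> invol A (g j) \<oplus> (- 1 / 2) \<odot> invol A (g j))"
      using g[of j] by (simp add: a_ac)
    also have "\<dots> = g j"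
      using g[of j] by (simp add: scale_add_left[symmetric])
    finally show ?thesis ..
  qed
  then have "range g \<subseteq> range (nceval s)" by blast
  then have "S \<subseteq> range (nceval s)" using rg by blast
  then have "(\<lambda>C. complex_subalgebra C A) hull S \<subseteq> range (nceval s)"
    by (rule hull_minimal) (rule complex_subalgebra_nceval[OF s])
  then show ?thesis using s by blast
qed

end

section \<open>Choice of the approximating sequence\<close>

lemma words_mono: "d \<le> e \<Longrightarrow> words d \<subseteq> words e"
  by (auto simp: words_def)

theorem corollary3p3:
  fixes A :: "'a tracial_algebra" and \<omega> :: "nat filter"
  assumes "trace_reduced_algebra A"
    and "\<exists>B. complex_subalgebra B A \<and> countably_generated B A \<and>
           pnorm_topology A closure_of B = carrier A"
    and "ultrafilter_on {1..} \<omega>"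
    and "nonprincipal \<omega>"
  shows "\<exists>(A\<^sub>n :: nat \<Rightarrow> (nat \<Rightarrow> complex) tracial_algebra) \<iota>.
           (\<forall>n\<ge>1. trace_reduced_algebra (A\<^sub>n n) \<and> type_I_le n (A\<^sub>n n)) \<and>
           trace_preserving_embedding A (metric_ultraproduct {1..} A\<^sub>n \<omega>) \<iota>"
proof -
  interpret T: trace_reduced_algebra A by fact
  obtain B S where S: "S \<subseteq> carrier A" "countable S" and B: "B = (\<lambda>C. complex_subalgebra C A) hull S"
    and cl: "pnorm_topology A closure_of B = carrier A"
    using assms(2) unfolding countably_generated_def by blast
  obtain s where s: "\<And>i. s i \<in> carrier A" "\<And>i. invol A (s i) = s i"
    and Bs: "B \<subseteq> range (T.nceval s)"
    using T.selfadjoint_generators[OF S] B by blast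
  have dense: "\<exists>P. T.N (Suc k) (T.nceval s P \<ominus>\<^bsub>A\<^esub> a) < e" if a: "a \<in> carrier A" and e: "0 < e" for a e k
  proof -
    let ?U = "{y \<in> carrier A. T.N (Suc k) (y \<ominus>\<^bsub>A\<^esub> a) < e}"
    have "openin (pnorm_topology A) ?U"
      unfolding openin_pnorm_topology by (rule T.pnorm_open_N_ball[OF a])
    moreover have "a \<in> ?U" using a e by (simp add: T.minus_self T.N_zero)
    moreover have "\<forall>U. a \<in> U \<and> openin (pnorm_topology A) U \<longrightarrow> (\<exists>y. y \<in> B \<and> y \<in> U)"
      using a unfolding cl[symmetric] in_closure_of by (rule conjunct2)
    ultimately obtain y where "y \<in> B" "y \<in> ?U" using spec[of _ ?U] by meson
    then show ?thesis using Bs by blast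
  qed
  define t where "t = (\<lambda>w. tau A (foldr (mult A) (map s w) (one A)))"
  interpret word_trace t unfolding t_def by (rule T.word_trace_tau[OF s])
  \<comment> \<open>The largest truncation whose algebra still has type I at index \<open>n\<close>;
    \<open>d \<le> n\<close> keeps the set finite. For n = 0 the set is empty and \<open>D 0\<close>
    unspecified, but the conclusion concerns n \<ge> 1.\<close>
  define D where "D = (\<lambda>n. Max {d. d \<le> n \<and> (card (words d))\<^sup>2 < 2 * n})"
  have fin: "finite {d. d \<le> n \<and> (card (words d))\<^sup>2 < 2 * n}" for n by simp
  have D: "(card (words (D n)))\<^sup>2 < 2 * n" if "1 \<le> n" for n
  proof -
    have "words 0 = {[]}" by (auto simp: words_def)
    then have "0 \<in> {d. d \<le> n \<and> (card (words d))\<^sup>2 < 2 * n}" using that by simp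
    then have "D n \<in> {d. d \<le> n \<and> (card (words d))\<^sup>2 < 2 * n}"
      unfolding D_def by (intro Max_in[OF fin]) blast
    then show ?thesis by simp
  qed
  \<comment> \<open>Hence \<open>D n\<close> tends to infinity, however slowly. The bound
    \<open>Suc d\<close> forces n > 0, so that a square at most n is less than 2n.\<close>
  have Dge: "d \<le> D n" if "max (Suc d) ((card (words d))\<^sup>2) \<le> n" for d n
    unfolding D_def using that by (intro Max_ge[OF fin]) auto
  obtain C x where C: "\<And>n. trace_reduced_algebra (C n :: (nat \<Rightarrow> complex) tracial_algebra)"
      "\<And>n k. (card (words (D n)))\<^sup>2 < 2 * k \<Longrightarrow> type_I_le k (C n)"
    and x: "\<And>n i. x n i \<in> carrier (C n)" "\<And>n i. invol (C n) (x n i) = x n i"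
    and close: "\<And>n w. w \<in> words (D n) \<Longrightarrow>
      cmod (tau (C n) (foldr (mult (C n)) (map (x n) w) (one (C n))) - t w) \<le> 1 / real (Suc (D n))"
    using approximate_word_trace[of "D _"] by metis
  have moments: "(\<lambda>n. tau (C n) (foldr (mult (C n)) (map (x n) w) (one (C n)))) \<longlonglongrightarrow> t w" for w
  proof (rule LIMSEQ_I)
    fix r :: real assume r: "0 < r"
    obtain d1 where d1: "1 / real (Suc d1) < r" using reals_Archimedean[OF r] by (auto simp: inverse_eq_divide)
    define d2 where "d2 = Max (insert (length w) (Suc ` set w))"
    have "length w \<le> d2" "\<And>i. i \<in> set w \<Longrightarrow> Suc i \<le> d2" unfolding d2_def by auto
    then have w2: "w \<in> words d2" by (auto simp: words_def Suc_le_eq)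
    define d where "d = max d1 d2"
    have "cmod (tau (C n) (foldr (mult (C n)) (map (x n) w) (one (C n))) - t w) < r"
      if n: "max (Suc d) ((card (words d))\<^sup>2) \<le> n" for n
    proof -
      have dn: "d \<le> D n" by (rule Dge[OF n])
      then have "w \<in> words (D n)" using w2 words_mono[of d2 "D n"] by (auto simp: d_def)
      then have "cmod (tau (C n) (foldr (mult (C n)) (map (x n) w) (one (C n))) - t w) \<le> 1 / real (Suc (D n))"
        by (rule close)
      also have "\<dots> \<le> 1 / real (Suc d1)" using dn by (intro divide_left_mono) (auto simp: d_def)
      finally show ?thesis using d1 by linarith
    qed
    then show "\<exists>no. \<forall>n\<ge>no. norm (tau (C n) (foldr (mult (C n)) (map (x n) w) (one (C n))) - t w) < r"
      by blast
  qed
  interpret moment_family A C \<omega> s x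
  proof (intro moment_family.intro tracial_family.intro moment_family_axioms.intro)
    show "tracial_star_algebra (C i)" if "i \<in> {1..}" for i
      using C(1) by (rule trace_reduced_algebra.axioms(1))
    show "\<omega> \<le> sequentially" by (rule nonprincipal_ultrafilter_le_sequentially[OF assms(3,4)])
  qed (use assms(1) s x moments dense assms(3) in \<open>auto simp: t_def\<close>)
  obtain \<iota> where "trace_preserving_embedding A (metric_ultraproduct {1..} C \<omega>) \<iota>"
    using embedding by blast
  moreover have "\<forall>n\<ge>1. trace_reduced_algebra (C n) \<and> type_I_le n (C n)"
    using C D by blast
  ultimately show ?thesis by blast
qed

end
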